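(* Let $\Sigma$ be a connected signed graph with $n$ nodes, edge set $E$, and $m=|E|$ edges, whose incidence matrix $A_\Sigma\in\mathbb{Z}^{n\times m}$ has full rank $n$. Choose a connected basis $T\subseteq E$ that contains a halfedge if $\Sigma$ contains a halfedge, and let $B$ be the corresponding binet matrix. Then the Ehrhart polynomial of the tocyclotope $\mathcal{Z}([I\mid-B^{\top}])\subseteq\mathbb{R}^{m-n}$ is $$\mathrm{ehr}_{\mathcal{Z}([I\mid-B^{\top}])}(t)=\begin{cases}\displaystyle\sum_{S}2^{\mathrm{mplc}(S)}\,t^{\,m-|S|}&\text{if }\Sigma\text{ contains a halfedge},\\[1ex]\displaystyle\sum_{S}2^{\mathrm{mplc}(S)-1}\,t^{\,m-|S|}&\text{if }\Sigma\text{ does not contain a halfedge},\end{cases}$$ where the sums run over all sets $S\subseteq E$ that contain a basis of $\Sigma$ (i.e., such that $\Sigma(S)$ contains a maximal pseudo-forest of $\Sigma$), and $$\mathrm{mplc}(S)=\min_{\tilde T\subseteq S}\bigl(\mathrm{pc}(\tilde T)+\mathrm{lc}(\tilde T)\bigr),$$ with the minimum taken over all maximal pseudo-forests $\tilde T$ of $\Sigma$ contained in $S$.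
   Context: A signed graph $\Sigma=(\Gamma,\sigma)$ consists of a finite graph $\Gamma=(V,E)$, whose edges may be links (two distinct endpoints, multiple links allowed), loops (two equal endpoints), or halfedges (exactly one endpoint), together with a sign $\sigma(e)\in\{+,-\}$ for each link and loop $e$. Positive loops and loose edges (edges with no endpoint) are excluded. With $n=|V|$, $m=|E|$, an incidence matrix $A_\Sigma\in\mathbb{Z}^{n\times m}$ has the column of an edge equal to $\pm(\mathbf{e}_j-\mathbf{e}_k)$ for a positive link with endpoints $j,k$; $\pm(\mathbf{e}_j+\mathbf{e}_k)$ for a negative link with endpoints $j,k$; $\pm\mathbf{e}_j$ for a halfedge at $j$; $\pm2\mathbf{e}_j$ for a negative loop at $j$, where the signs are determined by a chosen (arbitrary) orientation. For $F\subseteq E$, $\Sigma(F)$ is the signed graph with node set all of $V$, edge set $F$, and restricted signature. A circle is a closed path with no repeated nodes (other than first = last) or edges; two parallel links form a circle, and loops are treated separately from circles. A signed tree is a connected signed graph with no circles, loops, or halfedges (an isolated node is a signed tree). A halfedge-tree is a connected signed graph with no circles or loops and a single halfedge. A loop-tree is a connected signed graph with no circles or halfedges and a single negative loop. A pseudo-tree is a connected signed graph with no loops or halfedges that contains a single circle, this circle having an odd number of negative edges. A signed pseudo-forest is a signed graph each of whose components is a signed tree, halfedge-tree, loop-tree, or pseudo-tree. For $F\subseteq E$ with $\Sigma(F)$ a pseudo-forest, $\mathrm{lc}(F)$ and $\mathrm{pc}(F)$ denote the number of loop-tree components and pseudo-tree components of $\Sigma(F)$. The signed graphic matroid of $\Sigma$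 has ground set $E$ and independence given by linear independence of the columns of $A_\Sigma$; its independent sets are the $F$ with $\Sigma(F)$ a pseudo-forest, and its bases are the edge sets of inclusion-maximal pseudo-forests ("maximal pseudo-forests") of $\Sigma$. A basis $T$ is connected if $\Sigma(T)$ is connected. Given a basis $T$, put $R=E\setminus T$ and order the columns so that $A_\Sigma=[\mathbf{R}\mid\mathbf{T}]$, where $\mathbf{R}\in\mathbb{Z}^{n\times(m-n)}$ and the invertible matrix $\mathbf{T}\in\mathbb{Z}^{n\times n}$ consist of the columns indexed by $R$ and $T$. The binet matrix is $B=\mathbf{T}^{-1}\mathbf{R}$; for $T$ chosen as in the claim it is known to be integral. In $[I\mid-B^{\top}]$, $I$ is the $(m-n)\times(m-n)$ identity matrix. For an integer matrix $M$ with $m$ columns, $\mathcal{Z}(M)=M[0,1]^m$; $\mathcal{Z}([I\mid-B^{\top}])$ is called the tocyclotope of $\Sigma$. The Ehrhart polynomial of a lattice polytope $\mathcal{P}\subset\mathbb{R}^d$ is the polynomial with $\mathrm{ehr}_{\mathcal P}(t)=|t\mathcal{P}\cap\mathbb{Z}^d|$ for positive integers $t$. *)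

theory Defs
  imports
    "Jordan_Normal_Form.DL_Rank"
    "Jordan_Normal_Form.Gauss_Jordan_Elimination"
    "HOL-Library.Multiset"
begin

datatype edge_sign = Positive | Negative

text \<open>
  Edges are abstract labels, so parallel edges are possible. The multiset of endpoints
  distinguishes links (two distinct endpoints), loops (one endpoint with multiplicity two) and
  halfedges (a single endpoint). The sign of a halfedge is meaningless and is never used.
\<close>

record ('v, 'e) signed_graph =
  sg_nodes :: "'v set"
  sg_edges :: "'e set"
  sg_ends :: "'e \<Rightarrow> 'v multiset"
  sg_sign :: "'e \<Rightarrow> edge_sign"

definition sg_links :: "('v, 'e) signed_graph \<Rightarrow> 'e set" where
  "sg_links G = {e \<in> sg_edges G. \<exists>j k. j \<noteq> k \<and> sg_ends G e = {#j, k#}}"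

definition sg_loops :: "('v, 'e) signed_graph \<Rightarrow> 'e set" where
  "sg_loops G = {e \<in> sg_edges G. \<exists>j. sg_ends G e = {#j, j#}}"

definition sg_halfedges :: "('v, 'e) signed_graph \<Rightarrow> 'e set" where
  "sg_halfedges G = {e \<in> sg_edges G. \<exists>j. sg_ends G e = {#j#}}"

text \<open>Loose edges and positive loops are excluded.\<close>

definition is_signed_graph :: "('v, 'e) signed_graph \<Rightarrow> bool" where
  "is_signed_graph G \<longleftrightarrow>
     finite (sg_nodes G) \<and> finite (sg_edges G) \<and>
     sg_edges G = sg_links G \<union> sg_loops G \<union> sg_halfedges G \<and>
     (\<forall>e \<in> sg_edges G. set_mset (sg_ends G e) \<subseteq> sg_nodes G) \<and>
     (\<forall>e \<in> sg_loops G. sg_sign G e = Negative)"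

definition sg_restrict :: "('v, 'e) signed_graph \<Rightarrow> 'e set \<Rightarrow> ('v, 'e) signed_graph" where
  "sg_restrict G F = G\<lparr>sg_edges := F\<rparr>"

definition sg_adj :: "('v, 'e) signed_graph \<Rightarrow> 'v rel" where
  "sg_adj G = {(j, k). \<exists>e \<in> sg_links G. sg_ends G e = {#j, k#}}"

text \<open>As usual, a connected graph has at least one node.\<close>

definition sg_connected :: "('v, 'e) signed_graph \<Rightarrow> bool" where
  "sg_connected G \<longleftrightarrow>
     sg_nodes G \<noteq> {} \<and> (\<forall>j \<in> sg_nodes G. \<forall>k \<in> sg_nodes G. (j, k) \<in> (sg_adj G)\<^sup>*)"

definition sg_component :: "('v, 'e) signed_graph \<Rightarrow> 'v \<Rightarrow> ('v, 'e) signed_graph" where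
  "sg_component G j =
     (let C = {k \<in> sg_nodes G. (j, k) \<in> (sg_adj G)\<^sup>*}
      in G\<lparr>sg_nodes := C, sg_edges := {e \<in> sg_edges G. set_mset (sg_ends G e) \<subseteq> C}\<rparr>)"

definition sg_components :: "('v, 'e) signed_graph \<Rightarrow> ('v, 'e) signed_graph set" where
  "sg_components G = sg_component G ` sg_nodes G"

text \<open>
  A circle visits pairwise distinct nodes \<open>us\<close> along pairwise distinct edges \<open>es\<close>; length at
  least two admits pairs of parallel links and rules out loops. Circles are identified with
  their edge sets, so that choice of starting node and direction do not matter when counting.
\<close>

definition sg_circles :: "('v, 'e) signed_graph \<Rightarrow> 'e set set" where
  "sg_circles G = {set es | us es.
     2 \<le> length es \<and> length us = length es \<and> distinct us \<and> distinct es \<and>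
     set us \<subseteq> sg_nodes G \<and> set es \<subseteq> sg_edges G \<and>
     (\<forall>i < length es. sg_ends G (es ! i) = {#us ! i, us ! (Suc i mod length es)#})}"

definition signed_tree :: "('v, 'e) signed_graph \<Rightarrow> bool" where
  "signed_tree G \<longleftrightarrow>
     sg_connected G \<and> sg_circles G = {} \<and> sg_loops G = {} \<and> sg_halfedges G = {}"

definition halfedge_tree :: "('v, 'e) signed_graph \<Rightarrow> bool" where
  "halfedge_tree G \<longleftrightarrow>
     sg_connected G \<and> sg_circles G = {} \<and> sg_loops G = {} \<and> (\<exists>h. sg_halfedges G = {h})"

definition loop_tree :: "('v, 'e) signed_graph \<Rightarrow> bool" where
  "loop_tree G \<longleftrightarrow>
     sg_connected G \<and> sg_circles G = {} \<and> sg_halfedges G = {} \<and>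
     (\<exists>l. sg_loops G = {l} \<and> sg_sign G l = Negative)"

definition pseudo_tree :: "('v, 'e) signed_graph \<Rightarrow> bool" where
  "pseudo_tree G \<longleftrightarrow>
     sg_connected G \<and> sg_loops G = {} \<and> sg_halfedges G = {} \<and>
     (\<exists>C. sg_circles G = {C} \<and> odd (card {e \<in> C. sg_sign G e = Negative}))"

definition pseudo_forest :: "('v, 'e) signed_graph \<Rightarrow> bool" where
  "pseudo_forest G \<longleftrightarrow>
     (\<forall>K \<in> sg_components G. signed_tree K \<or> halfedge_tree K \<or> loop_tree K \<or> pseudo_tree K)"

definition lc :: "('v, 'e) signed_graph \<Rightarrow> 'e set \<Rightarrow> nat" where
  "lc G F = card {K \<in> sg_components (sg_restrict G F). loop_tree K}"

definition pc :: "('v, 'e) signed_graph \<Rightarrow> 'e set \<Rightarrow> nat" where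
  "pc G F = card {K \<in> sg_components (sg_restrict G F). pseudo_tree K}"

definition maximal_pseudo_forests :: "('v, 'e) signed_graph \<Rightarrow> 'e set set" where
  "maximal_pseudo_forests G =
     {F. F \<subseteq> sg_edges G \<and> pseudo_forest (sg_restrict G F) \<and>
         (\<forall>F'. F \<subseteq> F' \<and> F' \<subseteq> sg_edges G \<and> pseudo_forest (sg_restrict G F') \<longrightarrow> F' = F)}"

definition mplc :: "('v, 'e) signed_graph \<Rightarrow> 'e set \<Rightarrow> nat" where
  "mplc G S = Min ((\<lambda>F. pc G F + lc G F) ` {F \<in> maximal_pseudo_forests G. F \<subseteq> S})"


text \<open>
  An incidence matrix is first given as a function of nodes and edges; \<open>incidence_mat\<close> turns it
  into a matrix once the nodes and (some of) the edges have been listed. The factor \<open>s\<close> below is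
  the sign fixed by the orientation of the edge.
\<close>

inductive edge_column :: "('v, 'e) signed_graph \<Rightarrow> 'e \<Rightarrow> ('v \<Rightarrow> int) \<Rightarrow> bool"
  for G :: "('v, 'e) signed_graph" and e :: 'e where
  "j \<noteq> k \<Longrightarrow> sg_ends G e = {#j, k#} \<Longrightarrow> sg_sign G e = Positive \<Longrightarrow>
     edge_column G e (\<lambda>v. of_bool (v = j) - of_bool (v = k))"
| "j \<noteq> k \<Longrightarrow> sg_ends G e = {#j, k#} \<Longrightarrow> sg_sign G e = Negative \<Longrightarrow>
     edge_column G e (\<lambda>v. of_bool (v = j) + of_bool (v = k))"
| "sg_ends G e = {#j#} \<Longrightarrow> edge_column G e (\<lambda>v. of_bool (v = j))"
| "sg_ends G e = {#j, j#} \<Longrightarrow> sg_sign G e = Negative \<Longrightarrow>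
     edge_column G e (\<lambda>v. 2 * of_bool (v = j))"

definition is_incidence :: "('v, 'e) signed_graph \<Rightarrow> ('v \<Rightarrow> 'e \<Rightarrow> int) \<Rightarrow> bool" where
  "is_incidence G A \<longleftrightarrow>
     (\<forall>e \<in> sg_edges G. \<exists>c. \<exists>s \<in> {1, -1}. edge_column G e c \<and>
        (\<forall>v \<in> sg_nodes G. A v e = s * c v))"

definition incidence_mat :: "('v \<Rightarrow> 'e \<Rightarrow> int) \<Rightarrow> 'v list \<Rightarrow> 'e list \<Rightarrow> int mat" where
  "incidence_mat A vs es = mat (length vs) (length es) (\<lambda>(i, j). A (vs ! i) (es ! j))"

text \<open>
  Linear independence of the family of columns indexed by \<open>F\<close>; equal columns at different edges
  count as dependent.
\<close>

definition sgm_indep ::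
  "('v, 'e) signed_graph \<Rightarrow> ('v \<Rightarrow> 'e \<Rightarrow> int) \<Rightarrow> 'e set \<Rightarrow> bool" where
  "sgm_indep G A F \<longleftrightarrow> F \<subseteq> sg_edges G \<and>
     (\<forall>c :: 'e \<Rightarrow> real.
        (\<forall>v \<in> sg_nodes G. (\<Sum>e\<in>F. c e * of_int (A v e)) = 0) \<longrightarrow> (\<forall>e\<in>F. c e = 0))"

definition sgm_basis ::
  "('v, 'e) signed_graph \<Rightarrow> ('v \<Rightarrow> 'e \<Rightarrow> int) \<Rightarrow> 'e set \<Rightarrow> bool" where
  "sgm_basis G A F \<longleftrightarrow> sgm_indep G A F \<and> (\<forall>F'. F \<subseteq> F' \<and> sgm_indep G A F' \<longrightarrow> F' = F)"

text \<open>
  For listings \<open>rs\<close> of the non-basis edges and \<open>ts\<close> of the basis edges. \<open>mat_inverse\<close> returns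
  \<open>None\<close> exactly on singular square matrices, so \<open>the\<close> is meaningful whenever \<open>ts\<close> lists a
  basis of a signed graph whose incidence matrix has full row rank.
\<close>

definition binet_mat :: "('v \<Rightarrow> 'e \<Rightarrow> int) \<Rightarrow> 'v list \<Rightarrow> 'e list \<Rightarrow> 'e list \<Rightarrow> real mat" where
  "binet_mat A vs rs ts =
     the (mat_inverse (map_mat of_int (incidence_mat A vs ts)))
       * map_mat of_int (incidence_mat A vs rs)"


definition append_cols :: "'a :: zero mat \<Rightarrow> 'a mat \<Rightarrow> 'a mat" where
  "append_cols M N = four_block_mat M N (0\<^sub>m 0 (dim_col M)) (0\<^sub>m 0 (dim_col N))"

definition zonotope :: "real mat \<Rightarrow> real vec set" where
  "zonotope M =
     {M *\<^sub>v x | x. x \<in> carrier_vec (dim_col M) \<and> (\<forall>i < dim_col M. 0 \<le> x $ i \<and> x $ i \<le> 1)}"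

definition tocyclotope :: "('v \<Rightarrow> 'e \<Rightarrow> int) \<Rightarrow> 'v list \<Rightarrow> 'e list \<Rightarrow> 'e list \<Rightarrow> real vec set" where
  "tocyclotope A vs rs ts =
     zonotope (append_cols (1\<^sub>m (length rs)) (- transpose_mat (binet_mat A vs rs ts)))"

definition dilated_lattice_points :: "nat \<Rightarrow> real vec set \<Rightarrow> nat \<Rightarrow> real vec set" where
  "dilated_lattice_points d P t =
     ((\<lambda>x. of_nat t \<cdot>\<^sub>v x) ` P) \<inter> {z \<in> carrier_vec d. \<forall>i < d. z $ i \<in> \<int>}"

text \<open>
  Finiteness is stated because \<^const>\<open>card\<close> is 0 on infinite sets; it holds for every polytope.
\<close>

definition is_ehrhart_polynomial :: "nat \<Rightarrow> real vec set \<Rightarrow> real poly \<Rightarrow> bool" where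
  "is_ehrhart_polynomial d P p \<longleftrightarrow>
     (\<forall>t > 0. finite (dilated_lattice_points d P t) \<and>
        poly p (of_nat t) = of_nat (card (dilated_lattice_points d P t)))"

lemma is_ehrhart_polynomial_unique:
  assumes "is_ehrhart_polynomial d P p" and "is_ehrhart_polynomial d P q"
  shows "p = q"
proof (rule ccontr)
  assume "p \<noteq> q"
  then have "finite {x. poly (p - q) x = 0}"
    by (intro poly_roots_finite) simp
  moreover have "of_nat ` {0::nat<..} \<subseteq> {x. poly (p - q) x = 0}"
    using assms by (auto simp: is_ehrhart_polynomial_def)
  ultimately have "finite ((of_nat :: nat \<Rightarrow> real) ` {0<..})"
    by (rule finite_subset[rotated])
  then have "finite {0::nat<..}"
    by (rule finite_imageD) (auto simp: inj_on_def)
  then show False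
    using infinite_Ioi by blast
qed

end

theory Submission
  imports Defs
begin

text \<open>
  The proof replaces minors and tilings of the zonotope by counting classes of integer points.

  For \<open>z :: 'v \<Rightarrow> real\<close> let \<open>grad z e = (\<Sum>v. z v * A v e)\<close>. The map
  \<open>y \<mapsto> y\<^sub>R - B\<^sup>T y\<^sub>T\<close> given by \<open>[I | -B\<^sup>T]\<close> has the row space \<open>{grad z}\<close> of the incidence matrix
  as its kernel, and it sends the integer vectors onto the integer vectors because \<open>B\<close> is integral.
  So the lattice points of the \<open>t\<close>-th dilate are the classes of integer edge vectors \<open>x\<close>, modulo
  the lattice of integral vectors \<open>grad p\<close>, for which \<open>x - grad z\<close> lies in the cube \<open>[0, t]\<^sup>E\<close> for
  some real \<open>z\<close> (\<open>bij_betw_lattice_points_classes\<close>).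

  These classes are counted by removing one edge after the other. For an edge set \<open>S\<close> and side
  lengths \<open>u\<close>, let \<open>count S u\<close> be the number of classes over the coordinates \<open>S\<close>. If the columns
  of \<open>S - {e}\<close> still span, then forgetting the coordinate \<open>e\<close> maps the classes over \<open>S\<close> to those
  over \<open>S - {e}\<close>, and its fibres are the integers in an interval prolonged by \<open>u e\<close>. Prolonging a
  bounded nonempty interval by an integer \<open>k\<close> adds exactly \<open>k\<close> integers, whence
  \<open>count S u = count S (u(e := 0)) + u e * count (S - {e}) u\<close>. If \<open>S - {e}\<close> does not span, then
  \<open>z\<close> can absorb the coordinate \<open>e\<close> and only the first summand remains. Iterating gives
  \<open>\<Sum>S. t ^ (m - card S) * count S 0\<close> over the spanning \<open>S\<close>, that is, over the sets containing a
  basis (\<open>count_eq_sum_separating\<close>).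

  The number \<open>count S 0\<close> is the index of the group of those \<open>z\<close> that are integral on \<open>E\<close> in the
  group of those that are integral on \<open>S\<close>. Modulo 1, an element of the latter group is preserved up
  to sign along every link. Since every component of \<open>S\<close> contains a halfedge, a negative loop or an
  unbalanced circle, it is the constant 0 or 1/2 on each component, and 0 on components with a
  halfedge (\<open>potentials_iff\<close>). Hence it amounts to a choice of halfedge-free components of \<open>S\<close>. If
  the whole connected graph has no halfedge, then the constant 1/2 is integral on \<open>E\<close> as well, and
  the index is halved. The same description applied to the connected basis \<open>T\<close> shows that \<open>T\<close> and
  \<open>E\<close> have the same group, which is the integrality of \<open>B\<close> (\<open>potentials_T\<close>).

  It remains to see that \<open>mplc S\<close> is the number of halfedge-free components of \<open>S\<close>
  (\<open>mplc_eq_num_halffree\<close>). Each component of a maximal pseudo-forest contains exactly one halfedge,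
  loop or circle, so \<open>pc + lc\<close> counts its halfedge-free components; every halfedge-free component
  of \<open>S\<close> contains at least one of these, and a spanning forest of \<open>S\<close> with one extra edge in each
  component, a halfedge wherever possible, attains equality.
\<close>

section \<open>Integer points on translates of a bounded interval\<close>

text \<open>
  Shifting the integers of \<open>J\<close> by \<open>t\<close> gives integers of \<open>J + [0, t]\<close>. The missed ones are the \<open>t\<close>
  consecutive integers starting at the smallest integer \<open>m\<close> that is an upper bound of some point of \<open>J\<close>.
  Open and closed ends of \<open>J\<close> behave alike.
\<close>

lemma card_integers_extend_interval:
  fixes J :: "real set" and t :: nat
  assumes ne: "J \<noteq> {}" and conv: "\<And>a b c. a \<in> J \<Longrightarrow> b \<in> J \<Longrightarrow> a \<le> c \<Longrightarrow> c \<le> b \<Longrightarrow> c \<in> J"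
    and bound: "\<And>k. k \<in> J \<Longrightarrow> \<bar>k\<bar> \<le> B"
  shows "finite {s::int. \<exists>k\<in>J. 0 \<le> of_int s - k \<and> of_int s - k \<le> real t}"
    and "card {s::int. \<exists>k\<in>J. 0 \<le> of_int s - k \<and> of_int s - k \<le> real t}
      = card {s::int. of_int s \<in> J} + t"
proof -
  let ?L = "{s::int. \<exists>k\<in>J. 0 \<le> of_int s - k \<and> of_int s - k \<le> real t}"
  let ?I = "{s::int. of_int s \<in> J}"
  have abs_ceiling: "- \<lceil>B\<rceil> \<le> \<lceil>k\<rceil>" "\<lceil>k\<rceil> \<le> \<lceil>B\<rceil>" if "k \<in> J" for k
    using bound[OF that] by linarith+
  have "?I \<subseteq> {- \<lceil>B\<rceil> .. \<lceil>B\<rceil>}" using abs_ceiling by force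
  then have finI: "finite ?I" using finite_subset by blast
  have "ceiling ` J \<subseteq> {- \<lceil>B\<rceil> .. \<lceil>B\<rceil>}" using abs_ceiling by auto
  then have finC: "finite (ceiling ` J)" using finite_subset by blast
  define m where "m = Min (ceiling ` J)"
  have m_le: "m \<le> \<lceil>k\<rceil>" if "k \<in> J" for k using that finC by (simp add: m_def)
  obtain k1 where k1: "k1 \<in> J" "m = \<lceil>k1\<rceil>"
    using Min_in[OF finC] ne by (auto simp: m_def)
  have split: "?L = {m..<m + int t} \<union> (+) (int t) ` ?I"
  proof (intro equalityI subsetI)
    fix s assume "s \<in> ?L"
    then obtain k where k: "k \<in> J" "0 \<le> of_int s - k" "of_int s - k \<le> real t" by auto
    show "s \<in> {m..<m + int t} \<union> (+) (int t) ` ?I"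
    proof (cases "of_int (s - int t) \<in> J")
      case True
      then show ?thesis by (intro UnI2 image_eqI[of _ _ "s - int t"]) auto
    next
      case False
      have above: "of_int (s - int t) < k'" if "k' \<in> J" for k'
        using conv[of k' k "of_int (s - int t)"] that k False by force
      have "m \<le> s" using m_le[OF k(1)] k by linarith
      moreover have "s < m + int t" using above[OF k1(1)] k1(2) by linarith
      ultimately show ?thesis by simp
    qed
  next
    fix s assume "s \<in> {m..<m + int t} \<union> (+) (int t) ` ?I"
    then show "s \<in> ?L"
    proof
      assume "s \<in> {m..<m + int t}"
      then have "0 \<le> of_int s - k1" "of_int s - k1 \<le> real t" using k1(2) by auto linarith+
      then show ?thesis using k1(1) by blast
    next
      assume "s \<in> (+) (int t) ` ?I"
      then obtain i where "s = int t + i" "of_int i \<in> J" by auto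
      then show ?thesis by (auto intro!: bexI[of _ "of_int i"])
    qed
  qed
  have disj: "{m..<m + int t} \<inter> (+) (int t) ` ?I = {}"
    using m_le by fastforce
  show "finite ?L" unfolding split using finI by simp
  show "card ?L = card ?I + t"
    unfolding split using finI disj by (subst card_Un_disjoint) (auto simp: card_image)
qed

section \<open>Pairings with a finite vector configuration\<close>

definition pairing :: "'v set \<Rightarrow> ('v \<Rightarrow> 'e \<Rightarrow> real) \<Rightarrow> ('v \<Rightarrow> real) \<Rightarrow> 'e \<Rightarrow> real" where
  "pairing V a z e = (\<Sum>v\<in>V. z v * a v e)"

lemma pairing_add: "pairing V a (\<lambda>v. y v + z v) e = pairing V a y e + pairing V a z e"
  by (simp add: pairing_def sum.distrib algebra_simps)

lemma pairing_diff: "pairing V a (\<lambda>v. y v - z v) e = pairing V a y e - pairing V a z e"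
  by (simp add: pairing_def sum_subtractf algebra_simps)

lemma pairing_scale: "pairing V a (\<lambda>v. r * z v) e = r * pairing V a z e"
  by (simp add: pairing_def sum_distrib_left algebra_simps)

lemma pairing_zero [simp]: "pairing V a (\<lambda>v. 0) e = 0"
  by (simp add: pairing_def)

text \<open>
  Dual form of spanning: by \<open>span_or_separated\<close> below, \<open>separating V a S\<close> says that the vectors
  \<open>\<lambda>v. a v e\<close> with \<open>e \<in> S\<close> span the space of all functions on \<open>V\<close>.
\<close>

definition separating :: "'v set \<Rightarrow> ('v \<Rightarrow> 'e \<Rightarrow> real) \<Rightarrow> 'e set \<Rightarrow> bool" where
  "separating V a S \<longleftrightarrow> (\<forall>z. (\<forall>e\<in>S. pairing V a z e = 0) \<longrightarrow> (\<forall>v\<in>V. z v = 0))"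

lemma separating_mono: "separating V a S \<Longrightarrow> S \<subseteq> S' \<Longrightarrow> separating V a S'"
  by (auto simp: separating_def)

text \<open>
  The Fredholm alternative for finitely many vectors. When a vector \<open>g\<close> is added and the given
  functional \<open>z\<close> does not vanish on it, the induction hypothesis is applied to the translate of
  \<open>b\<close> along \<open>g\<close> that \<open>z\<close> annihilates; a functional separating this translate becomes orthogonal to
  \<open>g\<close> after subtracting a multiple of \<open>z\<close>.
\<close>

lemma span_or_separated:
  fixes a :: "'v \<Rightarrow> 'e \<Rightarrow> real" and b :: "'v \<Rightarrow> real"
  assumes "finite V" and "finite F"
  shows "(\<exists>c. \<forall>v\<in>V. b v = (\<Sum>f\<in>F. c f * a v f)) \<or>
    (\<exists>z. (\<forall>f\<in>F. pairing V a z f = 0) \<and> (\<Sum>v\<in>V. z v * b v) \<noteq> 0)"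
  using assms(2)
proof (induction F arbitrary: b)
  case empty
  show ?case
  proof (cases "\<exists>w\<in>V. b w \<noteq> 0")
    case True
    then obtain w where w: "w \<in> V" "b w \<noteq> 0" by blast
    have "(\<Sum>v\<in>V. of_bool (v = w) * b v) = (\<Sum>v\<in>V. if v = w then b v else 0)"
      by (rule sum.cong) auto
    then have "(\<Sum>v\<in>V. of_bool (v = w) * b v) \<noteq> 0" using w assms(1) by simp
    then show ?thesis by (intro disjI2 exI[of _ "\<lambda>v. of_bool (v = w)"]) auto
  qed auto
next
  case (insert g F)
  show ?case
  proof (cases "\<exists>c. \<forall>v\<in>V. b v = (\<Sum>f\<in>F. c f * a v f)")
    case True
    then obtain c where c: "\<forall>v\<in>V. b v = (\<Sum>f\<in>F. c f * a v f)" by blast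
    have "\<forall>v\<in>V. b v = (\<Sum>f\<in>insert g F. (c(g := 0)) f * a v f)"
    proof
      fix v assume "v \<in> V"
      have "(\<Sum>f\<in>insert g F. (c(g := 0)) f * a v f) = (\<Sum>f\<in>F. (c(g := 0)) f * a v f)"
        using insert.hyps by simp
      also have "\<dots> = (\<Sum>f\<in>F. c f * a v f)"
        using insert.hyps by (intro sum.cong) auto
      finally show "b v = (\<Sum>f\<in>insert g F. (c(g := 0)) f * a v f)" using c \<open>v \<in> V\<close> by simp
    qed
    then show ?thesis by blast
  next
    case False
    then obtain z where z: "\<forall>f\<in>F. pairing V a z f = 0" "(\<Sum>v\<in>V. z v * b v) \<noteq> 0"
      using insert.IH by blast
    show ?thesis
    proof (cases "pairing V a z g = 0")
      case True
      then show ?thesis using z by (intro disjI2 exI[of _ z]) auto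
    next
      case zg: False
      \<comment> \<open>Subtract the multiple of column \<open>g\<close> that makes \<open>b\<close> orthogonal to \<open>z\<close>.\<close>
      define r where "r = (\<Sum>v\<in>V. z v * b v) / pairing V a z g"
      define b' where "b' = (\<lambda>v. b v - r * a v g)"
      have zb': "(\<Sum>v\<in>V. y v * b' v) = (\<Sum>v\<in>V. y v * b v) - r * pairing V a y g" for y
        by (simp add: b'_def pairing_def algebra_simps sum_subtractf sum_distrib_left)
      have zero: "(\<Sum>v\<in>V. z v * b' v) = 0" using zg by (simp add: zb' r_def)
      from insert.IH[of b'] show ?thesis
      proof
        assume "\<exists>c. \<forall>v\<in>V. b' v = (\<Sum>f\<in>F. c f * a v f)"
        then obtain c where c: "\<forall>v\<in>V. b' v = (\<Sum>f\<in>F. c f * a v f)" by blast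
        have "\<forall>v\<in>V. b v = (\<Sum>f\<in>insert g F. (c(g := r)) f * a v f)"
        proof
          fix v assume v: "v \<in> V"
          have "(\<Sum>f\<in>F. (c(g := r)) f * a v f) = (\<Sum>f\<in>F. c f * a v f)"
            using insert.hyps by (intro sum.cong) auto
          then show "b v = (\<Sum>f\<in>insert g F. (c(g := r)) f * a v f)"
            using c v insert.hyps by (simp add: b'_def algebra_simps)
        qed
        then show ?thesis by blast
      next
        assume "\<exists>z. (\<forall>f\<in>F. pairing V a z f = 0) \<and> (\<Sum>v\<in>V. z v * b' v) \<noteq> 0"
        then obtain y where y: "\<forall>f\<in>F. pairing V a y f = 0" "(\<Sum>v\<in>V. y v * b' v) \<noteq> 0" by blast
        define q where "q = pairing V a y g / pairing V a z g"
        define x where "x = (\<lambda>v. y v - q * z v)"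
        have x: "pairing V a x f = pairing V a y f - q * pairing V a z f" for f
          by (simp add: x_def pairing_diff pairing_scale)
        have xg: "pairing V a x g = 0" using zg by (simp add: x q_def)
        have "(\<Sum>v\<in>V. x v * b' v) = (\<Sum>v\<in>V. y v * b' v) - q * (\<Sum>v\<in>V. z v * b' v)"
          by (simp add: x_def algebra_simps sum_subtractf sum_distrib_left)
        then have "(\<Sum>v\<in>V. x v * b v) \<noteq> 0" using zb'[of x] xg zero y(2) by simp
        moreover have "\<forall>f\<in>insert g F. pairing V a x f = 0" using xg x y z by simp
        ultimately show ?thesis by blast
      qed
    qed
  qed
qed

text \<open>
  The quantitative content of spanning: the value of a pairing at any edge is bounded once its values
  on \<open>S\<close> are.
\<close>

lemma separating_imp_pairing_combination:
  assumes "finite V" and "finite S" and "separating V a S"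
  obtains c where "\<And>z. pairing V a z e = (\<Sum>f\<in>S. c f * pairing V a z f)"
proof -
  have "\<not> (\<exists>z. (\<forall>f\<in>S. pairing V a z f = 0) \<and> (\<Sum>v\<in>V. z v * a v e) \<noteq> 0)"
    using assms(3) by (auto simp: separating_def)
  with span_or_separated[OF assms(1,2), of "\<lambda>v. a v e" a]
  obtain c where c: "\<And>v. v \<in> V \<Longrightarrow> a v e = (\<Sum>f\<in>S. c f * a v f)" by blast
  have "pairing V a z e = (\<Sum>f\<in>S. c f * pairing V a z f)" for z
  proof -
    have "pairing V a z e = (\<Sum>v\<in>V. \<Sum>f\<in>S. z v * (c f * a v f))"
      by (simp add: pairing_def c sum_distrib_left)
    also have "\<dots> = (\<Sum>f\<in>S. \<Sum>v\<in>V. z v * (c f * a v f))" by (rule sum.swap)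
    finally show ?thesis by (simp add: pairing_def sum_distrib_left algebra_simps)
  qed
  then show thesis by (rule that)
qed

section \<open>Counting cube points modulo a lattice\<close>

text \<open>
  \<open>P\<close> is a group of functions whose pairings with the edges in \<open>E\<close> are integers; integer edge vectors
  are counted modulo these pairings. The vectors range over all functions \<open>'e \<Rightarrow> int\<close>, and the relation
  compares only the coordinates in \<open>S\<close>, so that deleting an edge does not change the ambient type.
\<close>

locale pairing_lattice =
  fixes V :: "'v set" and E :: "'e set" and a :: "'v \<Rightarrow> 'e \<Rightarrow> real" and P :: "('v \<Rightarrow> real) set"
  assumes finite_V: "finite V" and finite_E: "finite E"
    and zero_P: "(\<lambda>v. 0) \<in> P"
    and diff_P: "p \<in> P \<Longrightarrow> q \<in> P \<Longrightarrow> (\<lambda>v. p v - q v) \<in> P"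
    and integral_P: "p \<in> P \<Longrightarrow> e \<in> E \<Longrightarrow> pairing V a p e \<in> \<int>"
begin

abbreviation pair :: "('v \<Rightarrow> real) \<Rightarrow> 'e \<Rightarrow> real" where
  "pair \<equiv> pairing V a"

abbreviation fits :: "'e set \<Rightarrow> ('e \<Rightarrow> nat) \<Rightarrow> ('e \<Rightarrow> int) \<Rightarrow> ('v \<Rightarrow> real) \<Rightarrow> bool" where
  "fits S u x z \<equiv> \<forall>f\<in>S. 0 \<le> of_int (x f) - pair z f \<and> of_int (x f) - pair z f \<le> real (u f)"

text \<open>
  The integer points of the sum of the box with side lengths \<open>u\<close> and the space of all pairings, seen
  in the coordinates \<open>S\<close>.
\<close>

definition reach :: "'e set \<Rightarrow> ('e \<Rightarrow> nat) \<Rightarrow> ('e \<Rightarrow> int) set" where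
  "reach S u = {x. \<exists>z. fits S u x z}"

definition lattice_rel :: "'e set \<Rightarrow> ('e \<Rightarrow> int) rel" where
  "lattice_rel S = {(x, y). \<exists>p\<in>P. \<forall>f\<in>S. of_int (x f) - of_int (y f) = pair p f}"

lemma equiv_lattice_rel: "equiv UNIV (lattice_rel S)"
proof (rule equivI)
  show "refl (lattice_rel S)"
    using zero_P by (auto simp: refl_on_def lattice_rel_def intro!: bexI[of _ "\<lambda>v. 0"])
  show "sym (lattice_rel S)"
  proof (rule symI)
    fix x y assume "(x, y) \<in> lattice_rel S"
    then obtain p where p: "p \<in> P" "\<forall>f\<in>S. of_int (x f) - of_int (y f) = pair p f"
      by (auto simp: lattice_rel_def)
    have "\<forall>f\<in>S. of_int (y f) - of_int (x f) = pair (\<lambda>v. 0 - p v) f"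
      using p(2) by (subst pairing_diff) force
    then show "(y, x) \<in> lattice_rel S"
      using diff_P[OF zero_P p(1)] by (auto simp: lattice_rel_def)
  qed
  show "trans (lattice_rel S)"
  proof (rule transI)
    fix x y w assume "(x, y) \<in> lattice_rel S" "(y, w) \<in> lattice_rel S"
    then obtain p q where p: "p \<in> P" "\<forall>f\<in>S. of_int (x f) - of_int (y f) = pair p f"
      and q: "q \<in> P" "\<forall>f\<in>S. of_int (y f) - of_int (w f) = pair q f"
      by (auto simp: lattice_rel_def)
    have "\<forall>f\<in>S. of_int (x f) - of_int (w f) = pair (\<lambda>v. p v - (0 - q v)) f"
      using p(2) q(2) unfolding pairing_diff pairing_zero by force
    then show "(x, w) \<in> lattice_rel S"
      using diff_P[OF p(1) diff_P[OF zero_P q(1)]] by (auto simp: lattice_rel_def)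
  qed
qed auto

lemma reach_closed:
  assumes "(x, y) \<in> lattice_rel S" and "y \<in> reach S u"
  shows "x \<in> reach S u"
proof -
  obtain p where p: "p \<in> P" "\<forall>f\<in>S. of_int (x f) - of_int (y f) = pair p f"
    using assms(1) by (auto simp: lattice_rel_def)
  obtain z where z: "fits S u y z"
    using assms(2) by (auto simp: reach_def)
  have "\<forall>f\<in>S. of_int (x f) - pair (\<lambda>v. z v + p v) f = of_int (y f) - pair z f"
    using p(2) unfolding pairing_add by force
  then show ?thesis
    using z unfolding reach_def by (intro CollectI exI[of _ "\<lambda>v. z v + p v"]) simp
qed

lemma reach_cong: "(\<And>f. f \<in> S \<Longrightarrow> u f = w f) \<Longrightarrow> reach S u = reach S w"
  by (auto simp: reach_def)

lemma reach_mono: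
  assumes "\<And>f. f \<in> S \<Longrightarrow> u f \<le> w f"
  shows "reach S u \<subseteq> reach S w"
proof
  fix x assume "x \<in> reach S u"
  then obtain z where z: "fits S u x z" by (auto simp: reach_def)
  have "real (u f) \<le> real (w f)" if "f \<in> S" for f using assms that by simp
  with z have "fits S w x z" by (meson order.trans)
  then show "x \<in> reach S w" unfolding reach_def by blast
qed

definition count :: "'e set \<Rightarrow> ('e \<Rightarrow> nat) \<Rightarrow> nat" where
  "count S u = card (reach S u // lattice_rel S)"

text \<open>
  Over a fixed \<open>x\<close> the admissible values at \<open>e\<close> form the set \<open>J + [0, u e]\<close>, where \<open>J\<close> collects the
  values of \<open>pair z e\<close> over all \<open>z\<close> that are good for the other edges. \<open>J\<close> is convex because
  the conditions on \<open>z\<close> are, and bounded because \<open>S - {e}\<close> separates.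
\<close>

lemma card_fibre:
  assumes e: "e \<in> S" and S: "S \<subseteq> E" and sep: "separating V a (S - {e})"
    and x: "x \<in> reach (S - {e}) u"
  shows "finite {s. x(e := x e + s) \<in> reach S u}"
    and "card {s. x(e := x e + s) \<in> reach S u}
      = card {s. x(e := x e + s) \<in> reach S (u(e := 0))} + u e"
proof -
  define good where "good z \<longleftrightarrow> (fits (S - {e}) u x z)" for z
  define J where "J = {pair z e - of_int (x e) | z. good z}"
  have mem: "x(e := x e + s) \<in> reach S w \<longleftrightarrow>
      (\<exists>k\<in>J. 0 \<le> of_int s - k \<and> of_int s - k \<le> real (w e))"
    if "\<And>f. f \<in> S - {e} \<Longrightarrow> w f = u f" for s w
  proof -
    have "x(e := x e + s) \<in> reach S w \<longleftrightarrow> (\<exists>z. good z \<and>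
        0 \<le> of_int s - (pair z e - of_int (x e)) \<and>
        of_int s - (pair z e - of_int (x e)) \<le> real (w e))"
      unfolding reach_def good_def mem_Collect_eq
      by (intro arg_cong[of _ _ Ex] ext) (use e that in \<open>auto simp: algebra_simps\<close>)
    then show ?thesis by (auto simp: J_def)
  qed
  obtain c where c: "\<And>z. pair z e = (\<Sum>f\<in>S - {e}. c f * pair z f)"
    using separating_imp_pairing_combination[OF finite_V _ sep] finite_E S
    by (meson finite_Diff finite_subset)
  have ne: "J \<noteq> {}" using x by (auto simp: J_def good_def reach_def)
  have bound: "\<bar>k\<bar> \<le> (\<Sum>f\<in>S - {e}. \<bar>c f\<bar> * (\<bar>of_int (x f)\<bar> + real (u f))) + \<bar>of_int (x e)\<bar>"
    if "k \<in> J" for k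
  proof -
    obtain z where k: "k = pair z e - of_int (x e)" and z: "good z"
      using \<open>k \<in> J\<close> by (auto simp: J_def)
    have "\<bar>pair z e\<bar> \<le> (\<Sum>f\<in>S - {e}. \<bar>c f\<bar> * (\<bar>of_int (x f)\<bar> + real (u f)))"
      unfolding c
    proof (rule order.trans[OF sum_abs sum_mono])
      fix f assume "f \<in> S - {e}"
      with z have "\<bar>pair z f\<bar> \<le> \<bar>of_int (x f)\<bar> + real (u f)"
        unfolding good_def by (smt (verit))
      then show "\<bar>c f * pair z f\<bar> \<le> \<bar>c f\<bar> * (\<bar>of_int (x f)\<bar> + real (u f))"
        by (simp add: abs_mult mult_left_mono)
    qed
    then show ?thesis using k by linarith
  qed
  have conv: "m \<in> J" if k: "k \<in> J" and l: "l \<in> J" and m: "k \<le> m" "m \<le> l" for k l m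
  proof (cases "k = l")
    case True then show ?thesis using that by simp
  next
    case False
    obtain y z where y: "k = pair y e - of_int (x e)" "good y"
      and z: "l = pair z e - of_int (x e)" "good z"
      using k l by (auto simp: J_def)
    define r where "r = (m - k) / (l - k)"
    have r: "0 \<le> r" "r \<le> 1" using m False by (auto simp: r_def divide_simps)
    define w where "w = (\<lambda>v. (1 - r) * y v + r * z v)"
    have w: "pair w f = (1 - r) * pair y f + r * pair z f" for f
      by (simp add: w_def pairing_add pairing_scale)
    have "good w"
      unfolding good_def
    proof
      fix f assume f: "f \<in> S - {e}"
      have eq: "of_int (x f) - pair w f =
          (1 - r) * (of_int (x f) - pair y f) + r * (of_int (x f) - pair z f)"
        unfolding w by (simp add: algebra_simps)
      have "0 \<le> of_int (x f) - pair w f"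
        unfolding eq using f y(2) z(2) r by (auto simp: good_def)
      moreover have "of_int (x f) - pair w f \<le> real (u f)"
        unfolding eq using f y(2) z(2) r by (intro convex_bound_le) (auto simp: good_def)
      ultimately show "0 \<le> of_int (x f) - pair w f \<and>
          of_int (x f) - pair w f \<le> real (u f)" ..
    qed
    moreover have "m = pair w e - of_int (x e)"
    proof -
      have "pair w e - of_int (x e) = k + r * (l - k)"
        unfolding w y(1) z(1) by (simp add: algebra_simps)
      also have "r * (l - k) = m - k" using False by (simp add: r_def)
      finally show ?thesis by simp
    qed
    ultimately show ?thesis by (auto simp: J_def)
  qed
  have u: "{s. x(e := x e + s) \<in> reach S u} =
      {s. \<exists>k\<in>J. 0 \<le> of_int s - k \<and> of_int s - k \<le> real (u e)}"
    by (simp add: mem)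
  have u0: "{s. x(e := x e + s) \<in> reach S (u(e := 0))} =
      {s. of_int s \<in> J}"
    by (subst mem) (auto intro: bexI[of _ "of_int _"])
  show "finite {s. x(e := x e + s) \<in> reach S u}"
    unfolding u by (rule card_integers_extend_interval(1)[OF ne conv bound])
  show "card {s. x(e := x e + s) \<in> reach S u}
      = card {s. x(e := x e + s) \<in> reach S (u(e := 0))} + u e"
    unfolding u u0 by (rule card_integers_extend_interval(2)[OF ne conv bound])
qed

text \<open>
  Classes over \<open>S\<close> are pairs of a class over \<open>S - {e}\<close> and an integer, namely the value at \<open>e\<close>
  relative to a chosen representative. The integer is unique: an element of \<open>P\<close> pairing to zero
  with \<open>S - {e}\<close> vanishes on \<open>V\<close>.
\<close>

lemma bij_betw_fibres:
  assumes e: "e \<in> S" and S: "S \<subseteq> E" and sep: "separating V a (S - {e})"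
  shows "bij_betw (\<lambda>(c, s). lattice_rel S `` {(\<some>x. x \<in> c)(e := (\<some>x. x \<in> c) e + s)})
    (SIGMA c : reach (S - {e}) u // lattice_rel (S - {e}).
      {s. (\<some>x. x \<in> c)(e := (\<some>x. x \<in> c) e + s) \<in> reach S u})
    (reach S u // lattice_rel S)"
    (is "bij_betw ?\<psi> ?D _")
proof -
  let ?R = "lattice_rel S" and ?R' = "lattice_rel (S - {e})"
  have eqv: "equiv UNIV ?R" and eqv': "equiv UNIV ?R'" by (rule equiv_lattice_rel)+
  define r :: "('e \<Rightarrow> int) set \<Rightarrow> 'e \<Rightarrow> int" where "r c = (\<some>x. x \<in> c)" for c
  have r: "r (?R' `` {x}) \<in> ?R' `` {x}" for x
    unfolding r_def by (rule someI[of _ x]) (use eqv' in \<open>auto simp: equiv_def refl_on_def\<close>)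
  have class_r: "c = ?R' `` {r c}" if "c \<in> reach (S - {e}) u // ?R'" for c
  proof -
    from that obtain x where "c = ?R' `` {x}" by (auto elim: quotientE)
    moreover have "(x, r c) \<in> ?R'" using r[of x] calculation by simp
    ultimately show ?thesis using equiv_class_eq[OF eqv'] by simp
  qed
  have inj: "inj_on ?\<psi> ?D"
  proof (rule inj_onI, clarify, fold r_def)
    fix c s d t
    assume c: "c \<in> reach (S - {e}) u // ?R'" and d: "d \<in> reach (S - {e}) u // ?R'"
      and "?R `` {(r c)(e := r c e + s)} = ?R `` {(r d)(e := r d e + t)}"
    then have "((r c)(e := r c e + s), (r d)(e := r d e + t)) \<in> ?R"
      using eq_equiv_class[OF _ eqv] by blast
    then obtain p where p: "p \<in> P" "\<forall>f\<in>S. of_int (((r c)(e := r c e + s)) f)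
        - of_int (((r d)(e := r d e + t)) f) = pair p f"
      unfolding lattice_rel_def by blast
    have p': "\<forall>f\<in>S - {e}. of_int (r c f) - of_int (r d f) = pair p f"
    proof
      fix f assume "f \<in> S - {e}"
      then show "of_int (r c f) - of_int (r d f) = pair p f"
        using p(2)[rule_format, of f] by simp
    qed
    then have "(r c, r d) \<in> ?R'" using p(1) by (auto simp: lattice_rel_def)
    then have cd: "c = d" using class_r[OF c] class_r[OF d] equiv_class_eq[OF eqv'] by metis
    then have "\<forall>f\<in>S - {e}. pair p f = 0" using p' by simp
    then have "\<forall>v\<in>V. p v = 0" using sep by (simp add: separating_def)
    then have "pair p e = 0" by (simp add: pairing_def)
    then have "s = t" using p(2)[rule_format, OF e] cd by simp
    with cd show "c = d \<and> s = t" ..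
  qed
  have "?\<psi> ` ?D = reach S u // ?R"
  proof (intro equalityI subsetI)
    fix X assume "X \<in> ?\<psi> ` ?D"
    then show "X \<in> reach S u // ?R" by (auto intro: quotientI)
  next
    fix X assume "X \<in> reach S u // ?R"
    then obtain x where X: "X = ?R `` {x}" and x: "x \<in> reach S u" by (auto elim: quotientE)
    define c where "c = ?R' `` {x}"
    have "x \<in> reach (S - {e}) u" using x by (auto simp: reach_def)
    then have c: "c \<in> reach (S - {e}) u // ?R'" unfolding c_def by (rule quotientI)
    have "(x, r c) \<in> ?R'" using r[of x] by (simp add: c_def)
    then obtain p where p: "p \<in> P"
      "\<forall>f\<in>S - {e}. of_int (x f) - of_int (r c f) = pair p f"
      by (auto simp: lattice_rel_def)
    obtain k where k: "pair p e = of_int k"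
      using integral_P[OF p(1)] e S by (meson Ints_cases subsetD)
    define s where "s = x e - k - r c e"
    have rel: "(x, (r c)(e := r c e + s)) \<in> ?R"
      using p k by (auto simp: lattice_rel_def s_def intro!: bexI[of _ p])
    then have "(r c)(e := r c e + s) \<in> reach S u"
      using reach_closed x eqv by (meson equivE symE)
    then have "(c, s) \<in> ?D" using c by (simp add: r_def)
    moreover have "X = ?\<psi> (c, s)"
      using equiv_class_eq[OF eqv rel] by (simp add: X r_def)
    ultimately show "X \<in> ?\<psi> ` ?D" by blast
  qed
  with inj show ?thesis by (simp add: bij_betw_def)
qed

text \<open>
  Both \<open>u\<close> and \<open>u(e := 0)\<close> lead to the same classes over \<open>S - {e}\<close>, and each fibre of the former is
  larger by \<open>u e\<close>.
\<close>

lemma count_delete_contract: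
  assumes e: "e \<in> S" and S: "S \<subseteq> E" and sep: "separating V a (S - {e})"
    and fin: "finite (reach (S - {e}) u // lattice_rel (S - {e}))"
  shows "finite (reach S u // lattice_rel S)"
    and "count S u = count S (u(e := 0)) + u e * count (S - {e}) u"
proof -
  let ?C = "reach (S - {e}) u // lattice_rel (S - {e})"
  define r :: "('e \<Rightarrow> int) set \<Rightarrow> 'e \<Rightarrow> int" where "r c = (\<some>x. x \<in> c)" for c
  define K where "K w c = {s. (r c)(e := r c e + s) \<in> reach S w}" for w c
  have r: "r c \<in> reach (S - {e}) u" if c: "c \<in> ?C" for c
  proof -
    from c obtain x where x: "x \<in> reach (S - {e}) u" "c = lattice_rel (S - {e}) `` {x}"
      by (auto elim: quotientE)
    then have "x \<in> c" using equiv_lattice_rel[of "S - {e}"] by (auto simp: equiv_def refl_on_def)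
    then have "r c \<in> c" unfolding r_def by (rule someI[of "\<lambda>x. x \<in> c"])
    then show ?thesis
      using x reach_closed equiv_lattice_rel[of "S - {e}"] by (metis Image_singleton_iff equivE symE)
  qed
  have K: "finite (K u c)" "card (K u c) = card (K (u(e := 0)) c) + u e" if "c \<in> ?C" for c
    using card_fibre[OF e S sep r[OF that]] unfolding K_def by auto
  have "reach S (u(e := 0)) \<subseteq> reach S u" by (rule reach_mono) simp
  then have sub: "K (u(e := 0)) c \<subseteq> K u c" for c by (auto simp: K_def)
  have reach0: "reach (S - {e}) (u(e := 0)) = reach (S - {e}) u" by (rule reach_cong) auto
  have bij: "bij_betw (\<lambda>(c, s). lattice_rel S `` {(r c)(e := r c e + s)})
      (Sigma ?C (K w)) (reach S w // lattice_rel S)" if "w = u \<or> w = u(e := 0)" for w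
    using that bij_betw_fibres[OF e S sep, of w] unfolding r_def K_def by (auto simp: reach0)
  have "finite (Sigma ?C (K u))" using fin K by blast
  then show "finite (reach S u // lattice_rel S)" using bij_betw_finite[OF bij[of u]] by blast
  have "count S w = (\<Sum>c\<in>?C. card (K w c))" if w: "w = u \<or> w = u(e := 0)" for w
  proof -
    have "count S w = card (Sigma ?C (K w))"
      unfolding count_def using bij_betw_same_card[OF bij[OF w]] by simp
    also have "\<dots> = (\<Sum>c\<in>?C. card (K w c))"
      using w K finite_subset[OF sub] fin by (intro card_SigmaI) auto
    finally show ?thesis .
  qed
  then have u: "count S u = (\<Sum>c\<in>?C. card (K u c))"
    and u0: "count S (u(e := 0)) = (\<Sum>c\<in>?C. card (K (u(e := 0)) c))" by blast+
  have "(\<Sum>c\<in>?C. card (K u c)) = (\<Sum>c\<in>?C. card (K (u(e := 0)) c) + u e)"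
    by (rule sum.cong[OF refl K(2)])
  then show "count S u = count S (u(e := 0)) + u e * count (S - {e}) u"
    unfolding u u0 count_def[of "S - {e}"] by (simp only: sum.distrib sum_constant of_nat_id mult.commute)
qed

text \<open>
  If \<open>S - {e}\<close> does not separate but \<open>S\<close> does, then some \<open>y\<close> pairs to zero with all edges of \<open>S\<close>
  except \<open>e\<close>, and adding a multiple of \<open>y\<close> to \<open>z\<close> makes the difference at \<open>e\<close> vanish.
\<close>

lemma reach_coloop:
  assumes e: "e \<in> S" and sep: "separating V a S" and nsep: "\<not> separating V a (S - {e})"
  shows "reach S u = reach S (u(e := 0))"
proof
  show "reach S (u(e := 0)) \<subseteq> reach S u" by (rule reach_mono) simp
  show "reach S u \<subseteq> reach S (u(e := 0))"
  proof
    fix x assume "x \<in> reach S u"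
    then obtain z where z: "fits S u x z" by (auto simp: reach_def)
    obtain y where y: "\<forall>f\<in>S - {e}. pair y f = 0" "\<not> (\<forall>v\<in>V. y v = 0)"
      using nsep by (auto simp: separating_def)
    then have ye: "pair y e \<noteq> 0" using sep e by (auto simp: separating_def)
    define q where "q = (of_int (x e) - pair z e) / pair y e"
    define w where "w = (\<lambda>v. z v + q * y v)"
    have w: "pair w f = pair z f + q * pair y f" for f
      by (simp add: w_def pairing_add pairing_scale)
    have "fits S (u(e := 0)) x w"
    proof
      fix f assume f: "f \<in> S"
      show "0 \<le> of_int (x f) - pair w f \<and>
       of_int (x f) - pair w f \<le> real ((u(e := 0)) f)"
      proof (cases "f = e")
        case True then show ?thesis using ye by (simp add: w q_def)
      next
        case False then show ?thesis using f y(1) z by (simp add: w)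
      qed
    qed
    then show "x \<in> reach S (u(e := 0))" unfolding reach_def by blast
  qed
qed

text \<open>
  The refined Ehrhart polynomial of the projected box, as a polynomial in the side lengths. The set
  \<open>M\<close> of edges with a possibly nonzero side length is the induction variable; \<open>U\<close> collects the edges
  at which the second summand of \<open>count_delete_contract\<close> was taken.
\<close>

theorem count_eq_sum_separating:
  assumes fin: "\<And>S. S \<subseteq> E \<Longrightarrow> separating V a S \<Longrightarrow> finite (reach S (\<lambda>_. 0) // lattice_rel S)"
    and S: "S \<subseteq> E" and sep: "separating V a S" and M: "M \<subseteq> S"
  shows "finite (reach S (\<lambda>f. if f \<in> M then u f else 0) // lattice_rel S) \<and>
    count S (\<lambda>f. if f \<in> M then u f else 0) =
      (\<Sum>U | U \<subseteq> M \<and> separating V a (S - U). (\<Prod>f\<in>U. u f) * count (S - U) (\<lambda>_. 0))"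
proof -
  have "finite M" using M S finite_E by (meson finite_subset)
  then show ?thesis using S sep M
  proof (induction M arbitrary: S)
    case empty
    have "{U. U \<subseteq> {} \<and> separating V a (S - U)} = {{}}" using empty by auto
    then show ?case using fin empty by simp
  next
    case (insert e M)
    let ?w = "\<lambda>f. if f \<in> insert e M then u f else 0"
    let ?wM = "\<lambda>f. if f \<in> M then u f else 0"
    let ?T = "\<lambda>S M. {U. U \<subseteq> M \<and> separating V a (S - U)}"
    let ?g = "\<lambda>S U. (\<Prod>f\<in>U. u f) * count (S - U) (\<lambda>_. 0)"
    have w0: "?w(e := 0) = ?wM" using insert.hyps by auto
    have e: "e \<in> S" and MS: "M \<subseteq> S" using insert.prems by auto
    have finT: "finite (?T S' M)" for S'
      by (rule finite_subset[of _ "Pow M"]) (use insert.hyps in auto)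
    note IH = insert.IH[OF insert.prems(1,2) MS]
    have split: "?T S (insert e M) = ?T S M \<union> insert e ` ?T (S - {e}) M"
    proof (intro equalityI subsetI)
      fix U assume U: "U \<in> ?T S (insert e M)"
      show "U \<in> ?T S M \<union> insert e ` ?T (S - {e}) M"
      proof (cases "e \<in> U")
        case True
        then have "U = insert e (U - {e})" "S - {e} - (U - {e}) = S - U" by auto
        then show ?thesis using U by (intro UnI2 image_eqI[of _ _ "U - {e}"]) auto
      qed (use U in auto)
    next
      fix U assume "U \<in> ?T S M \<union> insert e ` ?T (S - {e}) M"
      then show "U \<in> ?T S (insert e M)"
        by (auto simp: Diff_insert2[symmetric])
    qed
    have sum_split: "sum (?g S) (?T S (insert e M)) =
        sum (?g S) (?T S M) + u e * sum (?g (S - {e})) (?T (S - {e}) M)"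
    proof -
      have "sum (?g S) (?T S (insert e M)) =
          sum (?g S) (?T S M) + sum (?g S) (insert e ` ?T (S - {e}) M)"
        unfolding split using insert.hyps finT by (intro sum.union_disjoint) auto
      also have "sum (?g S) (insert e ` ?T (S - {e}) M) =
          (\<Sum>U\<in>?T (S - {e}) M. ?g S (insert e U))"
        using insert.hyps by (subst sum.reindex) (auto simp: inj_on_def o_def)
      also have "\<dots> = (\<Sum>U\<in>?T (S - {e}) M. u e * ?g (S - {e}) U)"
      proof (rule sum.cong)
        fix U assume "U \<in> ?T (S - {e}) M"
        then have "e \<notin> U" "finite U" using insert.hyps finite_subset by auto
        moreover have "S - insert e U = S - {e} - U" by auto
        ultimately show "?g S (insert e U) = u e * ?g (S - {e}) U" by simp
      qed simp
      finally show ?thesis by (simp add: sum_distrib_left)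
    qed
    show ?case
    proof (cases "separating V a (S - {e})")
      case True
      have M': "M \<subseteq> S - {e}" using MS insert.hyps by auto
      have eq: "reach (S - {e}) ?w = reach (S - {e}) ?wM" by (rule reach_cong) auto
      have SE: "S - {e} \<subseteq> E" using insert.prems by auto
      note IH' = insert.IH[OF SE True M']
      have fin': "finite (reach (S - {e}) ?w // lattice_rel (S - {e}))" using IH' eq by simp
      have eq': "count (S - {e}) ?w = count (S - {e}) ?wM" by (simp only: count_def eq)
      have "count S ?w = count S ?wM + ?w e * count (S - {e}) ?w"
        using count_delete_contract(2)[OF e insert.prems(1) True fin'] unfolding w0 .
      also have "\<dots> = sum (?g S) (?T S M) + u e * sum (?g (S - {e})) (?T (S - {e}) M)"
        unfolding eq' IH[THEN conjunct2] IH'[THEN conjunct2] by simp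
      finally show ?thesis
        using count_delete_contract(1)[OF e insert.prems(1) True fin'] sum_split by simp
    next
      case False
      have Tempty: "?T (S - {e}) M = {}"
        using False separating_mono[of V a] by blast
      have "sum (?g S) (?T S (insert e M)) = sum (?g S) (?T S M)"
        unfolding sum_split Tempty by (simp only: sum.empty mult_0_right add_0_right)
      moreover have "reach S ?w = reach S ?wM"
        using reach_coloop[OF e insert.prems(2) False, of ?w] unfolding w0 .
      ultimately show ?thesis using IH by (simp add: count_def)
    qed
  qed
qed

end

section \<open>Circles in multigraphs\<close>

lemma pair_mset_eq_iff: "{#a, b#} = {#c, d#} \<longleftrightarrow> (a = c \<and> b = d) \<or> (a = d \<and> b = c)"
  by (auto simp: add_eq_conv_ex)

definition is_link :: "('e \<Rightarrow> 'v multiset) \<Rightarrow> 'e \<Rightarrow> bool" where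
  "is_link ends e \<longleftrightarrow> (\<exists>j k. j \<noteq> k \<and> ends e = {#j, k#})"

definition link_rel :: "('e \<Rightarrow> 'v multiset) \<Rightarrow> 'e set \<Rightarrow> 'v rel" where
  "link_rel ends F = {(j, k). \<exists>e\<in>F. j \<noteq> k \<and> ends e = {#j, k#}}"

text \<open>
  Circles as a property of edge sets alone, without reference to an ambient graph, so that the circles
  of a subgraph are the circles contained in its edge set.
\<close>

definition is_circle :: "('e \<Rightarrow> 'v multiset) \<Rightarrow> 'e set \<Rightarrow> bool" where
  "is_circle ends D \<longleftrightarrow> (\<exists>us es. D = set es \<and> 2 \<le> length es \<and> length us = length es \<and>
     distinct us \<and> distinct es \<and>
     (\<forall>i < length es. ends (es ! i) = {#us ! i, us ! (Suc i mod length es)#}))"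

lemma sym_link_rel: "sym (link_rel ends F)"
  by (auto simp: sym_def link_rel_def add_mset_commute)

lemma link_rel_rtrancl_sym: "(j, k) \<in> (link_rel ends F)\<^sup>* \<Longrightarrow> (k, j) \<in> (link_rel ends F)\<^sup>*"
  using sym_rtrancl[OF sym_link_rel] by (rule symD)

lemma link_rel_mono: "F \<subseteq> F' \<Longrightarrow> link_rel ends F \<subseteq> link_rel ends F'"
  by (auto simp: link_rel_def)

lemma link_rel_rtrancl_mono:
  "(j, k) \<in> (link_rel ends F)\<^sup>* \<Longrightarrow> F \<subseteq> F' \<Longrightarrow> (j, k) \<in> (link_rel ends F')\<^sup>*"
  using rtrancl_mono[OF link_rel_mono] by blast

lemma is_link_other_end:
  assumes "is_link ends e" and "v \<in># ends e"
  obtains w where "w \<noteq> v" and "ends e = {#v, w#}"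
proof -
  obtain j k where jk: "j \<noteq> k" "ends e = {#j, k#}" using assms(1) by (auto simp: is_link_def)
  then consider "v = j" | "v = k" using assms(2) by auto
  then show thesis
  proof cases
    case 1 then show thesis using jk that[of k] by simp
  next
    case 2 then show thesis using jk that[of j] by (simp add: add_mset_commute)
  qed
qed

lemma bij_betw_Suc_mod: "bij_betw (\<lambda>i. Suc i mod n) {..<n} {..<n}"
proof -
  have "inj_on (\<lambda>i. Suc i mod n) {..<n}"
    by (rule inj_onI) (auto simp: mod_Suc split: if_splits)
  moreover have "(\<lambda>i. Suc i mod n) ` {..<n} \<subseteq> {..<n}" by auto
  ultimately show ?thesis by (simp add: bij_betw_def endo_inj_surj)
qed

text \<open>
  A longest walk without repeated nodes cannot be extended at its last node \<open>v\<close>, but \<open>v\<close> has a second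
  incident edge; it must lead back to the walk and closes a circle.
\<close>

lemma circle_of_min_degree:
  fixes ends :: "'e \<Rightarrow> 'v multiset"
  assumes fin: "finite X" and ne: "X \<noteq> {}" and links: "\<And>e. e \<in> X \<Longrightarrow> is_link ends e"
    and deg: "\<And>e v. e \<in> X \<Longrightarrow> v \<in># ends e \<Longrightarrow> \<exists>f\<in>X. f \<noteq> e \<and> v \<in># ends f"
  obtains D where "D \<subseteq> X" and "is_circle ends D"
proof -
  define walk where "walk us es \<longleftrightarrow> length us = Suc (length es) \<and> es \<noteq> [] \<and> distinct us \<and>
    set es \<subseteq> X \<and> (\<forall>i < length es. ends (es ! i) = {#us ! i, us ! Suc i#})" for us es
  let ?W = "\<Union>e\<in>X. set_mset (ends e)"
  have finW: "finite ?W" using fin by auto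
  have bound: "length us \<le> card ?W" if w: "walk us es" for us es
  proof -
    have "set us \<subseteq> ?W"
    proof
      fix x assume "x \<in> set us"
      then obtain i where i: "i < length us" "x = us ! i" by (auto simp: in_set_conv_nth)
      show "x \<in> ?W"
      proof (cases "i < length es")
        case True
        then have "x \<in># ends (es ! i)" "es ! i \<in> X" using w i by (auto simp: walk_def)
        then show ?thesis by blast
      next
        case False
        then have "i = length es" using w i by (simp add: walk_def)
        moreover have "es \<noteq> []" using w by (simp add: walk_def)
        ultimately obtain m where m: "i = Suc m" "m < length es" by (metis lessI list.size(3) not0_implies_Suc length_0_conv)
        then have "x \<in># ends (es ! m)" "es ! m \<in> X" using w i by (auto simp: walk_def)
        then show ?thesis by blast
      qed
    qed
    then have "card (set us) \<le> card ?W" using finW by (rule card_mono[rotated])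
    then show ?thesis using w by (simp add: walk_def distinct_card)
  qed
  have "\<exists>us es. walk us es"
  proof -
    obtain e where e: "e \<in> X" using ne by blast
    then obtain j k where "j \<noteq> k" "ends e = {#j, k#}"
      using links unfolding is_link_def by blast
    then have "walk [j, k] [e]" using e by (simp add: walk_def)
    then show ?thesis by blast
  qed
  \<comment> \<open>Node-simple walks have bounded length, so there is a longest one.\<close>
  moreover have "{length us | us es. walk us es} \<subseteq> {..card ?W}" using bound by auto
  then have finN: "finite {length us | us es. walk us es}" using finite_subset by blast
  ultimately have "Max {length us | us es. walk us es} \<in> {length us | us es. walk us es}"
    by (intro Max_in) auto
  then obtain us es where w: "walk us es" "length us = Max {length us | us es. walk us es}" by auto
  have max: "length us' \<le> length us" if "walk us' es'" for us' es'
    unfolding w(2) using finN that by (intro Max_ge) auto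
  define l where "l = length es"
  have l: "l > 0" "length us = Suc l" "distinct us" "set es \<subseteq> X"
    and ends: "\<And>i. i < l \<Longrightarrow> ends (es ! i) = {#us ! i, us ! Suc i#}"
    using w(1) by (auto simp: walk_def l_def)
  define v where "v = us ! l"
  have last: "es ! (l - 1) \<in> X" "v \<in># ends (es ! (l - 1))"
    using ends[of "l - 1"] l by (auto simp: v_def l_def)
  then obtain f where f: "f \<in> X" "f \<noteq> es ! (l - 1)" "v \<in># ends f" using deg by blast
  then obtain x where x: "x \<noteq> v" "ends f = {#v, x#}" using is_link_other_end links by metis
  have "x \<in> set us"
  proof (rule ccontr)
    assume "x \<notin> set us"
    then have "walk (us @ [x]) (es @ [f])"
      using w(1) f(1) x(2) unfolding walk_def
      by (auto simp: nth_append v_def l_def less_Suc_eq)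
    then have "length (us @ [x]) \<le> length us" by (rule max)
    then show False by simp
  qed
  then obtain i where i: "i < length us" "us ! i = x" by (auto simp: in_set_conv_nth)
  then have il: "i < l" using l x(1) by (cases "i = l") (auto simp: v_def)
  have fnew: "f \<notin> set es"
  proof
    assume "f \<in> set es"
    then obtain m where m: "m < l" "es ! m = f" by (auto simp: in_set_conv_nth l_def)
    then have "v = us ! m \<or> v = us ! Suc m" using f(3) ends by auto
    then have "m = l \<or> Suc m = l"
      using m(1) l(2,3) unfolding v_def by (metis Suc_mono less_Suc_eq nth_eq_iff_index_eq)
    then show False using m f(2) by auto
  qed
  have dist: "distinct es"
  proof (rule ccontr)
    assume "\<not> distinct es"
    then obtain p q where pq: "p < q" "q < l" "es ! p = es ! q"
      unfolding distinct_conv_nth l_def by (metis linorder_neqE_nat)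
    then have "us ! p = us ! q \<or> us ! p = us ! Suc q"
      using ends[of p] ends[of q] by (auto simp: pair_mset_eq_iff)
    then show False using pq l nth_eq_iff_index_eq[OF l(3)] by force
  qed
  let ?us = "drop i us" and ?es = "drop i es @ [f]"
  have len: "length ?es = Suc (l - i)" "length ?us = Suc (l - i)" using l il by (auto simp: l_def)
  have "is_circle ends (set ?es)"
    unfolding is_circle_def
  proof (intro exI[of _ ?us] exI[of _ ?es] conjI allI impI)
    show "distinct ?es" using dist fnew by (auto dest: in_set_dropD)
    show "distinct ?us" using l by simp
    fix m assume m: "m < length ?es"
    show "ends (?es ! m) = {#?us ! m, ?us ! (Suc m mod length ?es)#}"
    proof (cases "m < l - i")
      case True
      then have "Suc m mod length ?es = Suc m" using len by simp
      then show ?thesis using True ends[of "i + m"] l(2) il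
        by (simp add: nth_append l_def[symmetric])
    next
      case False
      then have "m = l - i" using m len by simp
      then show ?thesis using x(2) i l(2) il len
        by (simp add: nth_append v_def l_def[symmetric])
    qed
  qed (use len il l in \<open>auto\<close>)
  moreover have "set ?es \<subseteq> X" using l f(1) by (auto dest: in_set_dropD)
  ultimately show thesis using that by blast
qed

text \<open>
  A forest is balanced for any choice \<open>\<sigma>\<close> of signs: it has a node of degree one, at which the value
  of \<open>z\<close> is free. The freedom in \<open>\<sigma>\<close> matters, since different sign functions will be put on the same
  forest.
\<close>

lemma acyclic_sign_potential:
  fixes \<sigma> :: "'e \<Rightarrow> real"
  assumes "finite F" and "\<And>e. e \<in> F \<Longrightarrow> is_link ends e"
    and "\<And>D. D \<subseteq> F \<Longrightarrow> \<not> is_circle ends D" and \<sigma>: "\<And>e. \<sigma> e \<in> {1, -1}"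
  shows "\<exists>z. (\<forall>v. z v \<in> {1, -1}) \<and> (\<forall>e\<in>F. \<forall>j k. ends e = {#j, k#} \<longrightarrow> z j = \<sigma> e * z k)"
  using assms(1-3)
proof (induction F rule: finite_psubset_induct)
  case (psubset F)
  show ?case
  proof (cases "F = {}")
    case True then show ?thesis by (intro exI[of _ "\<lambda>_. 1"]) auto
  next
    case False
    obtain e v where e: "e \<in> F" "v \<in># ends e" "\<And>f. f \<in> F \<Longrightarrow> f \<noteq> e \<Longrightarrow> v \<notin># ends f"
      using circle_of_min_degree[OF psubset.hyps False] psubset.prems by metis
    obtain w where w: "w \<noteq> v" "ends e = {#v, w#}"
      using is_link_other_end e(1,2) psubset.prems(1) by metis
    obtain z where z: "\<forall>v. z v \<in> {1, -1::real}"
      "\<forall>f\<in>F - {e}. \<forall>j k. ends f = {#j, k#} \<longrightarrow> z j = \<sigma> f * z k"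
      using psubset.IH[of "F - {e}"] psubset.prems e(1) by blast
    have sq: "\<sigma> e * \<sigma> e = 1" using \<sigma>[of e] by auto
    define y where "y = z(v := \<sigma> e * z w)"
    have "y x \<in> {1, -1}" for x using z(1) \<sigma>[of e] by (cases "x = v") (auto simp: y_def)
    moreover have "y j = \<sigma> f * y k" if f: "f \<in> F" "ends f = {#j, k#}" for f j k
    proof (cases "f = e")
      case True
      then have "(j = v \<and> k = w) \<or> (j = w \<and> k = v)" using f w by (auto simp: pair_mset_eq_iff)
      then show ?thesis using True w(1) sq by (auto simp: y_def mult.assoc[symmetric])
    next
      case False
      then have "v \<notin># ends f" using e f by blast
      then have "j \<noteq> v" "k \<noteq> v" using f(2) by auto
      moreover have "z j = \<sigma> f * z k" using z(2) f False by blast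
      ultimately show ?thesis by (simp add: y_def)
    qed
    ultimately show ?thesis by blast
  qed
qed

text \<open>
  An edge of a forest is a bridge. If its ends were connected by the other edges, then a sign potential
  for signs that are positive on the other edges and negative on \<open>e\<close> would take equal and opposite values
  at these ends.
\<close>

lemma acyclic_bridge:
  assumes fin: "finite F" and links: "\<And>e. e \<in> F \<Longrightarrow> is_link ends e"
    and acyc: "\<And>D. D \<subseteq> F \<Longrightarrow> \<not> is_circle ends D"
    and e: "e \<in> F" "ends e = {#j, k#}"
  shows "(j, k) \<notin> (link_rel ends (F - {e}))\<^sup>*"
proof
  assume "(j, k) \<in> (link_rel ends (F - {e}))\<^sup>*"
  have "\<exists>z::_ \<Rightarrow> real. (\<forall>v. z v \<in> {1, -1}) \<and>
    (\<forall>f\<in>F. \<forall>j k. ends f = {#j, k#} \<longrightarrow> z j = (if f = e then -1 else 1) * z k)"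
    by (rule acyclic_sign_potential) (use fin links acyc in auto)
  then obtain z :: "_ \<Rightarrow> real" where z: "\<forall>v. z v \<in> {1, -1}"
    and zF: "\<And>f j k. f \<in> F \<Longrightarrow> ends f = {#j, k#} \<Longrightarrow> z j = (if f = e then -1 else 1) * z k"
    by blast
  have "z j = z k" using \<open>(j, k) \<in> (link_rel ends (F - {e}))\<^sup>*\<close>
  proof (induction rule: rtrancl_induct)
    case (step x y)
    then obtain f where "f \<in> F - {e}" "ends f = {#x, y#}" by (auto simp: link_rel_def)
    then have "z x = z y" using zF[of f x y] by simp
    with step show ?case by simp
  qed simp
  moreover have "z j = - z k" using zF[of e j k] e by simp
  ultimately show False using z[rule_format, of k] by auto
qed

lemma is_circleE:
  assumes "is_circle ends D"
  obtains us es where "D = set es" "2 \<le> length es" "length us = length es" "distinct us"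
    "distinct es" "\<And>i. i < length es \<Longrightarrow> ends (es ! i) = {#us ! i, us ! (Suc i mod length es)#}"
    "\<And>i. i < length es \<Longrightarrow> us ! i \<noteq> us ! (Suc i mod length es)"
proof -
  obtain us es where c: "D = set es" "2 \<le> length es" "length us = length es" "distinct us"
    "distinct es" "\<And>i. i < length es \<Longrightarrow> ends (es ! i) = {#us ! i, us ! (Suc i mod length es)#}"
    using assms unfolding is_circle_def by blast
  have "us ! i \<noteq> us ! (Suc i mod length es)" if i: "i < length es" for i
  proof -
    have "i \<noteq> Suc i mod length es" using c(2) i by (auto simp: mod_Suc)
    moreover have "Suc i mod length es < length es" using i by (intro mod_less_divisor) auto
    ultimately show ?thesis using i c(3) nth_eq_iff_index_eq[OF c(4)] by auto
  qed
  with c show thesis using that by blast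
qed

lemma is_circle_links: "is_circle ends D \<Longrightarrow> e \<in> D \<Longrightarrow> is_link ends e"
proof -
  assume "is_circle ends D" "e \<in> D"
  then obtain us es where c: "D = set es"
    "\<And>i. i < length es \<Longrightarrow> ends (es ! i) = {#us ! i, us ! (Suc i mod length es)#}"
    "\<And>i. i < length es \<Longrightarrow> us ! i \<noteq> us ! (Suc i mod length es)"
    using is_circleE by metis
  obtain i where "i < length es" "e = es ! i"
    using \<open>e \<in> D\<close> c(1) by (auto simp: in_set_conv_nth)
  then show "is_link ends e" using c(2,3)[of i] unfolding is_link_def by blast
qed

lemma is_circle_finite: "is_circle ends D \<Longrightarrow> finite D"
  by (auto simp: is_circle_def)

lemma is_circle_nonempty: "is_circle ends D \<Longrightarrow> D \<noteq> {}"
  by (auto simp: is_circle_def)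

text \<open>
  An edge crosses the boundary of \<open>X\<close> iff exactly one of its ends is in \<open>X\<close>, and going around the circle
  each node is counted twice as an end. The instances used below take for \<open>X\<close> a component, which shows
  that an edge of a circle is not a bridge, and a single node, which shows that degrees are even.
\<close>

lemma circle_crosses_evenly:
  assumes "is_circle ends D"
  shows "even (card {e\<in>D. \<exists>x y. ends e = {#x, y#} \<and> x \<in> X \<and> y \<notin> X})"
proof -
  obtain us es where c: "D = set es" "2 \<le> length es" "length us = length es" "distinct us"
    "distinct es" "\<And>i. i < length es \<Longrightarrow> ends (es ! i) = {#us ! i, us ! (Suc i mod length es)#}"
    using is_circleE[OF assms] by metis
  define n where "n = length es"
  define cross where "cross e \<longleftrightarrow> (\<exists>x y. ends e = {#x, y#} \<and> x \<in> X \<and> y \<notin> X)" for e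
  define g where "g i = (of_bool (us ! i \<in> X) :: nat)" for i
  have cr: "even (of_bool (cross (es ! i)) + (g i + g (Suc i mod n)))" if "i < n" for i
    using c(6)[of i] that by (auto simp: cross_def g_def n_def pair_mset_eq_iff)
  have "card {e\<in>D. cross e} = (\<Sum>e\<in>set es. of_bool (cross e))"
    using c(1) by (simp add: of_bool_def sum.If_cases Int_def)
  also have "\<dots> = (\<Sum>i<n. of_bool (cross (es ! i)))"
    unfolding n_def using c(5)
    by (intro sum.reindex_bij_betw[symmetric] bij_betw_nth) auto
  finally have card: "card {e\<in>D. cross e} = (\<Sum>i<n. of_bool (cross (es ! i)))" .
  have "(\<Sum>i<n. g (Suc i mod n)) = (\<Sum>i<n. g i)"
    by (rule sum.reindex_bij_betw[OF bij_betw_Suc_mod])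
  then have "even (\<Sum>i<n. g i + g (Suc i mod n))" by (simp add: sum.distrib)
  moreover have "even (\<Sum>i<n. of_bool (cross (es ! i)) + (g i + g (Suc i mod n)))"
    using cr by (intro dvd_sum) auto
  ultimately have "even (\<Sum>i<n. of_bool (cross (es ! i)) :: nat)"
    by (simp only: sum.distrib even_add)
  then show ?thesis using card by (simp add: cross_def)
qed

lemma circle_minus_edge_connected:
  assumes D: "is_circle ends D" and e: "e \<in> D" "ends e = {#j, k#}"
  shows "(j, k) \<in> (link_rel ends (D - {e}))\<^sup>*"
proof (rule ccontr)
  assume not: "(j, k) \<notin> (link_rel ends (D - {e}))\<^sup>*"
  define X where "X = {x. (j, x) \<in> (link_rel ends (D - {e}))\<^sup>*}"
  have "{f\<in>D. \<exists>x y. ends f = {#x, y#} \<and> x \<in> X \<and> y \<notin> X} = {e}"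
  proof (intro equalityI subsetI)
    fix f assume "f \<in> {f\<in>D. \<exists>x y. ends f = {#x, y#} \<and> x \<in> X \<and> y \<notin> X}"
    then obtain x y where f: "f \<in> D" "ends f = {#x, y#}" "x \<in> X" "y \<notin> X" by blast
    show "f \<in> {e}"
    proof (rule ccontr)
      assume "f \<notin> {e}"
      then have "(x, y) \<in> link_rel ends (D - {e})" using f by (auto simp: link_rel_def)
      then show False using f(3,4) unfolding X_def by (auto intro: rtrancl_into_rtrancl)
    qed
  next
    fix f assume "f \<in> {e}"
    then show "f \<in> {f\<in>D. \<exists>x y. ends f = {#x, y#} \<and> x \<in> X \<and> y \<notin> X}"
      using e not by (auto simp: X_def)
  qed
  then show False using circle_crosses_evenly[OF D, of X] by simp
qed

text \<open>
  All degrees in the symmetric difference are even, so no node has degree one there.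
\<close>

lemma circle_in_symmetric_difference:
  assumes D: "is_circle ends D" and D': "is_circle ends D'" and ne: "D \<noteq> D'"
  obtains C where "C \<subseteq> (D - D') \<union> (D' - D)" and "is_circle ends C"
proof -
  let ?X = "(D - D') \<union> (D' - D)"
  have links: "is_link ends e" if "e \<in> ?X" for e
    using that is_circle_links[OF D] is_circle_links[OF D'] by blast
  have fin: "finite D" "finite D'" using D D' by (auto dest: is_circle_finite)
  have even: "even (card {e\<in>C. v \<in># ends e})" if C: "is_circle ends C" for v C
  proof -
    have "v \<in># ends e \<longleftrightarrow> (\<exists>x y. ends e = {#x, y#} \<and> x \<in> {v} \<and> y \<notin> {v})" if "e \<in> C" for e
      using is_circle_links[OF C that]
      by (auto simp: is_link_def pair_mset_eq_iff)
    then have "{e\<in>C. v \<in># ends e} = {e\<in>C. \<exists>x y. ends e = {#x, y#} \<and> x \<in> {v} \<and> y \<notin> {v}}"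
      by blast
    then show ?thesis using circle_crosses_evenly[OF C, of "{v}"] by simp
  qed
  have "\<exists>f\<in>?X. f \<noteq> e \<and> v \<in># ends f" if e: "e \<in> ?X" "v \<in># ends e" for e v
  proof (rule ccontr)
    assume no: "\<not> (\<exists>f\<in>?X. f \<noteq> e \<and> v \<in># ends f)"
    let ?A = "{e\<in>D. v \<in># ends e}" and ?B = "{e\<in>D'. v \<in># ends e}"
    have "(?A - ?B) \<union> (?B - ?A) = {e}" using no e by blast
    then have "card (?A - ?B) + card (?B - ?A) = 1"
      using fin by (subst card_Un_disjoint[symmetric]) auto
    moreover have "card ?A = card (?A \<inter> ?B) + card (?A - ?B)"
      "card ?B = card (?B \<inter> ?A) + card (?B - ?A)"
      using fin by (auto simp: card_Int_Diff)
    ultimately have "card ?A + card ?B = 2 * card (?A \<inter> ?B) + 1"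
      by (simp add: Int_commute)
    then show False using even[OF D, of v] even[OF D', of v] by presburger
  qed
  moreover have "?X \<noteq> {}" using ne by blast
  ultimately show thesis using circle_of_min_degree[of ?X ends] fin links that by blast
qed

text \<open>
  The product of \<open>z j * z k\<close> over the edges of the circle is a product of squares.
\<close>

lemma circle_sign_product:
  fixes z :: "'v \<Rightarrow> real" and \<sigma> :: "'e \<Rightarrow> real"
  assumes "is_circle ends D" and z: "\<And>v. z v \<in> {1, -1}"
    and sat: "\<And>f j k. f \<in> D \<Longrightarrow> ends f = {#j, k#} \<Longrightarrow> z j = \<sigma> f * z k"
  shows "(\<Prod>f\<in>D. \<sigma> f) = 1"
proof -
  obtain us es where c: "D = set es" "length us = length es"
    "distinct es" "\<And>i. i < length es \<Longrightarrow> ends (es ! i) = {#us ! i, us ! (Suc i mod length es)#}"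
    using is_circleE[OF assms(1)] by metis
  define n where "n = length es"
  have sq: "z v * z v = 1" for v using z[of v] by auto
  have "(\<Prod>f\<in>D. \<sigma> f) = (\<Prod>i<n. \<sigma> (es ! i))"
    unfolding c(1) n_def using c(3)
    by (intro prod.reindex_bij_betw[symmetric] bij_betw_nth) auto
  also have "\<dots> = (\<Prod>i<n. z (us ! i) * z (us ! (Suc i mod n)))"
  proof (rule prod.cong)
    fix i assume "i \<in> {..<n}"
    then have i: "i < length es" by (simp add: n_def)
    have "es ! i \<in> D" using i c(1) by simp
    then have "z (us ! i) = \<sigma> (es ! i) * z (us ! (Suc i mod n))"
      unfolding n_def using sat c(4)[OF i] by blast
    then show "\<sigma> (es ! i) = z (us ! i) * z (us ! (Suc i mod n))"
      by (simp only: mult.assoc sq mult_1_right)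
  qed simp
  also have "\<dots> = (\<Prod>i<n. z (us ! i)) * (\<Prod>i<n. z (us ! i))"
    by (simp only: prod.distrib
      prod.reindex_bij_betw[OF bij_betw_Suc_mod, of "\<lambda>i. z (us ! i)" n])
  also have "\<dots> = (\<Prod>i<n. z (us ! i) * z (us ! i))" by (simp add: prod.distrib)
  finally show ?thesis by (simp add: sq)
qed

lemma circle_connected:
  assumes "is_circle ends D" and x: "x \<in> (\<Union>e\<in>D. set_mset (ends e))"
    and y: "y \<in> (\<Union>e\<in>D. set_mset (ends e))"
  shows "(x, y) \<in> (link_rel ends D)\<^sup>*"
proof -
  obtain us es where c: "D = set es" "2 \<le> length es" "length us = length es"
    "\<And>i. i < length es \<Longrightarrow> ends (es ! i) = {#us ! i, us ! (Suc i mod length es)#}"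
    "\<And>i. i < length es \<Longrightarrow> us ! i \<noteq> us ! (Suc i mod length es)"
    using is_circleE[OF assms(1)] by metis
  have reach: "i < length us \<Longrightarrow> (us ! 0, us ! i) \<in> (link_rel ends D)\<^sup>*" for i
  proof (induction i)
    case (Suc i)
    then have "es ! i \<in> D" "ends (es ! i) = {#us ! i, us ! Suc i#}" "us ! i \<noteq> us ! Suc i"
      using c(1,3) c(4)[of i] c(5)[of i] by auto
    then have "(us ! i, us ! Suc i) \<in> link_rel ends D" by (auto simp: link_rel_def)
    then show ?case using Suc by (auto intro: rtrancl_into_rtrancl)
  qed simp
  have "\<exists>i<length us. v = us ! i" if v: "v \<in> (\<Union>e\<in>D. set_mset (ends e))" for v
  proof -
    from v c(1) obtain i where i: "i < length es" "v \<in># ends (es ! i)"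
      by (auto simp: in_set_conv_nth)
    have "Suc i mod length es < length es" using i by (intro mod_less_divisor) auto
    then show ?thesis using c(4)[OF i(1)] i c(3) by auto
  qed
  then have "(us ! 0, x) \<in> (link_rel ends D)\<^sup>*" "(us ! 0, y) \<in> (link_rel ends D)\<^sup>*"
    using x y reach by blast+
  then show ?thesis using link_rel_rtrancl_sym by (metis rtrancl_trans)
qed

section \<open>Pseudo-forests\<close>

locale sgraph =
  fixes G :: "('v, 'e) signed_graph"
  assumes signed_graph: "is_signed_graph G"
begin

abbreviation ends :: "'e \<Rightarrow> 'v multiset" where "ends \<equiv> sg_ends G"
abbreviation V :: "'v set" where "V \<equiv> sg_nodes G"
abbreviation E :: "'e set" where "E \<equiv> sg_edges G"
abbreviation adjacent :: "'e set \<Rightarrow> 'v rel" where "adjacent F \<equiv> link_rel ends F"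
abbreviation link :: "'e \<Rightarrow> bool" where "link \<equiv> is_link ends"
abbreviation circle :: "'e set \<Rightarrow> bool" where "circle \<equiv> is_circle ends"
abbreviation is_half :: "'e \<Rightarrow> bool" where "is_half e \<equiv> \<exists>j. ends e = {#j#}"
abbreviation is_loop :: "'e \<Rightarrow> bool" where "is_loop e \<equiv> \<exists>j. ends e = {#j, j#}"

definition comp :: "'e set \<Rightarrow> 'v \<Rightarrow> 'v set" where
  "comp F j = {k. (j, k) \<in> (adjacent F)\<^sup>*}"

definition comps :: "'e set \<Rightarrow> 'v set set" where
  "comps F = comp F ` V"

text \<open>
  The ends of a halfedge form a singleton, so inclusion in \<open>C\<close> is the same as meeting \<open>C\<close>.
\<close>

definition halffree :: "'e set \<Rightarrow> 'v set \<Rightarrow> bool" where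
  "halffree F C \<longleftrightarrow> (\<forall>e\<in>F. is_half e \<longrightarrow> \<not> set_mset (ends e) \<subseteq> C)"

definition num_halffree :: "'e set \<Rightarrow> nat" where
  "num_halffree F = card {C \<in> comps F. halffree F C}"

lemma finite_V: "finite V" and finite_E: "finite E"
  using signed_graph by (auto simp: is_signed_graph_def)

lemma ends_in_V: "e \<in> E \<Longrightarrow> v \<in># ends e \<Longrightarrow> v \<in> V"
  using signed_graph by (auto simp: is_signed_graph_def)

lemma nonlink_loop_or_half:
  assumes "e \<in> E" and "\<not> link e"
  obtains j where "set_mset (ends e) = {j}" and "is_half e \<or> is_loop e"
proof -
  have "e \<in> sg_loops G \<union> sg_halfedges G"
    using signed_graph assms unfolding is_signed_graph_def is_link_def sg_links_def by blast
  then obtain j where "ends e = {#j#} \<or> ends e = {#j, j#}"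
    by (auto simp: sg_loops_def sg_halfedges_def)
  then show thesis
  proof
    assume "ends e = {#j#}"
    then show thesis using that[of j] by simp
  next
    assume "ends e = {#j, j#}"
    then show thesis using that[of j] by force
  qed
qed

lemma not_link_if_half_or_loop: "is_half e \<or> is_loop e \<Longrightarrow> \<not> link e"
  by (auto simp: is_link_def pair_mset_eq_iff)

lemma loop_negative: "e \<in> E \<Longrightarrow> is_loop e \<Longrightarrow> sg_sign G e = Negative"
  using signed_graph by (auto simp: is_signed_graph_def sg_loops_def)

lemma ends_nonempty:
  assumes "e \<in> E"
  shows "\<exists>v. v \<in># ends e"
proof (cases "link e")
  case False
  then obtain j where "set_mset (ends e) = {j}" using nonlink_loop_or_half assms by blast
  then show ?thesis by blast
qed (auto simp: is_link_def)

lemma comp_refl [simp]: "j \<in> comp F j"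
  by (simp add: comp_def)

lemma comp_eq: "k \<in> comp F j \<Longrightarrow> comp F k = comp F j"
  unfolding comp_def by (auto dest: link_rel_rtrancl_sym intro: rtrancl_trans)

lemma comp_step:
  assumes "e \<in> F" and "ends e = {#j, k#}" and "j \<in> comp F r"
  shows "k \<in> comp F r"
proof (cases "j = k")
  case False
  then have "(j, k) \<in> adjacent F" using assms by (auto simp: link_rel_def)
  then show ?thesis using assms(3) by (auto simp: comp_def intro: rtrancl_into_rtrancl)
qed (use assms in auto)

lemma comp_link_iff:
  "e \<in> F \<Longrightarrow> ends e = {#j, k#} \<Longrightarrow> j \<in> comp F r \<longleftrightarrow> k \<in> comp F r"
  using comp_step by (metis add_mset_commute)

lemma comp_subset_V: "F \<subseteq> E \<Longrightarrow> j \<in> V \<Longrightarrow> comp F j \<subseteq> V"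
proof
  fix k assume F: "F \<subseteq> E" "j \<in> V" and "k \<in> comp F j"
  then have "(j, k) \<in> (adjacent F)\<^sup>*" by (simp add: comp_def)
  then show "k \<in> V"
  proof (induction rule: rtrancl_induct)
    case (step y z)
    then obtain e where "e \<in> F" "ends e = {#y, z#}" by (auto simp: link_rel_def)
    then show ?case using ends_in_V[of e z] F by auto
  qed (use F in simp)
qed

lemma comps_eqI: "C \<in> comps F \<Longrightarrow> v \<in> C \<Longrightarrow> C = comp F v"
  using comp_eq by (auto simp: comps_def)

lemma comps_disjoint: "C \<in> comps F \<Longrightarrow> D \<in> comps F \<Longrightarrow> v \<in> C \<Longrightarrow> v \<in> D \<Longrightarrow> C = D"
  using comps_eqI by metis

lemma comp_mono: "F \<subseteq> S \<Longrightarrow> comp F j \<subseteq> comp S j"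
  by (auto simp: comp_def intro: link_rel_rtrancl_mono)

lemma finite_comps: "finite (comps F)"
  using finite_V by (simp add: comps_def)

text \<open>
  The features of an edge set are its halfedges, loops and circles, all regarded as edge sets. In these
  terms a pseudo-forest is an edge set in which no component has two features and every circle has an odd
  number of negative edges; stating the former as a condition on pairs of connected features
  avoids splitting into components and the four types of trees.
\<close>

definition feature :: "'e set \<Rightarrow> 'e set \<Rightarrow> bool" where
  "feature F f \<longleftrightarrow> (\<exists>e\<in>F. \<not> link e \<and> f = {e}) \<or> (f \<subseteq> F \<and> circle f)"

definition nodes_of :: "'e set \<Rightarrow> 'v set" where
  "nodes_of f = (\<Union>e\<in>f. set_mset (ends e))"

definition odd_negative :: "'e set \<Rightarrow> bool" where
  "odd_negative D \<longleftrightarrow> odd (card {e\<in>D. sg_sign G e = Negative})"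

definition separated_features :: "'e set \<Rightarrow> bool" where
  "separated_features F \<longleftrightarrow> (\<forall>D\<subseteq>F. circle D \<longrightarrow> odd_negative D) \<and>
    (\<forall>f g x y. feature F f \<longrightarrow> feature F g \<longrightarrow> x \<in> nodes_of f \<longrightarrow> y \<in> nodes_of g \<longrightarrow>
      y \<in> comp F x \<longrightarrow> f = g)"

lemma feature_subset: "feature F f \<Longrightarrow> f \<subseteq> F"
  by (auto simp: feature_def)

lemma feature_mono: "feature F f \<Longrightarrow> F \<subseteq> S \<Longrightarrow> feature S f"
  by (auto simp: feature_def)

lemma feature_restrict: "feature S f \<Longrightarrow> f \<subseteq> F \<Longrightarrow> feature F f"
  by (auto simp: feature_def)

lemma feature_nodes_nonempty:
  assumes "feature F f" and "F \<subseteq> E"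
  obtains x where "x \<in> nodes_of f" and "x \<in> V"
proof -
  have "f \<noteq> {}" using assms(1) is_circle_nonempty by (auto simp: feature_def)
  then obtain e where e: "e \<in> f" by blast
  then have "e \<in> E" using feature_subset[OF assms(1)] assms(2) by blast
  then show thesis using ends_nonempty[of e] ends_in_V e that by (auto simp: nodes_of_def)
qed

lemma feature_nodes_subset_comp:
  assumes f: "feature F f" and F: "F \<subseteq> E" and x: "x \<in> nodes_of f" "x \<in> comp F r"
  shows "nodes_of f \<subseteq> comp F r"
proof
  fix y assume y: "y \<in> nodes_of f"
  show "y \<in> comp F r"
  proof (cases "circle f")
    case True
    then have "(x, y) \<in> (adjacent f)\<^sup>*"
      using circle_connected[OF True] x y by (simp add: nodes_of_def)
    then have "(x, y) \<in> (adjacent F)\<^sup>*" using feature_subset[OF f] link_rel_rtrancl_mono by metis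
    then show ?thesis using x by (auto simp: comp_def intro: rtrancl_trans)
  next
    case False
    then obtain e where e: "e \<in> F" "\<not> link e" "f = {e}" using f by (auto simp: feature_def)
    then obtain j where "set_mset (ends e) = {j}" using nonlink_loop_or_half F by blast
    then have "y = x" using e x y by (simp add: nodes_of_def)
    then show ?thesis using x by simp
  qed
qed

lemma separated_features_unique:
  assumes "separated_features F" and "feature F f" and "feature F g" and "F \<subseteq> E"
    and "x \<in> nodes_of f" "x \<in> comp F r" and "y \<in> nodes_of g" "y \<in> comp F r"
  shows "f = g"
proof -
  have "y \<in> comp F x" using assms comp_eq by metis
  then show ?thesis using assms unfolding separated_features_def by blast
qed

subsection \<open>Components as signed graphs\<close>

definition comp_edges :: "'e set \<Rightarrow> 'v set \<Rightarrow> 'e set" where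
  "comp_edges F C = {e \<in> F. set_mset (ends e) \<subseteq> C}"

definition comp_graph :: "'e set \<Rightarrow> 'v set \<Rightarrow> ('v, 'e) signed_graph" where
  "comp_graph F C = G\<lparr>sg_nodes := C, sg_edges := comp_edges F C\<rparr>"

lemma sg_adj_eq:
  assumes "sg_ends K = ends"
  shows "sg_adj K = adjacent (sg_edges K)"
proof -
  have "e \<in> sg_links K \<longleftrightarrow> e \<in> sg_edges K \<and> j \<noteq> k" if "ends e = {#j, k#}" for e j k
  proof -
    have "(\<exists>x y. x \<noteq> y \<and> {#j, k#} = {#x, y#}) \<longleftrightarrow> j \<noteq> k" by (auto simp: pair_mset_eq_iff)
    then show ?thesis by (simp add: sg_links_def assms that)
  qed
  then show ?thesis unfolding sg_adj_def link_rel_def assms by blast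
qed

lemma sg_component_restrict:
  assumes "F \<subseteq> E" and "j \<in> V"
  shows "sg_component (sg_restrict G F) j = comp_graph F (comp F j)"
proof -
  have "sg_adj (sg_restrict G F) = adjacent F"
    by (subst sg_adj_eq) (auto simp: sg_restrict_def)
  moreover have "{k \<in> V. (j, k) \<in> (adjacent F)\<^sup>*} = comp F j"
    using comp_subset_V[OF assms] by (auto simp: comp_def)
  ultimately show ?thesis
    by (simp add: sg_component_def comp_graph_def sg_restrict_def comp_edges_def Let_def)
qed

lemma sg_components_restrict:
  assumes "F \<subseteq> E"
  shows "sg_components (sg_restrict G F) = comp_graph F ` comps F"
proof -
  have "sg_nodes (sg_restrict G F) = V" by (simp add: sg_restrict_def)
  then show ?thesis
    unfolding sg_components_def comps_def image_image
    using sg_component_restrict[OF assms] by (intro image_cong) auto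
qed

lemma comp_graph_connected: "sg_connected (comp_graph F (comp F r))"
proof -
  let ?C = "comp F r"
  have "(j, k) \<in> (adjacent (comp_edges F ?C))\<^sup>*" if j: "j \<in> ?C" and "k \<in> ?C" for j k
  proof -
    have "k \<in> comp F j" using that comp_eq by metis
    then have "(j, k) \<in> (adjacent F)\<^sup>*" by (simp add: comp_def)
    then have "(j, k) \<in> (adjacent (comp_edges F ?C))\<^sup>* \<and> k \<in> ?C"
    proof (induction rule: rtrancl_induct)
      case (step y z)
      then obtain e where e: "e \<in> F" "ends e = {#y, z#}" "y \<noteq> z" by (auto simp: link_rel_def)
      then have "z \<in> ?C" using step comp_step by blast
      then have "e \<in> comp_edges F ?C" using e step by (auto simp: comp_edges_def)
      then have "(y, z) \<in> adjacent (comp_edges F ?C)" using e by (auto simp: link_rel_def)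
      then show ?case using step \<open>z \<in> ?C\<close> by (auto intro: rtrancl_into_rtrancl)
    qed (use j in simp)
    then show ?thesis ..
  qed
  moreover have "?C \<noteq> {}" using comp_refl by blast
  ultimately show ?thesis
    by (simp add: sg_connected_def sg_adj_eq comp_graph_def)
qed

lemma sg_circles_comp_graph:
  "sg_circles (comp_graph F C) = {D. D \<subseteq> comp_edges F C \<and> circle D}"
proof (intro equalityI subsetI)
  fix D assume "D \<in> sg_circles (comp_graph F C)"
  then show "D \<in> {D. D \<subseteq> comp_edges F C \<and> circle D}"
    unfolding sg_circles_def is_circle_def comp_graph_def by auto
next
  fix D assume "D \<in> {D. D \<subseteq> comp_edges F C \<and> circle D}"
  then obtain us es where D: "D \<subseteq> comp_edges F C" and c: "D = set es" "2 \<le> length es"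
    "length us = length es" "distinct us" "distinct es"
    "\<And>i. i < length es \<Longrightarrow> ends (es ! i) = {#us ! i, us ! (Suc i mod length es)#}"
    unfolding is_circle_def by blast
  have "set us \<subseteq> C"
  proof
    fix x assume "x \<in> set us"
    then obtain i where i: "i < length es" "x = us ! i" using c(3) by (auto simp: in_set_conv_nth)
    then have "es ! i \<in> comp_edges F C" using D c(1) by auto
    then show "x \<in> C" using c(6)[OF i(1)] i by (auto simp: comp_edges_def)
  qed
  then show "D \<in> sg_circles (comp_graph F C)"
    using D c unfolding sg_circles_def comp_graph_def mem_Collect_eq
    by (intro exI[of _ us] exI[of _ es]) auto
qed

lemma sg_loops_comp_graph: "sg_loops (comp_graph F C) = {e \<in> comp_edges F C. is_loop e}"
  and sg_halfedges_comp_graph: "sg_halfedges (comp_graph F C) = {e \<in> comp_edges F C. is_half e}"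
  by (simp_all add: sg_loops_def sg_halfedges_def comp_graph_def)

lemma feature_in_component_iff:
  assumes "F \<subseteq> E"
  shows "feature F f \<and> nodes_of f \<subseteq> C \<longleftrightarrow>
    (\<exists>e\<in>comp_edges F C. (is_half e \<or> is_loop e) \<and> f = {e}) \<or>
    (f \<subseteq> comp_edges F C \<and> circle f)"
proof -
  have "\<not> link e \<longleftrightarrow> is_half e \<or> is_loop e" if "e \<in> F" for e
    using nonlink_loop_or_half[of e] not_link_if_half_or_loop[of e] assms that by blast
  then show ?thesis
    unfolding feature_def nodes_of_def comp_edges_def by auto
qed

text \<open>
  The four admissible types of components are distinguished by which feature, if any, they contain.
\<close>

lemma component_class_iff:
  assumes F: "F \<subseteq> E" and C: "C \<in> comps F"
  defines "K \<equiv> comp_graph F C"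
  defines "tame \<equiv> signed_tree K \<or> halfedge_tree K \<or> loop_tree K \<or> pseudo_tree K"
  shows "tame \<longleftrightarrow>
    (\<forall>f g. feature F f \<and> nodes_of f \<subseteq> C \<longrightarrow> feature F g \<and> nodes_of g \<subseteq> C \<longrightarrow> f = g) \<and>
    (\<forall>D. D \<subseteq> comp_edges F C \<and> circle D \<longrightarrow> odd_negative D)" (is "_ \<longleftrightarrow> ?R")
    and "tame \<Longrightarrow> \<exists>f. feature F f \<and> nodes_of f \<subseteq> C \<Longrightarrow>
      loop_tree K \<or> pseudo_tree K \<longleftrightarrow> halffree F C"
    and "\<not> (loop_tree K \<and> pseudo_tree K)"
proof -
  define H where "H = {e \<in> comp_edges F C. is_half e}"
  define L where "L = {e \<in> comp_edges F C. is_loop e}"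
  define Z where "Z = {D. D \<subseteq> comp_edges F C \<and> circle D}"
  have conn: "sg_connected K" using C comp_graph_connected by (auto simp: K_def comps_def)
  have neg: "sg_sign K e = Negative" if "e \<in> L" for e
    using that loop_negative[of e] F by (auto simp: L_def comp_edges_def K_def comp_graph_def)
  have sets: "sg_circles K = Z" "sg_loops K = L" "sg_halfedges K = H"
    by (simp_all add: K_def sg_circles_comp_graph sg_loops_comp_graph sg_halfedges_comp_graph
        Z_def L_def H_def)
  have odd: "odd (card {e \<in> D. sg_sign K e = Negative}) \<longleftrightarrow> odd_negative D" for D
    by (simp add: odd_negative_def K_def comp_graph_def)
  have HL: "H \<inter> L = {}" by (auto simp: H_def L_def)
  have single: "{e} \<notin> Z" if "e \<in> H \<union> L" for e
  proof
    assume "{e} \<in> Z"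
    then have "circle {e}" by (simp add: Z_def)
    then have "link e" using is_circle_links by fastforce
    then show False using that not_link_if_half_or_loop[of e] by (auto simp: H_def L_def)
  qed
  have feat: "feature F f \<and> nodes_of f \<subseteq> C \<longleftrightarrow> f \<in> (\<lambda>e. {e}) ` (H \<union> L) \<union> Z" for f
    unfolding feature_in_component_iff[OF F] by (auto simp: H_def L_def Z_def)
  have tree: "signed_tree K \<longleftrightarrow> Z = {} \<and> L = {} \<and> H = {}"
    "halfedge_tree K \<longleftrightarrow> Z = {} \<and> L = {} \<and> (\<exists>h. H = {h})"
    "loop_tree K \<longleftrightarrow> Z = {} \<and> H = {} \<and> (\<exists>l. L = {l})"
    "pseudo_tree K \<longleftrightarrow> L = {} \<and> H = {} \<and> (\<exists>D. Z = {D} \<and> odd_negative D)"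
    unfolding signed_tree_def halfedge_tree_def loop_tree_def pseudo_tree_def
    using conn neg by (auto simp: sets odd)
  have hf: "halffree F C \<longleftrightarrow> H = {}" by (auto simp: halffree_def H_def comp_edges_def)
  have Zodd: "(\<forall>D. D \<subseteq> comp_edges F C \<and> circle D \<longrightarrow> odd_negative D) \<longleftrightarrow>
      (\<forall>D\<in>Z. odd_negative D)" by (auto simp: Z_def)
  show "tame \<longleftrightarrow> ?R"
  proof
    assume tame
    then show ?R unfolding tame_def tree feat Zodd
      by (elim disjE conjE exE) simp_all
  next
    assume R: ?R
    then have uniq: "f = g" if "f \<in> (\<lambda>e. {e}) ` (H \<union> L) \<union> Z" "g \<in> (\<lambda>e. {e}) ` (H \<union> L) \<union> Z" for f g
      using that unfolding feat by blast
    consider h where "h \<in> H" | l where "l \<in> L" | D where "D \<in> Z" | "H = {}" "L = {}" "Z = {}" by blast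
    then show tame
    proof cases
      case 1
      have "H = {h}" "L = {}" "Z = {}" using uniq[of "{h}"] 1 HL single[of h] by blast+
      then show ?thesis unfolding tame_def tree by blast
    next
      case 2
      have "L = {l}" "H = {}" "Z = {}" using uniq[of "{l}"] 2 HL single[of l] by blast+
      then show ?thesis unfolding tame_def tree by blast
    next
      case 3
      have "Z = {D}" using uniq[of D] 3 by blast
      moreover have "H = {}" "L = {}" using uniq[of D] 3 single by blast+
      moreover have "odd_negative D" using R 3 by (auto simp: Z_def)
      ultimately show ?thesis unfolding tame_def tree by blast
    next
      case 4
      then show ?thesis unfolding tame_def tree by blast
    qed
  qed
  show "loop_tree K \<or> pseudo_tree K \<longleftrightarrow> halffree F C"
    if tame "\<exists>f. feature F f \<and> nodes_of f \<subseteq> C"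
    using that unfolding tame_def feat tree hf by blast
  show "\<not> (loop_tree K \<and> pseudo_tree K)" unfolding tree by blast
qed

lemma pseudo_forest_iff:
  assumes F: "F \<subseteq> E"
  shows "pseudo_forest (sg_restrict G F) \<longleftrightarrow> separated_features F"
proof -
  have pf: "pseudo_forest (sg_restrict G F) \<longleftrightarrow> (\<forall>C\<in>comps F.
    (\<forall>f g. feature F f \<and> nodes_of f \<subseteq> C \<longrightarrow> feature F g \<and> nodes_of g \<subseteq> C \<longrightarrow> f = g) \<and>
    (\<forall>D. D \<subseteq> comp_edges F C \<and> circle D \<longrightarrow> odd_negative D))"
    unfolding pseudo_forest_def sg_components_restrict[OF F]
    using component_class_iff(1)[OF F] by simp
  show ?thesis
  proof
    assume A: "pseudo_forest (sg_restrict G F)"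
    show "separated_features F"
      unfolding separated_features_def
    proof (intro conjI allI impI)
      fix D assume D: "D \<subseteq> F" "circle D"
      then have f: "feature F D" by (simp add: feature_def)
      obtain x where x: "x \<in> nodes_of D" "x \<in> V" using feature_nodes_nonempty[OF f F] .
      then have "nodes_of D \<subseteq> comp F x" using feature_nodes_subset_comp[OF f F] by simp
      then have "D \<subseteq> comp_edges F (comp F x)" using D by (auto simp: comp_edges_def nodes_of_def)
      moreover have "comp F x \<in> comps F" using x by (auto simp: comps_def)
      ultimately show "odd_negative D" using A D(2) unfolding pf by blast
    next
      fix f g x y
      assume f: "feature F f" and g: "feature F g" and x: "x \<in> nodes_of f"
        and y: "y \<in> nodes_of g" "y \<in> comp F x"
      have "x \<in> V" using x feature_subset[OF f] F ends_in_V by (auto simp: nodes_of_def)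
      then have "comp F x \<in> comps F" by (auto simp: comps_def)
      moreover have "nodes_of f \<subseteq> comp F x" using feature_nodes_subset_comp[OF f F x] by simp
      moreover have "nodes_of g \<subseteq> comp F x" using feature_nodes_subset_comp[OF g F y] by simp
      ultimately show "f = g" using A f g unfolding pf by blast
    qed
  next
    assume A: "separated_features F"
    show "pseudo_forest (sg_restrict G F)"
      unfolding pf
    proof (intro ballI conjI allI impI)
      fix C f g assume C: "C \<in> comps F" and f: "feature F f \<and> nodes_of f \<subseteq> C"
        and g: "feature F g \<and> nodes_of g \<subseteq> C"
      obtain r where r: "C = comp F r" using C by (auto simp: comps_def)
      obtain x where x: "x \<in> nodes_of f" using feature_nodes_nonempty f F by blast
      obtain y where y: "y \<in> nodes_of g" using feature_nodes_nonempty g F by blast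
      show "f = g" using separated_features_unique[OF A _ _ F x _ y] f g x y r by blast
    next
      fix C D assume "D \<subseteq> comp_edges F C \<and> circle D"
      then show "odd_negative D" using A by (auto simp: separated_features_def comp_edges_def)
    qed
  qed
qed

lemma comp_graph_inj: "inj (comp_graph F)"
proof (rule injI)
  fix C D assume "comp_graph F C = comp_graph F D"
  then have "sg_nodes (comp_graph F C) = sg_nodes (comp_graph F D)" by simp
  then show "C = D" by (simp add: comp_graph_def)
qed

text \<open>
  If every component has a feature, then it has exactly one, and the loop-trees and pseudo-trees are the
  components whose feature is not a halfedge.
\<close>

lemma pc_plus_lc:
  assumes F: "F \<subseteq> E" and sep: "separated_features F"
    and cover: "\<And>C. C \<in> comps F \<Longrightarrow> \<exists>f. feature F f \<and> nodes_of f \<subseteq> C"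
  shows "pc G F + lc G F = num_halffree F"
proof -
  let ?P = "{C \<in> comps F. pseudo_tree (comp_graph F C)}"
  let ?L = "{C \<in> comps F. loop_tree (comp_graph F C)}"
  have kinds: "signed_tree (comp_graph F C) \<or> halfedge_tree (comp_graph F C) \<or>
      loop_tree (comp_graph F C) \<or> pseudo_tree (comp_graph F C)" if "C \<in> comps F" for C
    using that sep unfolding pseudo_forest_iff[OF F, symmetric] pseudo_forest_def
      sg_components_restrict[OF F] by blast
  have card: "card {K \<in> comp_graph F ` comps F. Q K} = card {C \<in> comps F. Q (comp_graph F C)}" for Q
  proof -
    have "{K \<in> comp_graph F ` comps F. Q K} = comp_graph F ` {C \<in> comps F. Q (comp_graph F C)}"
      by auto
    then show ?thesis by (simp add: card_image inj_on_subset[OF comp_graph_inj])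
  qed
  have "pc G F + lc G F = card ?P + card ?L"
    unfolding pc_def lc_def sg_components_restrict[OF F] card ..
  also have "\<dots> = card (?P \<union> ?L)"
    using component_class_iff(3)[OF F] finite_comps by (subst card_Un_disjoint) auto
  also have "?P \<union> ?L = {C \<in> comps F. halffree F C}"
    using component_class_iff(2)[OF F _ kinds cover] by blast
  finally show ?thesis by (simp add: num_halffree_def)
qed

section \<open>Maximal pseudo-forests\<close>

definition sgn_of :: "'e \<Rightarrow> real" where
  "sgn_of e = (if sg_sign G e = Negative then -1 else 1)"

text \<open>
  The condition that the edge \<open>e\<close> imposes on a vector in the left kernel of an incidence matrix,
  independently of the orientation.
\<close>

definition sat :: "('v \<Rightarrow> real) \<Rightarrow> 'e \<Rightarrow> bool" where
  "sat z e \<longleftrightarrow> (\<forall>j k. j \<noteq> k \<longrightarrow> ends e = {#j, k#} \<longrightarrow> z j = sgn_of e * z k) \<and>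
    (\<not> link e \<longrightarrow> (\<forall>j. j \<in># ends e \<longrightarrow> z j = 0))"

text \<open>
  The combinatorial counterpart of \<open>separating\<close>: no component of \<open>S\<close> is balanced.
\<close>

definition unbalanced :: "'e set \<Rightarrow> bool" where
  "unbalanced S \<longleftrightarrow> (\<forall>z. (\<forall>e\<in>S. sat z e) \<longrightarrow> (\<forall>v\<in>V. z v = 0))"

lemma sgn_of_cases: "sgn_of e \<in> {1, -1}"
  by (simp add: sgn_of_def)

lemma sgn_of_square [simp]: "sgn_of e * sgn_of e = 1" "sgn_of e * (sgn_of e * x) = x"
  by (simp_all add: sgn_of_def)

lemma sat_link_iff:
  assumes "j \<noteq> k" and "ends e = {#j, k#}"
  shows "sat z e \<longleftrightarrow> z j = sgn_of e * z k"
proof -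
  have "link e" using assms by (auto simp: is_link_def)
  moreover have "z k = sgn_of e * z j" if "z j = sgn_of e * z k" using that by simp
  ultimately show ?thesis using assms by (auto simp: sat_def pair_mset_eq_iff)
qed

lemma sat_nonlink_iff:
  "\<not> link e \<Longrightarrow> set_mset (ends e) = {j} \<Longrightarrow> sat z e \<longleftrightarrow> z j = 0"
  unfolding sat_def is_link_def by auto

lemma unbalanced_mono: "unbalanced S \<Longrightarrow> S \<subseteq> S' \<Longrightarrow> unbalanced S'"
  unfolding unbalanced_def by blast

lemma not_sat_linkE:
  assumes "\<not> sat z e" and "link e"
  obtains j k where "j \<noteq> k" "ends e = {#j, k#}" "z j \<noteq> sgn_of e * z k"
  using assms by (auto simp: sat_def)

text \<open>
  Reversing the sign of the single violated edge makes \<open>z\<close> a sign potential of the circle, so the product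
  of the original signs is \<open>-1\<close>.
\<close>

lemma odd_negative_if_one_violated:
  assumes D: "circle D" and z: "\<And>v. z v \<in> {1, -1::real}"
    and e: "e \<in> D" "\<not> sat z e" and others: "\<And>f. f \<in> D \<Longrightarrow> f \<noteq> e \<Longrightarrow> sat z f"
  shows "odd_negative D"
proof -
  define \<sigma> where "\<sigma> = sgn_of(e := - sgn_of e)"
  have zs: "z j = \<sigma> f * z k" if f: "f \<in> D" "ends f = {#j, k#}" for f j k
  proof -
    have "link f" using is_circle_links[OF D f(1)] .
    then have jk: "j \<noteq> k" using f(2) by (auto simp: is_link_def pair_mset_eq_iff)
    show ?thesis
    proof (cases "f = e")
      case True
      then have "z j \<noteq> sgn_of e * z k" using e(2) sat_link_iff[OF jk, of e] f(2) by simp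
      then show ?thesis
        using True z[of j] z[of k] sgn_of_cases[of e] by (auto simp: \<sigma>_def)
    next
      case False
      then show ?thesis using others[OF f(1)] sat_link_iff[OF jk f(2)] by (simp add: \<sigma>_def)
    qed
  qed
  have one: "(\<Prod>f\<in>D. \<sigma> f) = 1"
    by (rule circle_sign_product[OF D, of z, OF z zs])
  have fin: "finite D" using is_circle_finite[OF D] .
  have "(\<Prod>f\<in>D. \<sigma> f) = \<sigma> e * (\<Prod>f\<in>D - {e}. \<sigma> f)"
    using prod.remove[OF fin e(1), of \<sigma>] .
  also have "(\<Prod>f\<in>D - {e}. \<sigma> f) = (\<Prod>f\<in>D - {e}. sgn_of f)"
    by (rule prod.cong) (auto simp: \<sigma>_def)
  also have "\<sigma> e * \<dots> = - (\<Prod>f\<in>D. sgn_of f)"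
    using prod.remove[OF fin e(1), of sgn_of] by (simp add: \<sigma>_def)
  also have "(\<Prod>f\<in>D. sgn_of f) = (-1) ^ card {f\<in>D. sg_sign G f = Negative}"
    using fin by (simp add: sgn_of_def prod.If_cases Int_def)
  finally have "(-1::real) ^ card {f\<in>D. sg_sign G f = Negative} = -1" using one by simp
  then show ?thesis unfolding odd_negative_def by (cases "even (card {f\<in>D. sg_sign G f = Negative})") auto
qed

lemma maximal_iff:
  "F \<in> maximal_pseudo_forests G \<longleftrightarrow> F \<subseteq> E \<and> separated_features F \<and>
    (\<forall>F'. F \<subseteq> F' \<and> F' \<subseteq> E \<and> separated_features F' \<longrightarrow> F' = F)"
  unfolding maximal_pseudo_forests_def mem_Collect_eq using pseudo_forest_iff by metis

text \<open>
  Adding to a pseudo-forest an edge that leaves the components unchanged. A component without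
  features may acquire one feature, but not more.
\<close>

lemma separated_features_insert:
  assumes F: "F \<subseteq> E" and sep: "separated_features F"
    and closure: "\<And>x. comp (insert e F) x = comp F x"
    and none: "\<And>f. feature F f \<Longrightarrow> \<not> nodes_of f \<subseteq> comp F r"
    and new: "\<And>f. feature (insert e F) f \<Longrightarrow> e \<in> f \<Longrightarrow> nodes_of f \<inter> comp F r \<noteq> {}"
    and uniq: "\<And>f g. feature (insert e F) f \<Longrightarrow> e \<in> f \<Longrightarrow> feature (insert e F) g \<Longrightarrow> e \<in> g \<Longrightarrow> f = g"
    and odd: "\<And>D. D \<subseteq> insert e F \<Longrightarrow> circle D \<Longrightarrow> e \<in> D \<Longrightarrow> odd_negative D"
    and e: "e \<in> E"
  shows "separated_features (insert e F)"
  unfolding separated_features_def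
proof (intro conjI allI impI)
  fix D assume "D \<subseteq> insert e F" "circle D"
  then show "odd_negative D"
    using odd sep unfolding separated_features_def by (cases "e \<in> D") (blast, blast)
next
  fix f g x y
  assume f: "feature (insert e F) f" and g: "feature (insert e F) g"
    and x: "x \<in> nodes_of f" and y: "y \<in> nodes_of g" "y \<in> comp (insert e F) x"
  have FE: "insert e F \<subseteq> E" using F e by blast
  have x_iff: "x \<in> comp F r \<longleftrightarrow> y \<in> comp F r"
    using y(2) unfolding closure by (metis comp_eq comp_refl)
  have old: "feature F h" if "feature (insert e F) h" "e \<notin> h" for h
    using feature_restrict[OF that(1)] feature_subset[OF that(1)] that(2) by blast
  have in_C: "v \<in> comp F r" if h: "feature (insert e F) h" "e \<in> h" "v \<in> nodes_of h" for h v
  proof -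
    obtain w where "w \<in> nodes_of h" "w \<in> comp F r" using new[OF h(1,2)] by blast
    then show ?thesis
      using feature_nodes_subset_comp[OF h(1) FE, of w r] h(3) unfolding closure by blast
  qed
  have not_in_C: "v \<notin> comp F r" if h: "feature (insert e F) h" "e \<notin> h" "v \<in> nodes_of h" for h v
    using feature_nodes_subset_comp[OF old[OF h(1,2)] F h(3)] none[OF old[OF h(1,2)]] by blast
  show "f = g"
  proof (cases "e \<in> f"; cases "e \<in> g")
    assume "e \<in> f" "e \<in> g" then show ?thesis using uniq f g by blast
  next
    assume "e \<in> f" "e \<notin> g" then show ?thesis using in_C[OF f _ x] not_in_C[OF g _ y(1)] x_iff by blast
  next
    assume "e \<notin> f" "e \<in> g" then show ?thesis using not_in_C[OF f _ x] in_C[OF g _ y(1)] x_iff by blast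
  next
    assume "e \<notin> f" "e \<notin> g"
    then show ?thesis
      using sep old[OF f] old[OF g] x y unfolding separated_features_def closure by blast
  qed
qed

text \<open>
  A component \<open>C\<close> without features is a balanced tree, so it carries a sign potential; extended by zero
  outside \<open>C\<close>, this is violated by some edge \<open>e\<close> because the whole graph is unbalanced. The edge
  \<open>e\<close> can be added to the pseudo-forest, contradicting maximality: if \<open>e\<close> is a halfedge or
  loop at \<open>C\<close>, it is the only feature of the new component; if \<open>e\<close> is a link inside \<open>C\<close>, it closes at
  most one circle, which is odd; and if \<open>e\<close> joins \<open>C\<close> to another component, no feature arises.
\<close>

lemma maximal_pseudo_forest_has_features:
  assumes max: "F \<in> maximal_pseudo_forests G" and unb: "unbalanced E" and r: "r \<in> V"
  shows "\<exists>f. feature F f \<and> nodes_of f \<subseteq> comp F r"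
proof (rule ccontr)
  assume no: "\<not> ?thesis"
  then have none: "\<And>f. feature F f \<Longrightarrow> \<not> nodes_of f \<subseteq> comp F r" by blast
  have F: "F \<subseteq> E" and sep: "separated_features F" using max by (auto simp: maximal_iff)
  define C where "C = comp F r"
  define FC where "FC = {e\<in>F. link e \<and> set_mset (ends e) \<subseteq> C}"
  have fin: "finite FC" using finite_subset[OF F finite_E] by (simp add: FC_def)
  have acyc: "\<not> circle D" if "D \<subseteq> FC" for D
  proof
    assume "circle D"
    then have "feature F D" "nodes_of D \<subseteq> C"
      using that by (auto simp: feature_def FC_def nodes_of_def)
    then show False using none C_def by blast
  qed
  have "\<exists>z. (\<forall>v. z v \<in> {1, -1::real}) \<and>
    (\<forall>e\<in>FC. \<forall>j k. ends e = {#j, k#} \<longrightarrow> z j = sgn_of e * z k)"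
    using acyc sgn_of_cases by (intro acyclic_sign_potential fin) (auto simp: FC_def)
  then obtain z where z: "\<And>v. z v \<in> {1, -1::real}"
    and zFC: "\<And>e j k. e \<in> FC \<Longrightarrow> ends e = {#j, k#} \<Longrightarrow> z j = sgn_of e * z k" by blast
  have z0: "z v \<noteq> 0" for v using z[of v] by auto
  define y where "y v = (if v \<in> C then z v else 0)" for v
  have "y r \<noteq> 0" using z0 by (simp add: y_def C_def)
  then obtain e where e: "e \<in> E" "\<not> sat y e" using unb r unfolding unbalanced_def by blast
  have satF: "sat y f" if f: "f \<in> F" for f
  proof (cases "link f")
    case True
    then obtain j k where jk: "j \<noteq> k" "ends f = {#j, k#}" by (auto simp: is_link_def)
    have "j \<in> C \<longleftrightarrow> k \<in> C" unfolding C_def by (rule comp_link_iff[OF f jk(2)])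
    moreover have "f \<in> FC" if "j \<in> C" "k \<in> C" using that f True jk by (auto simp: FC_def)
    ultimately show ?thesis
      using zFC jk unfolding sat_link_iff[OF jk] y_def by auto
  next
    case False
    then obtain j where j: "set_mset (ends f) = {j}" using nonlink_loop_or_half f F by blast
    have "feature F {f}" using False f by (auto simp: feature_def)
    then have "j \<notin> C" using none[of "{f}"] j by (auto simp: nodes_of_def C_def)
    then show ?thesis unfolding sat_nonlink_iff[OF False j] y_def by simp
  qed
  have eF: "e \<notin> F" using e satF by blast
  have "separated_features (insert e F)"
  proof (cases "link e")
    case False
    then obtain j where j: "set_mset (ends e) = {j}" using nonlink_loop_or_half e by blast
    then have jC: "j \<in> C" using e(2) unfolding sat_nonlink_iff[OF False j] y_def by (auto split: if_splits)
    have "adjacent (insert e F) = adjacent F" using False by (auto simp: link_rel_def is_link_def)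
    then have clos: "comp (insert e F) x = comp F x" for x by (simp add: comp_def)
    have new: "f = {e}" if "feature (insert e F) f" "e \<in> f" for f
      using that False is_circle_links[of ends f e] by (auto simp: feature_def)
    show ?thesis
    proof (rule separated_features_insert[OF F sep clos none])
      fix f assume "feature (insert e F) f" "e \<in> f"
      then show "nodes_of f \<inter> comp F r \<noteq> {}"
        using new jC j by (auto simp: nodes_of_def C_def)
    next
      fix D assume "circle D" "e \<in> D"
      then show "odd_negative D" using False is_circle_links[of ends D e] by simp
    qed (use new e in blast)+
  next
    case True
    obtain j k where jk: "j \<noteq> k" "ends e = {#j, k#}" "j \<in> C"
    proof -
      obtain x w where xw: "x \<noteq> w" "ends e = {#x, w#}" "y x \<noteq> sgn_of e * y w"
        using not_sat_linkE[OF e(2) True] .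
      then have "x \<in> C \<or> w \<in> C" by (auto simp: y_def split: if_splits)
      then show thesis using that[of x w] that[of w x] xw by (auto simp: add_mset_commute)
    qed
    show ?thesis
    proof (cases "k \<in> C")
      case kC: True
      have "adjacent (insert e F) \<subseteq> (adjacent F)\<^sup>*"
      proof
        fix p assume "p \<in> adjacent (insert e F)"
        then obtain x w f where p: "p = (x, w)" "f \<in> insert e F" "ends f = {#x, w#}" "x \<noteq> w"
          by (auto simp: link_rel_def)
        show "p \<in> (adjacent F)\<^sup>*"
        proof (cases "f = e")
          case True
          then have "x \<in> C" "w \<in> C" using p jk kC by (auto simp: pair_mset_eq_iff)
          then have "w \<in> comp F x" using comp_eq unfolding C_def by metis
          then show ?thesis by (simp add: p comp_def)
        next
          case False
          then show ?thesis using p by (auto simp: link_rel_def)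
        qed
      qed
      then have "(adjacent (insert e F))\<^sup>* = (adjacent F)\<^sup>*"
        using rtrancl_subset[of "adjacent F" "adjacent (insert e F)"] link_rel_mono[of F "insert e F" ends]
        by blast
      then have clos: "comp (insert e F) x = comp F x" for x by (simp add: comp_def)
      have new: "circle f \<and> f \<subseteq> insert e FC" if f: "feature (insert e F) f" "e \<in> f" for f
      proof -
        have circ: "circle f" using f True by (auto simp: feature_def)
        have "j \<in> nodes_of f" using f(2) jk by (auto simp: nodes_of_def intro!: bexI[of _ e])
        then have "nodes_of f \<subseteq> C"
          using feature_nodes_subset_comp[OF f(1), of j r] jk(3) F e(1) unfolding clos C_def by blast
        then have "f \<subseteq> insert e FC"
          using feature_subset[OF f(1)] is_circle_links[OF circ] by (auto simp: FC_def nodes_of_def)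
        then show ?thesis using circ by blast
      qed
      show ?thesis
      proof (rule separated_features_insert[OF F sep clos none])
        fix f assume f: "feature (insert e F) f" "e \<in> f"
        have "j \<in> nodes_of f" using f(2) jk by (auto simp: nodes_of_def intro!: bexI[of _ e])
        then show "nodes_of f \<inter> comp F r \<noteq> {}" using jk(3) unfolding C_def by blast
        fix g assume g: "feature (insert e F) g" "e \<in> g"
        show "f = g"
        proof (rule ccontr)
          assume "f \<noteq> g"
          then obtain D where D: "D \<subseteq> (f - g) \<union> (g - f)" "circle D"
            using circle_in_symmetric_difference new[OF f] new[OF g] by blast
          then have "D \<subseteq> FC" using new[OF f] new[OF g] f(2) g(2) by blast
          then show False using acyc D(2) by blast
        qed
      next
        fix D assume D: "D \<subseteq> insert e F" "circle D" "e \<in> D"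
        then have "feature (insert e F) D" by (simp add: feature_def)
        then have DF: "D \<subseteq> insert e FC" using new D by blast
        show "odd_negative D"
        proof (rule odd_negative_if_one_violated[OF D(2) z D(3)])
          show "\<not> sat z e" using e(2) jk kC unfolding sat_link_iff[OF jk(1,2)] by (simp add: y_def)
          fix f assume "f \<in> D" "f \<noteq> e"
          then have f: "f \<in> FC" using DF by blast
          then obtain x w where xw: "x \<noteq> w" "ends f = {#x, w#}" by (auto simp: FC_def is_link_def)
          show "sat z f" by (rule iffD2[OF sat_link_iff[OF xw] zFC[OF f xw(2)]])
        qed
      next
        show "e \<in> E" using e by blast
      qed
    next
      case kC: False
      have old: "e \<notin> D" if "D \<subseteq> insert e F" "circle D" for D
      proof
        assume "e \<in> D"
        then have "(j, k) \<in> (adjacent (D - {e}))\<^sup>*"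
          using circle_minus_edge_connected[OF that(2) _ jk(2)] by blast
        then have "(j, k) \<in> (adjacent F)\<^sup>*"
          using that(1) by (elim link_rel_rtrancl_mono) blast
        then have "k \<in> comp F j" by (simp add: comp_def)
        then show False using jk(3) kC comp_eq unfolding C_def by metis
      qed
      have featF: "feature F f" if "feature (insert e F) f" for f
        using that old[of f] True by (auto simp: feature_def)
      have out: "x \<notin> C" if "feature F f" "x \<in> nodes_of f" for f x
        using feature_nodes_subset_comp[OF that(1) F that(2)] none[OF that(1)] unfolding C_def by blast
      \<comment> \<open>A path that starts outside \<open>C\<close> can enter \<open>C\<close> only from \<open>k\<close>, hence all of \<open>C\<close> is attached to the component of \<open>k\<close>.\<close>
      have reach: "(w \<in> C \<longrightarrow> k \<in> comp F x) \<and> (w \<notin> C \<longrightarrow> w \<in> comp F x)"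
        if x: "x \<notin> C" and "w \<in> comp (insert e F) x" for x w
      proof -
        have "(x, w) \<in> (adjacent (insert e F))\<^sup>*" using that by (simp add: comp_def)
        then show ?thesis
        proof (induction rule: rtrancl_induct)
          case base then show ?case using x by simp
        next
          case (step u w)
          then obtain f where f: "f \<in> insert e F" "ends f = {#u, w#}" "u \<noteq> w"
            by (auto simp: link_rel_def)
          show ?case
          proof (cases "f = e")
            case True
            then have "(u = j \<and> w = k) \<or> (u = k \<and> w = j)" using f jk by (auto simp: pair_mset_eq_iff)
            then show ?thesis using step.IH jk(3) kC by auto
          next
            case False
            then have fF: "f \<in> F" using f by blast
            have "u \<in> C \<longleftrightarrow> w \<in> C" unfolding C_def by (rule comp_link_iff[OF fF f(2)])
            then show ?thesis using step.IH comp_step[OF fF f(2), of x] by blast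
          qed
        qed
      qed
      show ?thesis
        unfolding separated_features_def
      proof (intro conjI allI impI)
        fix D assume D: "D \<subseteq> insert e F" "circle D"
        have "D \<subseteq> F" using D(1) old[OF D] by blast
        then show "odd_negative D" using sep D(2) unfolding separated_features_def by simp
      next
        fix f g x w
        assume f: "feature (insert e F) f" and g: "feature (insert e F) g"
          and x: "x \<in> nodes_of f" and w: "w \<in> nodes_of g" "w \<in> comp (insert e F) x"
        have "x \<notin> C" "w \<notin> C" using out featF f g x w by blast+
        then have "w \<in> comp F x" using reach w(2) by blast
        then show "f = g" using sep featF[OF f] featF[OF g] x w(1) unfolding separated_features_def by blast
      qed
    qed
  qed
  then have "insert e F = F" using max F e(1) by (auto simp: maximal_iff)
  then show False using eF by blast
qed

lemma maximal_spanning_forest: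
  assumes S: "S \<subseteq> E"
  obtains F where "F \<subseteq> S" and "\<And>e. e \<in> F \<Longrightarrow> link e"
    and "\<And>D. D \<subseteq> F \<Longrightarrow> \<not> circle D"
    and "\<And>e. e \<in> S \<Longrightarrow> link e \<Longrightarrow> e \<notin> F \<Longrightarrow>
      \<exists>D. D \<subseteq> insert e F \<and> circle D \<and> e \<in> D"
proof -
  define \<F> where "\<F> = {F. F \<subseteq> {e\<in>S. link e} \<and> (\<forall>D\<subseteq>F. \<not> circle D)}"
  have "finite S" using finite_subset[OF S finite_E] .
  then have "finite \<F>" by (intro finite_subset[of \<F> "Pow S"]) (auto simp: \<F>_def)
  moreover have "{} \<in> \<F>" using is_circle_nonempty by (auto simp: \<F>_def)
  ultimately obtain F where F: "F \<in> \<F>" and max: "\<And>F'. F' \<in> \<F> \<Longrightarrow> F \<subseteq> F' \<Longrightarrow> F = F'"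
    using finite_has_maximal2[of \<F> "{}"] by metis
  have acyc: "\<not> circle D" if "D \<subseteq> F" for D using F that by (auto simp: \<F>_def)
  have "\<exists>D. D \<subseteq> insert e F \<and> circle D \<and> e \<in> D"
    if e: "e \<in> S" "link e" "e \<notin> F" for e
  proof -
    have "insert e F \<notin> \<F>" using max[of "insert e F"] e(3) by blast
    moreover have "insert e F \<subseteq> {e\<in>S. link e}" using F e by (auto simp: \<F>_def)
    ultimately obtain D where D: "D \<subseteq> insert e F" "circle D" unfolding \<F>_def by blast
    then have "e \<in> D" using acyc[of D] by blast
    then show ?thesis using D by blast
  qed
  moreover have "F \<subseteq> S" "\<And>e. e \<in> F \<Longrightarrow> link e" using F by (auto simp: \<F>_def)
  ultimately show thesis using that acyc by blast
qed

text \<open>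
  The witness consists of a maximal forest \<open>F0\<close> in \<open>S\<close> and, for each component \<open>C\<close> of \<open>S\<close>, one edge \<open>\<phi> C\<close>
  inside \<open>C\<close> that violates a sign potential \<open>z\<close> of \<open>F0\<close>; a halfedge is chosen wherever there is one. Each
  component then has exactly one feature, and it contains \<open>\<phi> C\<close>. The result is maximal among
  all pseudo-forests, because any further edge either is a feature, or joins two components with features,
  or closes a circle with \<open>F0\<close>.
\<close>

lemma pseudo_forest_with_same_components:
  assumes S: "S \<subseteq> E" and unb: "unbalanced S"
  obtains F where "F \<in> maximal_pseudo_forests G" and "F \<subseteq> S"
    and "num_halffree F = num_halffree S"
proof -
  obtain F0 where F0: "F0 \<subseteq> S" and links: "\<And>e. e \<in> F0 \<Longrightarrow> link e"
    and acyc: "\<And>D. D \<subseteq> F0 \<Longrightarrow> \<not> circle D"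
    and closing: "\<And>e. e \<in> S \<Longrightarrow> link e \<Longrightarrow> e \<notin> F0 \<Longrightarrow>
      \<exists>D. D \<subseteq> insert e F0 \<and> circle D \<and> e \<in> D"
    using maximal_spanning_forest[OF S] by blast
  have fin0: "finite F0" using finite_subset[OF F0 finite_subset[OF S finite_E]] .
  have "adjacent S \<subseteq> (adjacent F0)\<^sup>*"
  proof
    fix p assume "p \<in> adjacent S"
    then obtain x w e where p: "p = (x, w)" "e \<in> S" "ends e = {#x, w#}" "x \<noteq> w"
      by (auto simp: link_rel_def)
    show "p \<in> (adjacent F0)\<^sup>*"
    proof (cases "e \<in> F0")
      case True
      then show ?thesis using p by (auto simp: link_rel_def)
    next
      case False
      have "link e" using p by (auto simp: is_link_def)
      then obtain D where D: "D \<subseteq> insert e F0" "circle D" "e \<in> D"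
        using closing p(2) False by blast
      have "(x, w) \<in> (adjacent (D - {e}))\<^sup>*"
        using circle_minus_edge_connected[OF D(2,3) p(3)] .
      then show ?thesis unfolding p(1) by (rule link_rel_rtrancl_mono) (use D in blast)
    qed
  qed
  then have adj0: "(adjacent S)\<^sup>* = (adjacent F0)\<^sup>*"
    using rtrancl_subset[of "adjacent F0" "adjacent S"] link_rel_mono[OF F0, of ends] by blast
  have comp0: "comp F0 x = comp S x" for x using adj0 by (simp add: comp_def)
  have "\<exists>z. (\<forall>v. z v \<in> {1, -1::real}) \<and>
    (\<forall>e\<in>F0. \<forall>j k. ends e = {#j, k#} \<longrightarrow> z j = sgn_of e * z k)"
    using acyc sgn_of_cases links by (intro acyclic_sign_potential fin0) auto
  then obtain z where z: "\<And>v. z v \<in> {1, -1::real}"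
    and zF0: "\<And>e j k. e \<in> F0 \<Longrightarrow> ends e = {#j, k#} \<Longrightarrow> z j = sgn_of e * z k" by blast
  have z0: "z v \<noteq> 0" for v using z[of v] by auto
  have satF0: "sat z e" if e: "e \<in> F0" for e
  proof -
    obtain j k where jk: "j \<noteq> k" "ends e = {#j, k#}" using links[OF e] by (auto simp: is_link_def)
    show ?thesis by (rule iffD2[OF sat_link_iff[OF jk] zF0[OF e jk(2)]])
  qed
  have "\<exists>e\<in>S. set_mset (ends e) \<subseteq> C \<and> \<not> sat z e \<and> (halffree S C \<or> is_half e)"
    if C: "C \<in> comps S" for C
  proof (cases "halffree S C")
    case False
    then obtain e j where e: "e \<in> S" "ends e = {#j#}" "set_mset (ends e) \<subseteq> C"
      by (auto simp: halffree_def)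
    have "\<not> link e" using e(2) by (intro not_link_if_half_or_loop) blast
    then have "\<not> sat z e" using sat_nonlink_iff[of e j z] e(2) z0 by simp
    then show ?thesis using e by blast
  next
    case True
    obtain r where r: "r \<in> V" "C = comp S r" using C by (auto simp: comps_def)
    define y where "y v = (if v \<in> C then z v else 0)" for v
    have "y r \<noteq> 0" using z0 r by (simp add: y_def)
    then obtain e where e: "e \<in> S" "\<not> sat y e" using unb r(1) unfolding unbalanced_def by blast
    have "set_mset (ends e) \<subseteq> C \<and> \<not> sat z e"
    proof (cases "link e")
      case True
      obtain j k where jk: "j \<noteq> k" "ends e = {#j, k#}" "y j \<noteq> sgn_of e * y k"
        using not_sat_linkE[OF e(2) True] .
      have "j \<in> C \<longleftrightarrow> k \<in> C" unfolding r(2) by (rule comp_link_iff[OF e(1) jk(2)])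
      then show ?thesis using jk sat_link_iff[OF jk(1,2), of z] by (auto simp: y_def split: if_splits)
    next
      case False
      then obtain j where j: "set_mset (ends e) = {j}" using nonlink_loop_or_half e S by blast
      then have "j \<in> C" using e(2) unfolding sat_nonlink_iff[OF False j] y_def by (auto split: if_splits)
      then show ?thesis using sat_nonlink_iff[OF False j, of z] z0 j by simp
    qed
    then show ?thesis using e(1) True by blast
  qed
  then obtain \<phi> where \<phi>: "\<And>C. C \<in> comps S \<Longrightarrow> \<phi> C \<in> S"
    "\<And>C. C \<in> comps S \<Longrightarrow> set_mset (ends (\<phi> C)) \<subseteq> C"
    "\<And>C. C \<in> comps S \<Longrightarrow> \<not> sat z (\<phi> C)"
    "\<And>C. C \<in> comps S \<Longrightarrow> halffree S C \<or> is_half (\<phi> C)"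
    by metis
  define F where "F = F0 \<union> \<phi> ` comps S"
  have FS: "F \<subseteq> S" using F0 \<phi>(1) by (auto simp: F_def)
  have FE: "F \<subseteq> E" using FS S by blast
  have compF: "comp F x = comp S x" for x
    using comp_mono[of F0 F x] comp_mono[OF FS, of x] comp0[of x] by (auto simp: F_def)
  have compsF: "comps F = comps S" by (simp add: comps_def compF)
  \<comment> \<open>As \<open>F0\<close> has no features, a feature of \<open>F\<close> meeting \<open>C\<close> uses the only additional edge there.\<close>
  have feat: "\<phi> C \<in> f \<and> nodes_of f \<subseteq> C \<and> f \<subseteq> insert (\<phi> C) F0"
    if f: "feature F f" and C: "C \<in> comps S" and x: "x \<in> nodes_of f" "x \<in> C" for f C x
  proof -
    obtain r where r: "C = comp F r" using C by (auto simp: comps_def compF)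
    have sub: "nodes_of f \<subseteq> C" using feature_nodes_subset_comp[OF f FE] x unfolding r by blast
    have new: "e = \<phi> C" if e: "e \<in> f" "e \<notin> F0" for e
    proof -
      obtain D where D: "D \<in> comps S" "e = \<phi> D"
        using e feature_subset[OF f] by (auto simp: F_def)
      obtain v where v: "v \<in># ends e" using ends_nonempty e(1) feature_subset[OF f] FE by blast
      then have "v \<in> C" "v \<in> D" using sub e(1) D \<phi>(2)[OF D(1)] by (auto simp: nodes_of_def)
      then show ?thesis using comps_disjoint[OF C D(1)] D(2) by blast
    qed
    then have "f \<subseteq> insert (\<phi> C) F0" by blast
    moreover have "\<not> f \<subseteq> F0"
      using f acyc links by (auto simp: feature_def)
    ultimately show ?thesis using sub by blast
  qed
  have sep: "separated_features F"
    unfolding separated_features_def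
  proof (intro conjI allI impI)
    fix D assume D: "D \<subseteq> F" "circle D"
    then have f: "feature F D" by (simp add: feature_def)
    obtain x where x: "x \<in> nodes_of D" "x \<in> V" using feature_nodes_nonempty[OF f FE] .
    then have C: "comp S x \<in> comps S" by (simp add: comps_def)
    note fC = feat[OF f C x(1) comp_refl]
    show "odd_negative D"
    proof (rule odd_negative_if_one_violated[OF D(2) z])
      show "\<phi> (comp S x) \<in> D" using fC by blast
      show "\<not> sat z (\<phi> (comp S x))" using \<phi>(3)[OF C] .
      fix e assume "e \<in> D" "e \<noteq> \<phi> (comp S x)"
      then show "sat z e" using fC satF0 by blast
    qed
  next
    fix f g x y
    assume f: "feature F f" and g: "feature F g" and x: "x \<in> nodes_of f"
      and y: "y \<in> nodes_of g" "y \<in> comp F x"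
    have "x \<in> V" using x feature_subset[OF f] FE ends_in_V by (auto simp: nodes_of_def)
    then have C: "comp S x \<in> comps S" by (simp add: comps_def)
    note fC = feat[OF f C x comp_refl] and gC = feat[OF g C y[unfolded compF]]
    show "f = g"
    proof (cases "link (\<phi> (comp S x))")
      case True
      then have circ: "circle f" "circle g"
        using f g fC gC by (auto simp: feature_def)
      show ?thesis
      proof (rule ccontr)
        assume "f \<noteq> g"
        then obtain D where "D \<subseteq> (f - g) \<union> (g - f)" "circle D"
          using circle_in_symmetric_difference[OF circ] by blast
        then show False using acyc[of D] fC gC by blast
      qed
    next
      case False
      have "h = {\<phi> (comp S x)}" if "feature F h" "\<phi> (comp S x) \<in> h" for h
        using that False is_circle_links[of ends h "\<phi> (comp S x)"] by (auto simp: feature_def)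
      then show ?thesis using f g fC gC by blast
    qed
  qed
  have cover: "\<exists>f. feature F f \<and> nodes_of f \<subseteq> C" if C: "C \<in> comps S" for C
  proof (cases "link (\<phi> C)")
    case True
    have "\<phi> C \<notin> F0" using satF0 \<phi>(3)[OF C] by blast
    then obtain D where D: "D \<subseteq> insert (\<phi> C) F0" "circle D" "\<phi> C \<in> D"
      using closing[OF \<phi>(1)[OF C] True] by blast
    have "D \<subseteq> F" using D(1) C by (auto simp: F_def)
    then have f: "feature F D" using D(2) by (simp add: feature_def)
    obtain x where x: "x \<in># ends (\<phi> C)" using ends_nonempty \<phi>(1)[OF C] S by blast
    then have "x \<in> nodes_of D" "x \<in> C" using D(3) \<phi>(2)[OF C] by (auto simp: nodes_of_def)
    then show ?thesis using feat[OF f C] f by blast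
  next
    case False
    have "feature F {\<phi> C}" using False C by (auto simp: feature_def F_def)
    then show ?thesis using \<phi>(2)[OF C] by (auto simp: nodes_of_def)
  qed
  have "F \<in> maximal_pseudo_forests G"
    unfolding maximal_iff
  proof (intro conjI allI impI FE sep)
    fix F' assume F': "F \<subseteq> F' \<and> F' \<subseteq> E \<and> separated_features F'"
    show "F' = F"
    proof (rule ccontr)
      assume "F' \<noteq> F"
      then obtain e where e: "e \<in> F'" "e \<notin> F" using F' by blast
      have uniq: "g = h" if g: "feature F' g" "x \<in> nodes_of g" "x \<in> comp F' r"
        and h: "feature F' h" "y \<in> nodes_of h" "y \<in> comp F' r" for g h x y r
        using separated_features_unique[of F' g h x r y] F' g h by blast
      have atF: "\<exists>g x. feature F' g \<and> g \<subseteq> F \<and> nodes_of g \<subseteq> comp S v \<and> x \<in> nodes_of g \<and> x \<in> comp F' v"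
        if "v \<in> V" for v
      proof -
        have "comp S v \<in> comps S" using that by (simp add: comps_def)
        then obtain g where g: "feature F g" "nodes_of g \<subseteq> comp S v" using cover by blast
        obtain x where x: "x \<in> nodes_of g" using feature_nodes_nonempty[OF g(1) FE] by blast
        have "x \<in> comp F' v" using x g(2) comp_mono[of F F' v] F' compF by blast
        then show ?thesis using feature_mono[OF g(1), of F'] feature_subset[OF g(1)] F' g(2) x by blast
      qed
      have eE: "e \<in> E" using e F' by blast
      show False
      proof (cases "link e")
        case False
        then obtain j where j: "set_mset (ends e) = {j}" using nonlink_loop_or_half eE by blast
        then have "j \<in> V" using ends_in_V eE by blast
        then obtain g x where g: "feature F' g" "g \<subseteq> F" "x \<in> nodes_of g" "x \<in> comp F' j"
          using atF by blast
        have "feature F' {e}" using False e(1) by (auto simp: feature_def)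
        then have "{e} = g" using uniq[of "{e}" j j g x] g j by (simp add: nodes_of_def)
        then show False using g(2) e(2) by blast
      next
        case True
        then obtain j k where jk: "j \<noteq> k" "ends e = {#j, k#}" by (auto simp: is_link_def)
        then have jkV: "j \<in> V" "k \<in> V" using ends_in_V[OF eE] by auto
        obtain g x where g: "feature F' g" "g \<subseteq> F" "nodes_of g \<subseteq> comp S j" "x \<in> nodes_of g"
          "x \<in> comp F' j" using atF[OF jkV(1)] by blast
        obtain h y where h: "feature F' h" "h \<subseteq> F" "nodes_of h \<subseteq> comp S k" "y \<in> nodes_of h"
          "y \<in> comp F' k" using atF[OF jkV(2)] by blast
        have kj: "k \<in> comp F' j" using comp_step[OF e(1) jk(2)] by simp
        show False
        proof (cases "k \<in> comp S j")
          case False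
          have "y \<in> comp F' j" using h(5) comp_eq[OF kj] by simp
          then have "g = h" using uniq[OF g(1,4,5) h(1,4)] by blast
          then have "x \<in> comp S j" "x \<in> comp S k" using g h by blast+
          then show False using False comp_eq[of x S j] comp_eq[of x S k] comp_refl[of k S] by simp
        next
          case inS: True
          have "e \<notin> F0" using e(2) by (simp add: F_def)
          have "(j, k) \<in> (adjacent F0)\<^sup>*" using inS adj0 by (simp add: comp_def)
          moreover have "insert e F0 - {e} = F0" using \<open>e \<notin> F0\<close> by blast
          ultimately have "\<exists>D. D \<subseteq> insert e F0 \<and> circle D"
            using acyclic_bridge[of "insert e F0" ends e j k] fin0 links True jk(2) by auto
          then obtain D where D: "D \<subseteq> insert e F0" "circle D" by blast
          then have eD: "e \<in> D" using acyc[of D] by blast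
          have "D \<subseteq> F'" using D(1) e(1) F' by (auto simp: F_def)
          then have "feature F' D" using D(2) by (simp add: feature_def)
          moreover have "j \<in> nodes_of D" using eD jk by (auto simp: nodes_of_def intro!: bexI[of _ e])
          ultimately have "D = g" using uniq[of D j j g x] g by simp
          then show False using eD g(2) e(2) by blast
        qed
      qed
    qed
  qed
  moreover have "num_halffree F = num_halffree S"
  proof -
    have "halffree F C \<longleftrightarrow> halffree S C" if C: "C \<in> comps S" for C
    proof
      assume "halffree F C"
      moreover have "\<phi> C \<in> F" using C by (simp add: F_def)
      ultimately show "halffree S C" using \<phi>(2,4)[OF C] by (auto simp: halffree_def)
    next
      assume "halffree S C"
      then show "halffree F C" using FS by (auto simp: halffree_def)
    qed
    then have "{C \<in> comps S. halffree F C} = {C \<in> comps S. halffree S C}" by blast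
    then show ?thesis by (simp add: num_halffree_def compsF)
  qed
  ultimately show thesis using that FS by blast
qed

text \<open>
  Every halfedge-free component of \<open>S\<close> contains a component of \<open>F\<close>, and it is halfedge-free too.
\<close>

lemma num_halffree_antimono:
  assumes "F \<subseteq> S" and "S \<subseteq> E"
  shows "num_halffree S \<le> num_halffree F"
proof -
  define rep where "rep C = (SOME v. v \<in> V \<and> C = comp S v)" for C
  have rep: "rep C \<in> V" "C = comp S (rep C)" if C: "C \<in> comps S" for C
  proof -
    have "\<exists>v. v \<in> V \<and> C = comp S v" using C by (auto simp: comps_def)
    from someI_ex[OF this] show "rep C \<in> V" "C = comp S (rep C)" by (simp_all add: rep_def)
  qed
  have sub: "comp F (rep C) \<subseteq> C" if C: "C \<in> comps S" for C
    using comp_mono[OF assms(1), of "rep C"] rep(2)[OF C] by simp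
  show ?thesis
    unfolding num_halffree_def
  proof (rule card_inj_on_le)
    show "inj_on (\<lambda>C. comp F (rep C)) {C \<in> comps S. halffree S C}"
    proof (rule inj_onI)
      fix C D
      assume C: "C \<in> {C \<in> comps S. halffree S C}" and D: "D \<in> {C \<in> comps S. halffree S C}"
        and eq: "comp F (rep C) = comp F (rep D)"
      have "rep C \<in> C" "rep C \<in> D"
        using sub[of C] sub[of D] C D eq comp_refl[of "rep C" F] by auto
      then show "C = D" using comps_disjoint C D by blast
    qed
    show "(\<lambda>C. comp F (rep C)) ` {C \<in> comps S. halffree S C} \<subseteq> {C \<in> comps F. halffree F C}"
    proof
      fix X assume "X \<in> (\<lambda>C. comp F (rep C)) ` {C \<in> comps S. halffree S C}"
      then obtain C where C: "C \<in> comps S" "halffree S C" "X = comp F (rep C)" by blast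
      have "halffree F X" using C sub[OF C(1)] assms(1) by (fastforce simp: halffree_def)
      then show "X \<in> {C \<in> comps F. halffree F C}" using C rep(1)[OF C(1)] by (auto simp: comps_def)
    qed
  qed (use finite_comps in simp)
qed

theorem mplc_eq_num_halffree:
  assumes S: "S \<subseteq> E" and unb: "unbalanced S"
  shows "mplc G S = num_halffree S"
proof -
  have val: "pc G F + lc G F = num_halffree F" if F: "F \<in> maximal_pseudo_forests G" for F
  proof (rule pc_plus_lc)
    show "F \<subseteq> E" "separated_features F" using F by (auto simp: maximal_iff)
    fix C assume "C \<in> comps F"
    then obtain r where "r \<in> V" "C = comp F r" by (auto simp: comps_def)
    then show "\<exists>f. feature F f \<and> nodes_of f \<subseteq> C"
      using maximal_pseudo_forest_has_features[OF F unbalanced_mono[OF unb S]] by blast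
  qed
  obtain F where F: "F \<in> maximal_pseudo_forests G" "F \<subseteq> S" "num_halffree F = num_halffree S"
    using pseudo_forest_with_same_components[OF S unb] .
  show ?thesis
    unfolding mplc_def
  proof (rule Min_eqI)
    have "finite {F. F \<subseteq> E}" using finite_E by simp
    then show "finite ((\<lambda>F. pc G F + lc G F) ` {F \<in> maximal_pseudo_forests G. F \<subseteq> S})"
      by (intro finite_imageI, rule rev_finite_subset) (auto simp: maximal_iff)
    show "num_halffree S \<in> (\<lambda>F. pc G F + lc G F) ` {F \<in> maximal_pseudo_forests G. F \<subseteq> S}"
      using F val by (intro image_eqI[of _ _ F]) auto
    fix n assume "n \<in> (\<lambda>F. pc G F + lc G F) ` {F \<in> maximal_pseudo_forests G. F \<subseteq> S}"
    then show "num_halffree S \<le> n" using val num_halffree_antimono[OF _ S] by auto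
  qed
qed

end

section \<open>Potentials\<close>

locale incidence = sgraph G for G :: "('v, 'e) signed_graph" +
  fixes A :: "'v \<Rightarrow> 'e \<Rightarrow> int"
  assumes incidence: "is_incidence G A"
begin

abbreviation a :: "'v \<Rightarrow> 'e \<Rightarrow> real" where "a v e \<equiv> real_of_int (A v e)"
abbreviation grad :: "('v \<Rightarrow> real) \<Rightarrow> 'e \<Rightarrow> real" where "grad \<equiv> pairing V a"

lemma pairing_sum_of_bool: "j \<in> V \<Longrightarrow> (\<Sum>v\<in>V. z v * of_bool (v = j)) = (z j :: real)"
  using finite_V by (simp add: of_bool_def if_distrib[of "\<lambda>x. _ * x"] cong: if_cong)

text \<open>
  The orientation only contributes the global sign \<open>s\<close> of the column.
\<close>

lemma edge_columnE:
  assumes "e \<in> E"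
  obtains s c where "s \<in> {1, -1}" "edge_column G e c"
    "\<And>z. grad z e = s * (\<Sum>v\<in>V. z v * of_int (c v))"
proof -
  obtain c s where c: "edge_column G e c" "s \<in> {1, -1::int}" "\<forall>v\<in>V. A v e = s * c v"
    using incidence assms unfolding is_incidence_def by blast
  have "grad z e = real_of_int s * (\<Sum>v\<in>V. z v * of_int (c v))" for z
    using c(3) by (simp add: pairing_def sum_distrib_left algebra_simps)
  moreover have "real_of_int s \<in> {1, -1}" using c(2) by auto
  ultimately show thesis using that c(1) by blast
qed

lemma pairing_link:
  assumes e: "e \<in> E" and jk: "j \<noteq> k" "ends e = {#j, k#}"
  obtains s where "s \<in> {1, -1}" and "\<And>z. grad z e = s * (z j - sgn_of e * z k)"
proof -
  obtain s c where s: "s \<in> {1, -1}" "edge_column G e c"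
    "\<And>z. grad z e = s * (\<Sum>v\<in>V. z v * of_int (c v))" using edge_columnE[OF e] by metis
  have V: "j \<in> V" "k \<in> V" using ends_in_V[OF e] jk by auto
  note sums = pairing_sum_of_bool[OF V(1)] pairing_sum_of_bool[OF V(2)]
  from s(2) show thesis
  proof cases
    case (1 j' k')
    then consider "j' = j" "k' = k" | "j' = k" "k' = j" using jk by (auto simp: pair_mset_eq_iff)
    then show thesis
    proof cases
      case 11: 1
      show thesis by (rule that[of s])
        (use s(1,3) 1 11 in \<open>auto simp: sgn_of_def sums algebra_simps sum_subtractf\<close>)
    next
      case 12: 2
      show thesis by (rule that[of "- s"])
        (use s(1,3) 1 12 in \<open>auto simp: sgn_of_def sums algebra_simps sum_subtractf\<close>)
    qed
  next
    case (2 j' k')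
    then have "(j' = j \<and> k' = k) \<or> (j' = k \<and> k' = j)" using jk by (auto simp: pair_mset_eq_iff)
    then show thesis
      by (intro that[of s])
        (use s(1,3) 2 in \<open>auto simp: sgn_of_def sums algebra_simps sum.distrib\<close>)
  next
    case (3 j')
    then show thesis using jk by simp
  next
    case (4 j')
    then show thesis using jk by (auto simp: pair_mset_eq_iff)
  qed
qed

lemma pairing_half:
  assumes e: "e \<in> E" and j: "ends e = {#j#}"
  obtains s where "s \<in> {1, -1}" and "\<And>z. grad z e = s * z j"
proof -
  obtain s c where s: "s \<in> {1, -1}" "edge_column G e c"
    "\<And>z. grad z e = s * (\<Sum>v\<in>V. z v * of_int (c v))" using edge_columnE[OF e] by metis
  have V: "j \<in> V" using ends_in_V[OF e] j by auto
  have "c = (\<lambda>v. of_bool (v = j))" using s(2) j by cases auto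
  then show thesis using that[of s] s(1,3) by (simp add: pairing_sum_of_bool[OF V])
qed

lemma pairing_loop:
  assumes e: "e \<in> E" and j: "ends e = {#j, j#}"
  obtains s where "s \<in> {1, -1}" and "\<And>z. grad z e = s * (2 * z j)"
proof -
  obtain s c where s: "s \<in> {1, -1}" "edge_column G e c"
    "\<And>z. grad z e = s * (\<Sum>v\<in>V. z v * of_int (c v))" using edge_columnE[OF e] by metis
  have V: "j \<in> V" using ends_in_V[OF e] j by auto
  have c: "c = (\<lambda>v. 2 * of_bool (v = j))" using s(2) j by cases (auto simp: pair_mset_eq_iff)
  have "(\<Sum>v\<in>V. z v * of_int (c v)) = 2 * z j" for z :: "'v \<Rightarrow> real"
  proof -
    have "(\<Sum>v\<in>V. z v * of_int (c v)) = (\<Sum>v\<in>V. 2 * (z v * of_bool (v = j)))"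
      by (simp add: c mult.left_commute)
    also have "\<dots> = 2 * z j" by (simp only: sum_distrib_left[symmetric] pairing_sum_of_bool[OF V])
    finally show ?thesis .
  qed
  then show thesis using that[of s] s(1,3) by simp
qed

lemma Ints_sign_mult_iff: "s \<in> {1, -1} \<Longrightarrow> s * x \<in> \<int> \<longleftrightarrow> (x::real) \<in> \<int>"
  by auto

lemma pairing_link_integral_iff:
  assumes "e \<in> E" "j \<noteq> k" "ends e = {#j, k#}"
  shows "grad z e \<in> \<int> \<longleftrightarrow> z j - sgn_of e * z k \<in> \<int>"
  using pairing_link[OF assms] Ints_sign_mult_iff by metis

lemma pairing_half_integral_iff:
  assumes "e \<in> E" "ends e = {#j#}"
  shows "grad z e \<in> \<int> \<longleftrightarrow> z j \<in> \<int>"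
  using pairing_half[OF assms] Ints_sign_mult_iff by metis

lemma pairing_loop_integral_iff:
  assumes "e \<in> E" "ends e = {#j, j#}"
  shows "grad z e \<in> \<int> \<longleftrightarrow> 2 * z j \<in> \<int>"
  using pairing_loop[OF assms] Ints_sign_mult_iff by metis

lemma pairing_eq_0_iff:
  assumes e: "e \<in> E"
  shows "grad z e = 0 \<longleftrightarrow> sat z e"
proof (cases "link e")
  case True
  then obtain j k where jk: "j \<noteq> k" "ends e = {#j, k#}" by (auto simp: is_link_def)
  obtain s where s: "s \<in> {1, -1}" "\<And>z. grad z e = s * (z j - sgn_of e * z k)"
    using pairing_link[OF e jk] by blast
  show ?thesis unfolding s(2) sat_link_iff[OF jk] using s(1) by auto
next
  case False
  then obtain j where j: "set_mset (ends e) = {j}" "is_half e \<or> is_loop e"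
    using nonlink_loop_or_half e by blast
  from j(2) show ?thesis
  proof (elim disjE exE)
    fix i assume i: "ends e = {#i#}"
    obtain s where s: "s \<in> {1, -1}" "\<And>z. grad z e = s * z i" using pairing_half[OF e i] by blast
    show ?thesis unfolding s(2) sat_nonlink_iff[OF False j(1)] using s(1) i j(1) by auto
  next
    fix i assume i: "ends e = {#i, i#}"
    obtain s where s: "s \<in> {1, -1}" "\<And>z. grad z e = s * (2 * z i)" using pairing_loop[OF e i] by blast
    show ?thesis unfolding s(2) sat_nonlink_iff[OF False j(1)] using s(1) i j(1) by auto
  qed
qed

lemma separating_iff_unbalanced: "S \<subseteq> E \<Longrightarrow> separating V a S \<longleftrightarrow> unbalanced S"
  unfolding separating_def unbalanced_def using pairing_eq_0_iff by (metis subsetD)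

text \<open>
  For separating \<open>S\<close>, the quotient of \<open>potentials S\<close> by \<open>potentials E\<close> has \<open>count S 0\<close> elements.
\<close>

definition potentials :: "'e set \<Rightarrow> ('v \<Rightarrow> real) set" where
  "potentials S = {z. \<forall>e\<in>S. grad z e \<in> \<int>}"

definition half_on :: "'v set set \<Rightarrow> 'v \<Rightarrow> real" where
  "half_on X v = (if v \<in> \<Union>X then 1/2 else 0)"

lemma potential_step:
  assumes S: "S \<subseteq> E" and z: "z \<in> potentials S" and e: "e \<in> S" "j \<noteq> k" "ends e = {#j, k#}"
  shows "z j - sgn_of e * z k \<in> \<int>"
  using z e S pairing_link_integral_iff[of e j k z] by (auto simp: potentials_def)

lemma potential_propagates:
  assumes S: "S \<subseteq> E" and z: "z \<in> potentials S" and v: "v \<in> comp S r"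
  shows "z v - z r \<in> \<int> \<or> z v + z r \<in> \<int>"
proof -
  have "(r, v) \<in> (adjacent S)\<^sup>*" using v by (simp add: comp_def)
  then show ?thesis
  proof (induction rule: rtrancl_induct)
    case (step u w)
    then obtain e where e: "e \<in> S" "ends e = {#w, u#}" "w \<noteq> u"
      by (auto simp: link_rel_def add_mset_commute)
    have st: "z w - sgn_of e * z u \<in> \<int>" using potential_step[OF S z e(1,3,2)] .
    have eqs: "z w - z r = (z w - z u) + (z u - z r)" "z w + z r = (z w - z u) + (z u + z r)"
      "z w + z r = (z w + z u) - (z u - z r)" "z w - z r = (z w + z u) - (z u + z r)" by simp_all
    show ?case
    proof (cases "sgn_of e = 1")
      case True
      then have "z w - z u \<in> \<int>" using st by simp
      then show ?thesis using step.IH eqs(1,2) Ints_add by metis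
    next
      case False
      then have "z w + z u \<in> \<int>" using st sgn_of_cases[of e] by simp
      then show ?thesis using step.IH eqs(3,4) Ints_diff by metis
    qed
  qed simp
qed

text \<open>
  Modulo 1 a potential equals \<open>z r\<close> or \<open>- z r\<close> at every node of the component of \<open>r\<close>. If these two values
  were different, then the sign would be determined at each node and would be a sign potential of the
  component, contradicting that \<open>S\<close> is unbalanced.
\<close>

lemma potential_half_integral:
  assumes S: "S \<subseteq> E" and unb: "unbalanced S" and z: "z \<in> potentials S"
    and r: "r \<in> V"
  shows "2 * z r \<in> \<int>"
proof (rule ccontr)
  assume not: "2 * z r \<notin> \<int>"
  define C where "C = comp S r"
  have excl: "\<not> (z v - z r \<in> \<int> \<and> z v + z r \<in> \<int>)" for v
  proof
    assume "z v - z r \<in> \<int> \<and> z v + z r \<in> \<int>"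
    then have "(z v + z r) - (z v - z r) \<in> \<int>" using Ints_diff by blast
    then show False using not by simp
  qed
  have dich: "z v - z r \<in> \<int> \<or> z v + z r \<in> \<int>" if "v \<in> C" for v
    using potential_propagates[OF S z] that by (simp add: C_def)
  define y :: "'v \<Rightarrow> real" where "y v = (if v \<in> C then (if z v - z r \<in> \<int> then 1 else -1) else 0)" for v
  have "sat y e" if e: "e \<in> S" for e
  proof (cases "link e")
    case True
    then obtain j k where jk: "j \<noteq> k" "ends e = {#j, k#}" by (auto simp: is_link_def)
    have iff: "j \<in> C \<longleftrightarrow> k \<in> C" unfolding C_def by (rule comp_link_iff[OF e jk(2)])
    have st: "z j - sgn_of e * z k \<in> \<int>" using potential_step[OF S z e jk] .
    show ?thesis
      unfolding sat_link_iff[OF jk]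
    proof (cases "j \<in> C")
      case False
      then show "y j = sgn_of e * y k" using iff by (simp add: y_def)
    next
      case jC: True
      then have kC: "k \<in> C" using iff by simp
      show "y j = sgn_of e * y k"
      proof (cases "sgn_of e = 1")
        case True
        have d: "z j - z k \<in> \<int>" using st True by simp
        have "z j - z r = (z j - z k) + (z k - z r)" "z k - z r = (z j - z r) - (z j - z k)" by simp_all
        then have "z j - z r \<in> \<int> \<longleftrightarrow> z k - z r \<in> \<int>" using d Ints_add Ints_diff by metis
        then show ?thesis using True jC kC by (simp add: y_def)
      next
        case False
        have d: "z j + z k \<in> \<int>" "sgn_of e = -1" using st False sgn_of_cases[of e] by auto
        have "z k + z r = (z j + z k) - (z j - z r)" "z j - z r = (z j + z k) - (z k + z r)" by simp_all
        then have "z j - z r \<in> \<int> \<longleftrightarrow> z k + z r \<in> \<int>" using d(1) Ints_diff by metis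
        then have "z j - z r \<in> \<int> \<longleftrightarrow> \<not> z k - z r \<in> \<int>" using excl[of k] dich[OF kC] by blast
        then show ?thesis using d(2) jC kC by (simp add: y_def)
      qed
    qed
  next
    case False
    have eE: "e \<in> E" using e S by blast
    obtain j where j: "set_mset (ends e) = {j}" "is_half e \<or> is_loop e"
      using nonlink_loop_or_half[OF eE False] by blast
    have "2 * z j \<in> \<int>"
      using j(2)
    proof (elim disjE exE)
      fix i assume i: "ends e = {#i#}"
      then have "z j \<in> \<int>"
        using z e j(1) pairing_half_integral_iff[OF eE i, of z] by (simp add: potentials_def)
      then show ?thesis by simp
    next
      fix i assume i: "ends e = {#i, i#}"
      then show ?thesis
        using z e j(1) pairing_loop_integral_iff[OF eE i, of z] by (simp add: potentials_def)
    qed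
    have "j \<notin> C"
    proof
      assume "j \<in> C"
      have "2 * z r = 2 * z j - (z j - z r) - (z j - z r)"
        "2 * z r = (z j + z r) + (z j + z r) - 2 * z j" by simp_all
      then show False using dich[OF \<open>j \<in> C\<close>] \<open>2 * z j \<in> \<int>\<close> not Ints_diff Ints_add by metis
    qed
    then show ?thesis unfolding sat_nonlink_iff[OF False j(1)] by (simp add: y_def)
  qed
  then have "y r = 0" using unb r unfolding unbalanced_def by blast
  then show False by (simp add: y_def C_def)
qed

lemma half_on_constant_along_edges:
  assumes S: "S \<subseteq> E" and X: "X \<subseteq> comps S" and e: "e \<in> S" "ends e = {#j, k#}"
  shows "half_on X j = half_on X k"
proof -
  have "j \<in> C \<longleftrightarrow> k \<in> C" if "C \<in> comps S" for C
    using that comp_link_iff[OF e] by (auto simp: comps_def)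
  then show ?thesis using X by (fastforce simp: half_on_def)
qed

text \<open>
  Being half-integral, a potential cannot distinguish the two signs of a link modulo 1, hence it is constant
  modulo 1 on components; and a halfedge forces this constant to be zero.
\<close>

theorem potentials_iff:
  assumes S: "S \<subseteq> E" and unb: "unbalanced S"
  shows "z \<in> potentials S \<longleftrightarrow>
    (\<exists>X \<subseteq> {C \<in> comps S. halffree S C}. \<forall>v\<in>V. z v - half_on X v \<in> \<int>)"
proof
  assume z: "z \<in> potentials S"
  have half: "2 * z r \<in> \<int>" if "r \<in> V" for r by (rule potential_half_integral[OF S unb z that])
  have const: "z w - z r \<in> \<int>" if "r \<in> V" "w \<in> comp S r" for r w
  proof -
    have "z w - z r = (z w + z r) - 2 * z r" by simp
    then show ?thesis using potential_propagates[OF S z that(2)] half[OF that(1)] Ints_diff by metis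
  qed
  have zero: "z v \<in> \<int>" if C: "C \<in> comps S" "\<not> halffree S C" "v \<in> C" for C v
  proof -
    obtain e j where e: "e \<in> S" "ends e = {#j#}" "j \<in> C"
      using C(2) by (auto simp: halffree_def)
    have eE: "e \<in> E" using e(1) S by blast
    have zj: "z j \<in> \<int>"
      using z e(1) pairing_half_integral_iff[OF eE e(2), of z] by (simp add: potentials_def)
    have "j \<in> V" using ends_in_V[OF eE] e(2) by simp
    moreover have "v \<in> comp S j" using comps_eqI[OF C(1) e(3)] C(3) by simp
    ultimately have "(z v - z j) + z j \<in> \<int>" using const zj Ints_add by blast
    then show ?thesis by simp
  qed
  define X where "X = {C \<in> comps S. \<exists>v\<in>C. z v \<notin> \<int>}"
  have "X \<subseteq> {C \<in> comps S. halffree S C}" using zero by (auto simp: X_def)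
  moreover have "z v - half_on X v \<in> \<int>" if v: "v \<in> V" for v
  proof (cases "z v \<in> \<int>")
    case True
    have "v \<notin> \<Union>X"
    proof
      assume "v \<in> \<Union>X"
      then obtain C w where C: "C \<in> comps S" "v \<in> C" "w \<in> C" "z w \<notin> \<int>" by (auto simp: X_def)
      then have "w \<in> comp S v" using comps_eqI by blast
      then have "(z w - z v) + z v \<in> \<int>" using const[OF v] True Ints_add by blast
      then show False using C(4) by simp
    qed
    then show ?thesis using True by (simp add: half_on_def)
  next
    case False
    have "comp S v \<in> X" using v False by (auto simp: X_def comps_def intro!: bexI[of _ v])
    then have "half_on X v = 1/2" unfolding half_on_def using comp_refl[of v S] by (auto simp del: comp_refl)
    moreover obtain m where m: "2 * z v = of_int m" using half[OF v] by (auto elim: Ints_cases)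
    moreover have "odd m"
    proof
      assume "even m"
      then obtain q where "m = 2 * q" by blast
      then have "z v = of_int q" using m by simp
      then show False using False by simp
    qed
    then obtain q where "m = 2 * q + 1" by (elim oddE)
    ultimately have "z v - half_on X v = of_int q" by simp
    then show ?thesis by simp
  qed
  ultimately show "\<exists>X \<subseteq> {C \<in> comps S. halffree S C}. \<forall>v\<in>V. z v - half_on X v \<in> \<int>" by blast
next
  assume "\<exists>X \<subseteq> {C \<in> comps S. halffree S C}. \<forall>v\<in>V. z v - half_on X v \<in> \<int>"
  then obtain X where X: "X \<subseteq> comps S" "\<And>C. C \<in> X \<Longrightarrow> halffree S C"
    and z: "\<And>v. v \<in> V \<Longrightarrow> z v - half_on X v \<in> \<int>" by blast
  have two: "2 * half_on X v \<in> \<int>" for v by (simp add: half_on_def)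
  show "z \<in> potentials S"
    unfolding potentials_def
  proof (intro CollectI ballI)
    fix e assume e: "e \<in> S"
    have eE: "e \<in> E" using e S by blast
    show "grad z e \<in> \<int>"
    proof (cases "link e")
      case True
      then obtain j k where jk: "j \<noteq> k" "ends e = {#j, k#}" by (auto simp: is_link_def)
      have V: "j \<in> V" "k \<in> V" using ends_in_V[OF eE] jk by auto
      have h: "half_on X j = half_on X k" by (rule half_on_constant_along_edges[OF S X(1) e jk(2)])
      have "z j - z k = (z j - half_on X j) - (z k - half_on X k)"
        "z j + z k = (z j - half_on X j) + (z k - half_on X k) + 2 * half_on X k"
        using h by simp_all
      then have "z j - z k \<in> \<int>" "z j + z k \<in> \<int>"
        using z[OF V(1)] z[OF V(2)] two[of k] Ints_diff Ints_add by metis+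
      then show ?thesis
        unfolding pairing_link_integral_iff[OF eE jk] using sgn_of_cases[of e] by auto
    next
      case False
      obtain j where j: "set_mset (ends e) = {j}" "is_half e \<or> is_loop e"
        using nonlink_loop_or_half[OF eE False] by blast
      have jV: "j \<in> V" using ends_in_V[OF eE] j by auto
      from j(2) show ?thesis
      proof (elim disjE exE)
        fix i assume i: "ends e = {#i#}"
        have "C \<notin> X" if "j \<in> C" for C
        proof -
          have "set_mset (ends e) \<subseteq> C" using j(1) that by simp
          then show ?thesis using X(2)[of C] e i unfolding halffree_def by blast
        qed
        then have "half_on X j = 0" by (auto simp: half_on_def)
        then have "z i \<in> \<int>" using z[OF jV] i j(1) by simp
        then show ?thesis unfolding pairing_half_integral_iff[OF eE i] .
      next
        fix i assume i: "ends e = {#i, i#}"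
        have "2 * z j = (z j - half_on X j) + (z j - half_on X j) + 2 * half_on X j" by simp
        then have "2 * z j \<in> \<int>" using z[OF jV] two[of j] Ints_add by metis
        then have "2 * z i \<in> \<int>" using i j(1) by simp
        then show ?thesis unfolding pairing_loop_integral_iff[OF eE i] .
      qed
    qed
  qed
qed

lemma potentials_integral: "(\<And>v. v \<in> V \<Longrightarrow> z v \<in> \<int>) \<Longrightarrow> z \<in> potentials S"
  unfolding potentials_def pairing_def by (auto intro!: Ints_sum Ints_mult)

sublocale lat: pairing_lattice V E a "potentials E"
proof
  show "finite V" "finite E" by (rule finite_V finite_E)+
  show "(\<lambda>v. 0) \<in> potentials E" by (rule potentials_integral) simp
  show "(\<lambda>v. p v - q v) \<in> potentials E" if "p \<in> potentials E" "q \<in> potentials E" for p q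
    using that by (auto simp: potentials_def pairing_diff)
  show "pairing V a p e \<in> \<int>" if "p \<in> potentials E" "e \<in> E" for p e
    using that by (auto simp: potentials_def)
qed

lemma comps_connected:
  assumes "F \<subseteq> E" and "sg_connected (sg_restrict G F)"
  shows "comps F = {V}"
proof -
  have adj: "sg_adj (sg_restrict G F) = adjacent F"
    by (subst sg_adj_eq) (auto simp: sg_restrict_def)
  have "comp F v = V" if "v \<in> V" for v
    using comp_subset_V[OF assms(1) that] assms(2) that
    unfolding sg_connected_def adj by (auto simp: comp_def sg_restrict_def)
  moreover have "V \<noteq> {}" using assms(2) by (auto simp: sg_connected_def sg_restrict_def)
  ultimately show ?thesis by (auto simp: comps_def)
qed

text \<open>
  In the connected case the group depends only on the presence of a halfedge.
\<close>

lemma potentials_connected_iff: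
  assumes S: "S \<subseteq> E" "unbalanced S" and conn: "comps S = {V}"
  shows "p \<in> potentials S \<longleftrightarrow> (\<forall>v\<in>V. p v \<in> \<int>) \<or>
    (S \<inter> sg_halfedges G = {} \<and> (\<forall>v\<in>V. p v - 1/2 \<in> \<int>))"
proof -
  have hf: "halffree S V \<longleftrightarrow> S \<inter> sg_halfedges G = {}"
    using S(1) ends_in_V by (auto simp: halffree_def sg_halfedges_def)
  have h0: "half_on {} v = 0" and h1: "v \<in> V \<Longrightarrow> half_on {V} v = 1/2" for v
    by (simp_all add: half_on_def)
  have "p \<in> potentials S \<longleftrightarrow> (\<exists>X\<subseteq>{C \<in> {V}. halffree S C}. \<forall>v\<in>V. p v - half_on X v \<in> \<int>)"
    using potentials_iff[OF S] conn by simp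
  also have "\<dots> \<longleftrightarrow> (\<forall>v\<in>V. p v - half_on {} v \<in> \<int>) \<or>
      (halffree S V \<and> (\<forall>v\<in>V. p v - half_on {V} v \<in> \<int>))"
    by (auto simp: subset_singleton_iff Collect_conv_if)
  also have "(\<forall>v\<in>V. p v - half_on {} v \<in> \<int>) \<longleftrightarrow> (\<forall>v\<in>V. p v \<in> \<int>)" by (simp add: h0)
  also have "(\<forall>v\<in>V. p v - half_on {V} v \<in> \<int>) \<longleftrightarrow> (\<forall>v\<in>V. p v - 1/2 \<in> \<int>)"
    by (intro ball_cong refl) (simp add: h1)
  finally show ?thesis by (simp add: hf)
qed

lemma half_not_integral: "(1/2::real) \<notin> \<int>"
proof
  assume "(1/2::real) \<in> \<int>"
  then obtain m where "(1/2::real) = of_int m" by (auto elim: Ints_cases)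
  then have "(1::real) = of_int (2 * m)" by simp
  then have "1 = 2 * m" by linarith
  then show False by presburger
qed

lemma half_on_diff_integral:
  assumes "half_on X v - half_on Y v \<in> \<int>"
  shows "v \<in> \<Union>X \<longleftrightarrow> v \<in> \<Union>Y"
proof -
  have half: "(1/2::real) \<notin> \<int>" by (rule half_not_integral)
  moreover have "- (1/2::real) \<notin> \<int>" using half Ints_minus[of "- (1/2::real)"] by auto
  ultimately show ?thesis using assms unfolding half_on_def by (auto split: if_splits)
qed

lemma comps_Union_inj:
  assumes X: "X \<subseteq> comps S" "Y \<subseteq> comps S" and eq: "\<And>v. v \<in> V \<Longrightarrow> v \<in> \<Union>X \<longleftrightarrow> v \<in> \<Union>Y"
  shows "X \<subseteq> Y"
proof
  fix C assume C: "C \<in> X"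
  then obtain v where v: "v \<in> V" "C = comp S v" using X(1) by (auto simp: comps_def)
  then have "v \<in> C" by simp
  then obtain D where D: "D \<in> Y" "v \<in> D" using eq[OF v(1)] C by blast
  then have "C = D" using comps_disjoint[of C S D v] X C \<open>v \<in> C\<close> by blast
  then show "C \<in> Y" using D by simp
qed

text \<open>
  Every class is represented by a function that is 1/2 on the union of a set \<open>X\<close> of halfedge-free
  components and 0 elsewhere. Without halfedges, \<open>X\<close> and its complement represent the same class,
  and the one avoiding the component of the fixed node \<open>r0\<close> is chosen.
\<close>

lemma count_zero:
  assumes conn: "comps E = {V}" and S: "S \<subseteq> E" and unb: "unbalanced S" and r0: "r0 \<in> V"
  defines "H \<equiv> {C \<in> comps S. halffree S C}"
  defines "\<X> \<equiv> (if sg_halfedges G \<noteq> {} then Pow H else Pow (H - {comp S r0}))"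
  shows "finite (lat.reach S (\<lambda>_. 0) // lat.lattice_rel S)"
    and "lat.count S (\<lambda>_. 0) = card \<X>"
proof -
  let ?R = "lat.lattice_rel S"
  have unbE: "unbalanced E" using unbalanced_mono[OF unb S] .
  note potE = potentials_connected_iff[OF subset_refl unbE conn]
  have EH: "E \<inter> sg_halfedges G = sg_halfedges G" by (auto simp: sg_halfedges_def)
  have XH: "X \<subseteq> H" if "X \<in> \<X>" for X using that by (auto simp: \<X>_def split: if_splits)
  have half_pot: "half_on X \<in> potentials S" if "X \<subseteq> H" for X
    unfolding potentials_iff[OF S unb] using that by (auto simp: H_def intro!: exI[of _ X])
  define pt where "pt X f = \<lfloor>grad (half_on X) f\<rfloor>" for X f
  have pt: "real_of_int (pt X f) = grad (half_on X) f" if "X \<subseteq> H" "f \<in> S" for X f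
    using half_pot[OF that(1)] that(2) by (auto simp: pt_def potentials_def)
  define \<psi> where "\<psi> X = ?R `` {pt X}" for X
  have "inj_on \<psi> \<X>"
  proof (rule inj_onI)
    fix X Y assume X: "X \<in> \<X>" and Y: "Y \<in> \<X>" and eq: "\<psi> X = \<psi> Y"
    have "(pt X, pt Y) \<in> ?R"
      using eq eq_equiv_class[OF _ lat.equiv_lattice_rel] by (simp add: \<psi>_def)
    then obtain p where p: "p \<in> potentials E"
      "\<And>f. f \<in> S \<Longrightarrow> real_of_int (pt X f) - real_of_int (pt Y f) = grad p f"
      by (auto simp: lat.lattice_rel_def)
    have "grad (\<lambda>v. (half_on X v - half_on Y v) - p v) f = 0" if "f \<in> S" for f
      using p(2)[OF that] pt[OF XH[OF X] that] pt[OF XH[OF Y] that] by (simp add: pairing_diff)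
    moreover have "separating V a S" using unb separating_iff_unbalanced[OF S] by simp
    ultimately have "\<forall>v\<in>V. (half_on X v - half_on Y v) - p v = 0"
      unfolding separating_def by blast
    then have pv: "half_on X v - half_on Y v = p v" if "v \<in> V" for v
      using that by simp
    have "p v \<in> \<int>" if v: "v \<in> V" for v
    proof (cases "sg_halfedges G = {}")
      case False
      then show ?thesis using p(1) v unfolding potE EH by blast
    next
      case True
      have "r0 \<notin> C" if "C \<in> H - {comp S r0}" for C
        using that comps_eqI[of C S r0] by (auto simp: H_def)
      then have "r0 \<notin> \<Union>X" "r0 \<notin> \<Union>Y" using X Y True by (auto simp: \<X>_def)
      then have "p r0 = 0" using pv[OF r0] by (simp add: half_on_def)
      moreover have "(0::real) - 1/2 \<notin> \<int>"
        using half_not_integral Ints_minus[of "0 - 1/2 :: real"] by auto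
      ultimately have "\<not> (\<forall>v\<in>V. p v - 1/2 \<in> \<int>)" using r0 by force
      then show ?thesis using p(1) v unfolding potE by blast
    qed
    then have same: "v \<in> \<Union>X \<longleftrightarrow> v \<in> \<Union>Y" if "v \<in> V" for v
      using that pv half_on_diff_integral by metis
    have XY: "X \<subseteq> comps S" "Y \<subseteq> comps S" using XH[OF X] XH[OF Y] by (auto simp: H_def)
    show "X = Y"
      using comps_Union_inj[OF XY same] comps_Union_inj[OF XY(2,1) same[symmetric]] by (rule subset_antisym)
  qed
  moreover have "\<psi> ` \<X> = lat.reach S (\<lambda>_. 0) // ?R"
  proof (intro equalityI subsetI)
    fix c assume "c \<in> \<psi> ` \<X>"
    then obtain X where X: "X \<in> \<X>" "c = \<psi> X" by blast
    have "pt X \<in> lat.reach S (\<lambda>_. 0)"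
      unfolding lat.reach_def using pt[OF XH[OF X(1)]] by (auto intro!: exI[of _ "half_on X"])
    then show "c \<in> lat.reach S (\<lambda>_. 0) // ?R" unfolding X(2) \<psi>_def by (rule quotientI)
  next
    fix c assume "c \<in> lat.reach S (\<lambda>_. 0) // ?R"
    then obtain x where x: "x \<in> lat.reach S (\<lambda>_. 0)" "c = ?R `` {x}" by (auto elim: quotientE)
    then obtain z where "\<forall>f\<in>S. 0 \<le> real_of_int (x f) - grad z f \<and> real_of_int (x f) - grad z f \<le> 0"
      by (auto simp: lat.reach_def)
    then have z: "real_of_int (x f) = grad z f" if "f \<in> S" for f using that by force
    have "grad z f \<in> \<int>" if "f \<in> S" for f using z[OF that] by (metis Ints_of_int)
    then have "z \<in> potentials S" by (simp add: potentials_def)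
    then have "\<exists>Y\<subseteq>H. \<forall>v\<in>V. z v - half_on Y v \<in> \<int>"
      using potentials_iff[OF S unb, of z] unfolding H_def by blast
    then obtain Y where Y: "Y \<subseteq> H" "\<And>v. v \<in> V \<Longrightarrow> z v - half_on Y v \<in> \<int>"
      by blast
    have "\<exists>X\<in>\<X>. (\<lambda>v. z v - half_on X v) \<in> potentials E"
    proof (cases "Y \<in> \<X>")
      case True
      then show ?thesis using Y(2) potentials_integral[of "\<lambda>v. z v - half_on Y v"] by blast
    next
      case False
      \<comment> \<open>Here the constant 1/2 is a potential of \<open>E\<close>, so \<open>Y\<close> may be replaced by its complement.\<close>
      then have no: "sg_halfedges G = {}" and r: "comp S r0 \<in> Y"
        using Y(1) by (auto simp: \<X>_def split: if_splits)
      have Hall: "H = comps S"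
        using no S by (auto simp: H_def halffree_def sg_halfedges_def)
      define X where "X = H - Y"
      have "X \<in> \<X>" using no r by (auto simp: X_def \<X>_def)
      have compl: "half_on X v = 1/2 - half_on Y v" if v: "v \<in> V" for v
      proof -
        have C: "comp S v \<in> comps S" using v by (auto simp: comps_def)
        have one: "v \<in> \<Union>Z \<longleftrightarrow> comp S v \<in> Z" if "Z \<subseteq> comps S" for Z
          using that comps_eqI comp_refl by (metis Union_iff subsetD)
        show ?thesis
          using one[of X] one[of Y] C Y(1) by (auto simp: half_on_def X_def Hall)
      qed
      have "(z v - half_on X v) - 1/2 \<in> \<int>" if v: "v \<in> V" for v
      proof -
        have "(z v - half_on X v) - 1/2 = (z v - half_on Y v) + (2 * half_on Y v - 1)"
          using compl[OF v] by simp
        moreover have "2 * half_on Y v - 1 \<in> \<int>" by (simp add: half_on_def)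
        ultimately show ?thesis using Y(2)[OF v] Ints_add by metis
      qed
      then have "(\<lambda>v. z v - half_on X v) \<in> potentials E" unfolding potE EH using no by simp
      then show ?thesis using \<open>X \<in> \<X>\<close> by blast
    qed
    then obtain X where X: "X \<in> \<X>" "(\<lambda>v. z v - half_on X v) \<in> potentials E" by blast
    have "real_of_int (x f) - real_of_int (pt X f) = grad (\<lambda>v. z v - half_on X v) f" if "f \<in> S" for f
      using z[OF that] pt[OF XH[OF X(1)] that] by (simp add: pairing_diff)
    then have "(x, pt X) \<in> ?R" using X(2) unfolding lat.lattice_rel_def by blast
    then have "c = \<psi> X" using equiv_class_eq[OF lat.equiv_lattice_rel] x(2) by (simp add: \<psi>_def)
    then show "c \<in> \<psi> ` \<X>" using X(1) by blast
  qed
  ultimately have bij: "bij_betw \<psi> \<X> (lat.reach S (\<lambda>_. 0) // ?R)" by (simp add: bij_betw_def)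
  have "finite \<X>" using finite_comps by (auto simp: \<X>_def H_def)
  then show "finite (lat.reach S (\<lambda>_. 0) // ?R)" "lat.count S (\<lambda>_. 0) = card \<X>"
    using bij_betw_finite[OF bij] bij_betw_same_card[OF bij] by (simp_all add: lat.count_def)
qed

lemma count_zero_eq_mplc:
  assumes conn: "comps E = {V}" and S: "S \<subseteq> E" and unb: "unbalanced S" and V: "V \<noteq> {}"
  shows "finite (lat.reach S (\<lambda>_. 0) // lat.lattice_rel S)"
    and "sg_halfedges G \<noteq> {} \<Longrightarrow> lat.count S (\<lambda>_. 0) = 2 ^ mplc G S"
    and "sg_halfedges G = {} \<Longrightarrow>
      real (lat.count S (\<lambda>_. 0)) = 2 powi (int (mplc G S) - 1)"
proof -
  obtain r0 where r0: "r0 \<in> V" using V by blast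
  note cz = count_zero[OF conn S unb r0]
  let ?H = "{C \<in> comps S. halffree S C}"
  have fin: "finite ?H" using finite_comps by simp
  have m: "mplc G S = card ?H"
    using mplc_eq_num_halffree[OF S unb] by (simp add: num_halffree_def)
  show "finite (lat.reach S (\<lambda>_. 0) // lat.lattice_rel S)" by (rule cz(1))
  show "lat.count S (\<lambda>_. 0) = 2 ^ mplc G S" if "sg_halfedges G \<noteq> {}"
    using cz(2) that fin by (simp add: m card_Pow)
  show "real (lat.count S (\<lambda>_. 0)) = 2 powi (int (mplc G S) - 1)" if no: "sg_halfedges G = {}"
  proof -
    have "halffree S C" for C using no S by (auto simp: halffree_def sg_halfedges_def)
    then have "comp S r0 \<in> ?H" using r0 by (auto simp: comps_def)
    then have c: "card (?H - {comp S r0}) = card ?H - 1" and pos: "card ?H > 0"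
      using fin by (auto simp: card_gt_0_iff)
    have "lat.count S (\<lambda>_. 0) = 2 ^ (card ?H - 1)"
      using cz(2) no fin c by (simp add: card_Pow)
    then have "real (lat.count S (\<lambda>_. 0)) = 2 ^ (card ?H - 1)" by simp
    also have "\<dots> = 2 powi int (card ?H - 1)" by simp
    also have "int (card ?H - 1) = int (card ?H) - 1" using pos by simp
    finally show ?thesis by (simp only: m)
  qed
qed

section \<open>Bases\<close>

lemma sgm_indep_iff:
  "sgm_indep G A F \<longleftrightarrow> F \<subseteq> E \<and>
    (\<forall>c. (\<forall>v\<in>V. (\<Sum>e\<in>F. c e * a v e) = 0) \<longrightarrow> (\<forall>e\<in>F. c e = 0))"
  by (simp add: sgm_indep_def)

lemma pairing_combination:
  "(\<Sum>v\<in>V. z v * (\<Sum>e\<in>F. c e * a v e)) = (\<Sum>e\<in>F. c e * grad z e)"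
proof -
  have "(\<Sum>v\<in>V. z v * (\<Sum>e\<in>F. c e * a v e)) = (\<Sum>v\<in>V. \<Sum>e\<in>F. c e * (z v * a v e))"
    by (simp add: sum_distrib_left algebra_simps)
  also have "\<dots> = (\<Sum>e\<in>F. \<Sum>v\<in>V. c e * (z v * a v e))" by (rule sum.swap)
  finally show ?thesis by (simp add: pairing_def sum_distrib_left)
qed

text \<open>
  If adding \<open>e\<close> to an independent set makes it dependent, then the column of \<open>e\<close> is a combination of the others.
\<close>

lemma grad_zero_on_closure:
  assumes ind: "sgm_indep G A F" and dep: "\<not> sgm_indep G A (insert e F)" and e: "e \<in> E"
    and z: "\<forall>f\<in>F. grad z f = 0"
  shows "grad z e = 0"
proof (cases "e \<in> F")
  case False
  have F: "F \<subseteq> E" using ind by (simp add: sgm_indep_def)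
  have finF: "finite F" using finite_subset[OF F finite_E] .
  obtain c where c: "\<forall>v\<in>V. (\<Sum>f\<in>insert e F. c f * a v f) = 0"
    "\<not> (\<forall>f\<in>insert e F. c f = 0)" using dep F e by (auto simp: sgm_indep_iff)
  have "c e \<noteq> 0"
  proof
    assume 0: "c e = 0"
    then have "\<forall>v\<in>V. (\<Sum>f\<in>F. c f * a v f) = 0" using c(1) False finF by simp
    then have "\<forall>f\<in>F. c f = 0" using ind unfolding sgm_indep_iff by blast
    then show False using c(2) 0 by simp
  qed
  moreover have "c e * grad z e + (\<Sum>f\<in>F. c f * grad z f) = 0"
    using pairing_combination[of z c "insert e F"] c(1) False finF by simp
  ultimately show ?thesis using z by simp
qed (use z in simp)

lemma basis_separating:
  assumes B: "sgm_basis G A F" and sep: "separating V a E"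
  shows "separating V a F"
  unfolding separating_def
proof (intro allI impI)
  fix z assume z: "\<forall>e\<in>F. grad z e = 0"
  have F: "F \<subseteq> E" and ind: "sgm_indep G A F"
    and max: "\<And>F'. F \<subseteq> F' \<Longrightarrow> sgm_indep G A F' \<Longrightarrow> F' = F"
    using B by (auto simp: sgm_basis_def sgm_indep_def)
  have "grad z e = 0" if e: "e \<in> E" for e
  proof (cases "e \<in> F")
    case False
    then have "\<not> sgm_indep G A (insert e F)" using max[of "insert e F"] by blast
    then show ?thesis by (rule grad_zero_on_closure[OF ind _ e z])
  qed (use z in simp)
  then show "\<forall>v\<in>V. z v = 0" using sep by (simp add: separating_def)
qed

lemma separating_contains_basis:
  assumes S: "S \<subseteq> E" and sep: "separating V a S"
  obtains F where "sgm_basis G A F" and "F \<subseteq> S"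
proof -
  let ?I = "{F. F \<subseteq> S \<and> sgm_indep G A F}"
  have "finite S" using finite_subset[OF S finite_E] .
  then have "finite ?I" by (intro finite_subset[of ?I "Pow S"]) auto
  moreover have "{} \<in> ?I" by (simp add: sgm_indep_def)
  ultimately obtain F where F: "F \<in> ?I" and max: "\<And>F'. F' \<in> ?I \<Longrightarrow> F \<subseteq> F' \<Longrightarrow> F = F'"
    using finite_has_maximal2[of ?I "{}"] by metis
  have FE: "F \<subseteq> E" using F S by blast
  have finF: "finite F" using finite_subset[OF FE finite_E] .
  have sepF: "separating V a F"
    unfolding separating_def
  proof (intro allI impI)
    fix z assume z: "\<forall>e\<in>F. grad z e = 0"
    have "grad z e = 0" if e: "e \<in> S" for e
    proof (cases "e \<in> F")
      case False
      then have "\<not> sgm_indep G A (insert e F)" using max[of "insert e F"] F e by blast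
      then show ?thesis using grad_zero_on_closure[of F e z] F S e z by blast
    qed (use z in simp)
    then show "\<forall>v\<in>V. z v = 0" using sep by (simp add: separating_def)
  qed
  have "F' = F" if F': "F \<subseteq> F'" "sgm_indep G A F'" for F'
  proof (rule ccontr)
    assume "F' \<noteq> F"
    then obtain e where e: "e \<in> F'" "e \<notin> F" using F' by blast
    have F'E: "F' \<subseteq> E" using F'(2) by (simp add: sgm_indep_def)
    have finF': "finite F'" using finite_subset[OF F'E finite_E] .
    obtain c where c: "\<And>v. v \<in> V \<Longrightarrow> a v e = (\<Sum>f\<in>F. c f * a v f)"
      using span_or_separated[OF finite_V finF, of "\<lambda>v. a v e" a] sepF
      by (auto simp: separating_def)
    define b where "b f = (if f = e then -1 else if f \<in> F then c f else 0)" for f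
    have "(\<Sum>f\<in>F'. b f * a v f) = 0" if v: "v \<in> V" for v
    proof -
      have "(\<Sum>f\<in>F'. b f * a v f) = (\<Sum>f\<in>insert e F. b f * a v f)"
        using F'(1) e finF' by (intro sum.mono_neutral_right) (auto simp: b_def)
      also have "\<dots> = - a v e + (\<Sum>f\<in>F. b f * a v f)" using finF e by (simp add: b_def)
      also have "(\<Sum>f\<in>F. b f * a v f) = (\<Sum>f\<in>F. c f * a v f)"
        using e by (intro sum.cong) (auto simp: b_def)
      finally show ?thesis using c[OF v] by simp
    qed
    then have "b e = 0" using F'(2) e(1) unfolding sgm_indep_iff by blast
    then show False by (simp add: b_def)
  qed
  then have "sgm_basis G A F" using F by (auto simp: sgm_basis_def)
  then show thesis using that F by blast
qed

text \<open>
  The inverse \<open>c\<close> of the square matrix formed by the columns of a basis: spanning gives a right inverse,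
  independence makes it a left inverse, and the two ways of computing the trace of the product show that
  the matrix is square.
\<close>

lemma basis_inverse:
  assumes B: "sgm_basis G A F" and sep: "separating V a E"
  obtains c where "\<And>v w. v \<in> V \<Longrightarrow> w \<in> V \<Longrightarrow> (\<Sum>f\<in>F. c w f * a v f) = of_bool (v = w)"
    and "\<And>e f. e \<in> F \<Longrightarrow> f \<in> F \<Longrightarrow> (\<Sum>w\<in>V. c w f * a w e) = of_bool (e = f)"
    and "card F = card V"
proof -
  have ind: "sgm_indep G A F" and F: "F \<subseteq> E" using B by (auto simp: sgm_basis_def sgm_indep_def)
  have finF: "finite F" using finite_subset[OF F finite_E] .
  have "\<exists>c. \<forall>v\<in>V. of_bool (v = w) = (\<Sum>f\<in>F. c f * a v f)" if "w \<in> V" for w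
  proof -
    have "\<not> (\<exists>z. (\<forall>f\<in>F. grad z f = 0) \<and> (\<Sum>v\<in>V. z v * of_bool (v = w)) \<noteq> 0)"
      using basis_separating[OF B sep] that unfolding pairing_sum_of_bool[OF that] separating_def
      by blast
    then show ?thesis
      using span_or_separated[OF finite_V finF, of "\<lambda>v. of_bool (v = w)" a] by blast
  qed
  then obtain c where c: "\<And>v w. w \<in> V \<Longrightarrow> v \<in> V \<Longrightarrow> of_bool (v = w) = (\<Sum>f\<in>F. c w f * a v f)"
    by metis
  have left: "(\<Sum>w\<in>V. c w f * a w e) = of_bool (e = f)" if e: "e \<in> F" and f: "f \<in> F" for e f
  proof -
    define b where "b f = (\<Sum>w\<in>V. c w f * a w e) - of_bool (e = f)" for f
    have "(\<Sum>f\<in>F. b f * a v f) = 0" if v: "v \<in> V" for v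
    proof -
      have "(\<Sum>f\<in>F. (\<Sum>w\<in>V. c w f * a w e) * a v f) = (\<Sum>f\<in>F. \<Sum>w\<in>V. a w e * (c w f * a v f))"
        by (simp add: sum_distrib_left sum_distrib_right algebra_simps)
      also have "\<dots> = (\<Sum>w\<in>V. \<Sum>f\<in>F. a w e * (c w f * a v f))" by (rule sum.swap)
      also have "\<dots> = (\<Sum>w\<in>V. a w e * of_bool (w = v))"
      proof (rule sum.cong[OF refl])
        fix w assume "w \<in> V"
        then have "(\<Sum>f\<in>F. c w f * a v f) = of_bool (w = v)" using c[of w v] v by (cases "v = w") auto
        then show "(\<Sum>f\<in>F. a w e * (c w f * a v f)) = a w e * of_bool (w = v)"
          by (simp add: sum_distrib_left[symmetric])
      qed
      also have "\<dots> = a v e" by (rule pairing_sum_of_bool[OF v])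
      finally have 1: "(\<Sum>f\<in>F. (\<Sum>w\<in>V. c w f * a w e) * a v f) = a v e" .
      have "(\<Sum>f\<in>F. of_bool (e = f) * a v f) = (\<Sum>f\<in>F. if e = f then a v f else 0)"
        by (intro sum.cong) auto
      then have 2: "(\<Sum>f\<in>F. of_bool (e = f) * a v f) = a v e" using finF e by simp
      have "(\<Sum>f\<in>F. b f * a v f) = (\<Sum>f\<in>F. (\<Sum>w\<in>V. c w f * a w e) * a v f)
          - (\<Sum>f\<in>F. of_bool (e = f) * a v f)"
        by (simp add: b_def left_diff_distrib sum_subtractf)
      then show ?thesis using 1 2 by simp
    qed
    then have "b f = 0" using ind f unfolding sgm_indep_iff by blast
    then show ?thesis by (simp add: b_def)
  qed
  have right: "(\<Sum>f\<in>F. c w f * a v f) = of_bool (v = w)" if "v \<in> V" "w \<in> V" for v w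
    using c[OF that(2,1)] by simp
  have "real (card V) = (\<Sum>w\<in>V. \<Sum>f\<in>F. c w f * a w f)" by (simp add: right)
  also have "\<dots> = (\<Sum>f\<in>F. \<Sum>w\<in>V. c w f * a w f)" by (rule sum.swap)
  also have "\<dots> = real (card F)" by (simp add: left)
  finally have "card F = card V" by simp
  then show thesis using that[of c] right left by blast
qed

lemma basis_potential_exists:
  assumes B: "sgm_basis G A F" and sep: "separating V a E"
  obtains z where "\<And>e. e \<in> F \<Longrightarrow> grad z e = y e"
proof -
  obtain c where c: "\<And>e f. e \<in> F \<Longrightarrow> f \<in> F \<Longrightarrow> (\<Sum>w\<in>V. c w f * a w e) = of_bool (e = f)"
    using basis_inverse[OF B sep] by metis
  have finF: "finite F" using B finite_subset[OF _ finite_E] by (auto simp: sgm_basis_def sgm_indep_def)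
  define z where "z w = (\<Sum>f\<in>F. c w f * y f)" for w
  have "grad z e = y e" if e: "e \<in> F" for e
  proof -
    have "grad z e = (\<Sum>w\<in>V. \<Sum>f\<in>F. y f * (c w f * a w e))"
      unfolding pairing_def z_def sum_distrib_right by (intro sum.cong refl) (simp add: mult_ac)
    also have "\<dots> = (\<Sum>f\<in>F. \<Sum>w\<in>V. y f * (c w f * a w e))" by (rule sum.swap)
    also have "\<dots> = (\<Sum>f\<in>F. y f * of_bool (e = f))"
      by (intro sum.cong refl) (simp add: sum_distrib_left[symmetric] c e)
    also have "\<dots> = (\<Sum>f\<in>F. if e = f then y f else 0)" by (intro sum.cong) auto
    finally show ?thesis using e finF by simp
  qed
  then show thesis by (rule that)
qed

end

section \<open>Lattice points of the tocyclotope\<close>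

text \<open>
  A vector orthogonal to all columns is orthogonal to their span, which is the whole space, and hence to itself.
\<close>

lemma full_row_rank_left_kernel:
  fixes M :: "real mat"
  assumes M: "M \<in> carrier_mat n nc" and rank: "vec_space.rank n M = n"
    and u: "u \<in> carrier_vec n" and orth: "\<And>j. j < nc \<Longrightarrow> u \<bullet> col M j = 0"
  shows "u = 0\<^sub>v n"
proof -
  interpret vec_space "TYPE(real)" n .
  let ?P = "\<lambda>T. T \<subseteq> set (cols M) \<and> lin_indpt T"
  have carr: "set (cols M) \<subseteq> carrier_vec n" using M cols_dim by blast
  have "lin_indpt {}" using finite_lin_indpt2[of "{}"] by auto
  then obtain S where S: "maximal S ?P"
    using maximal_exists_superset[of "set (cols M)" ?P "{}"] by auto
  then have SP: "S \<subseteq> set (cols M)" "lin_indpt S" by (auto simp: maximal_def)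
  have Sc: "S \<subseteq> carrier_vec n" using SP carr by blast
  have "card S = n" using rank_card_indpt[OF M S] rank by simp
  then have "basis S"
    using dim_li_is_basis[of S] SP Sc dim_is_n finite_subset[OF SP(1)] by auto
  then have span: "span S = carrier_vec n" by (simp add: basis_def)
  have "u \<in> orthogonal_complement S"
    using u SP(1) orth M unfolding orthogonal_complement_def by (auto simp: cols_def)
  then have "u \<in> orthogonal_complement (carrier_vec n)"
    using in_orthogonal_complement_span[OF Sc] span by simp
  then have "u \<bullet> u = 0" using u by (simp add: orthogonal_complement_def)
  then show ?thesis using u
    by (intro eq_vecI) (auto simp: scalar_prod_def sum_nonneg_eq_0_iff)
qed

lemma append_cols_mult_vec:
  assumes M: "M \<in> carrier_mat n p" and N: "N \<in> carrier_mat n q"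
    and x: "x \<in> carrier_vec p" and y: "y \<in> carrier_vec q"
  shows "append_cols M N *\<^sub>v (x @\<^sub>v y) = M *\<^sub>v x + N *\<^sub>v y"
proof -
  have "append_cols M N *\<^sub>v (x @\<^sub>v y) = (M *\<^sub>v x + N *\<^sub>v y) @\<^sub>v (0\<^sub>m 0 p *\<^sub>v x + 0\<^sub>m 0 q *\<^sub>v y)"
    using M N x y unfolding append_cols_def by (subst four_block_mat_mult_vec) auto
  also have "\<dots> = M *\<^sub>v x + N *\<^sub>v y" using M N x y by (intro eq_vecI) auto
  finally show ?thesis .
qed

lemma sum_nth_distinct: "distinct xs \<Longrightarrow> (\<Sum>i<length xs. g (xs ! i)) = sum g (set xs)"
  by (intro sum.reindex_bij_betw bij_betw_nth) auto

locale binet = incidence G A for G :: "('v, 'e) signed_graph" and A +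
  fixes T :: "'e set" and vs :: "'v list" and rs ts :: "'e list"
  assumes vs: "distinct vs" "set vs = sg_nodes G"
    and rs: "distinct rs" "set rs = sg_edges G - T"
    and ts: "distinct ts" "set ts = T"
    and connected: "sg_connected G"
    and full_rank: "vec_space.rank (card (sg_nodes G))
      (map_mat real_of_int (incidence_mat A vs (rs @ ts))) = card (sg_nodes G)"
    and basis: "sgm_basis G A T" and connected_T: "sg_connected (sg_restrict G T)"
    and half_T: "sg_halfedges G \<noteq> {} \<Longrightarrow> T \<inter> sg_halfedges G \<noteq> {}"
begin

lemma length_vs: "length vs = card V"
  using vs distinct_card by metis

lemma T_subset: "T \<subseteq> E"
  using basis by (simp add: sgm_basis_def sgm_indep_def)

abbreviation mat_of :: "'e list \<Rightarrow> real mat" where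
  "mat_of es \<equiv> map_mat real_of_int (incidence_mat A vs es)"

abbreviation coords :: "('v \<Rightarrow> real) \<Rightarrow> real vec" where
  "coords z \<equiv> vec (length vs) (\<lambda>i. z (vs ! i))"

lemma transpose_mat_of_mult:
  "transpose_mat (mat_of es) *\<^sub>v coords z = vec (length es) (\<lambda>j. grad z (es ! j))"
proof (rule eq_vecI)
  fix j assume "j < dim_vec (vec (length es) (\<lambda>j. grad z (es ! j)))"
  then have j: "j < length es" by simp
  have "(transpose_mat (mat_of es) *\<^sub>v coords z) $ j =
      (\<Sum>i<length vs. z (vs ! i) * a (vs ! i) (es ! j))"
    using j by (simp add: incidence_mat_def scalar_prod_def atLeast0LessThan mult.commute)
  also have "\<dots> = grad z (es ! j)"
    unfolding pairing_def vs(2)[symmetric] by (rule sum_nth_distinct[OF vs(1)])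
  finally show "(transpose_mat (mat_of es) *\<^sub>v coords z) $ j = vec (length es) (\<lambda>j. grad z (es ! j)) $ j"
    using j by simp
qed (simp add: incidence_mat_def)

text \<open>
  The rank hypothesis in dual form.
\<close>

lemma separating_E: "separating V a E"
  unfolding separating_def
proof (intro allI impI)
  fix z assume z: "\<forall>e\<in>E. grad z e = 0"
  have carr: "mat_of (rs @ ts) \<in> carrier_mat (card V) (length (rs @ ts))"
    by (simp add: incidence_mat_def length_vs)
  have "coords z = 0\<^sub>v (card V)"
  proof (rule full_row_rank_left_kernel[OF carr full_rank])
    show "coords z \<in> carrier_vec (card V)" using length_vs by simp
    fix j assume j: "j < length (rs @ ts)"
    have "coords z \<bullet> col (mat_of (rs @ ts)) j = (transpose_mat (mat_of (rs @ ts)) *\<^sub>v coords z) $ j"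
      using j carr by (simp add: comm_scalar_prod[of _ "card V"] incidence_mat_def length_vs)
    also have "\<dots> = grad z ((rs @ ts) ! j)" using j unfolding transpose_mat_of_mult by simp
    also have "(rs @ ts) ! j \<in> E"
      using nth_mem[OF j] rs ts T_subset by auto
    then have "grad z ((rs @ ts) ! j) = 0" using z by blast
    finally show "coords z \<bullet> col (mat_of (rs @ ts)) j = 0" .
  qed
  then have "z (vs ! i) = 0" if "i < length vs" for i
    using that length_vs by (metis index_vec index_zero_vec(1))
  then show "\<forall>v\<in>V. z v = 0" using vs(2) by (metis in_set_conv_nth)
qed

lemma card_T: "card T = card V"
  using basis_inverse[OF basis separating_E] by metis

lemma length_ts: "length ts = card V"
  using card_T ts distinct_card by metis

abbreviation Binet :: "real mat" where "Binet \<equiv> binet_mat A vs rs ts"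

text \<open>
  The rows of \<open>[I | -B\<^sup>T]\<close> are orthogonal to the row space of the incidence matrix: \<open>B\<^sup>T\<close> recovers a
  vector \<open>grad z\<close> on the edges outside the basis from its values on the basis.
\<close>

lemma binet_transpose:
  shows "Binet \<in> carrier_mat (length ts) (length rs)"
    and "transpose_mat Binet *\<^sub>v vec (length ts) (\<lambda>j. grad z (ts ! j)) =
      vec (length rs) (\<lambda>i. grad z (rs ! i))"
proof -
  let ?n = "card V"
  have MT: "mat_of ts \<in> carrier_mat ?n ?n" and MR: "mat_of rs \<in> carrier_mat ?n (length rs)"
    by (simp_all add: incidence_mat_def length_vs length_ts)
  obtain c where c: "\<And>v w. v \<in> V \<Longrightarrow> w \<in> V \<Longrightarrow> (\<Sum>f\<in>T. c w f * a v f) = of_bool (v = w)"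
    using basis_inverse[OF basis separating_E] by metis
  define N where "N = mat ?n ?n (\<lambda>(i, j). c (vs ! j) (ts ! i))"
  have N: "N \<in> carrier_mat ?n ?n" by (simp add: N_def)
  have right: "mat_of ts * N = 1\<^sub>m ?n"
  proof (rule eq_matI)
    fix i j assume "i < dim_row (1\<^sub>m ?n :: real mat)" "j < dim_col (1\<^sub>m ?n :: real mat)"
    then have ij: "i < ?n" "j < ?n" by simp_all
    have "(mat_of ts * N) $$ (i, j) = (\<Sum>k<length ts. c (vs ! j) (ts ! k) * a (vs ! i) (ts ! k))"
      using ij by (simp add: N_def incidence_mat_def scalar_prod_def length_vs length_ts
          atLeast0LessThan mult.commute)
    also have "\<dots> = (\<Sum>f\<in>T. c (vs ! j) f * a (vs ! i) f)"
      unfolding ts(2)[symmetric] by (rule sum_nth_distinct[OF ts(1)])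
    also have "\<dots> = of_bool (vs ! i = vs ! j)"
    proof (rule c)
      show "vs ! i \<in> V" "vs ! j \<in> V"
        using nth_mem[of i vs] nth_mem[of j vs] ij length_vs vs(2) by simp_all
    qed
    also have "\<dots> = 1\<^sub>m ?n $$ (i, j)"
      using ij vs(1) length_vs by (simp add: nth_eq_iff_index_eq)
    finally show "(mat_of ts * N) $$ (i, j) = 1\<^sub>m ?n $$ (i, j)" .
  qed (use MT N in auto)
  have left: "N * mat_of ts = 1\<^sub>m ?n" by (rule mat_mult_left_right_inverse[OF MT N right])
  have "mat_of ts \<in> Units (ring_mat TYPE(real) ?n ())"
    using MT N left right by (auto simp: Units_def ring_mat_def)
  then obtain Q where Q: "mat_inverse (mat_of ts) = Some Q"
    using mat_inverse(1)[OF MT, of "()"] by (cases "mat_inverse (mat_of ts)") auto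
  have inv: "mat_of ts * Q = 1\<^sub>m ?n" "Q \<in> carrier_mat ?n ?n" using mat_inverse(2)[OF MT Q] by auto
  have B: "Binet = Q * mat_of rs" by (simp add: binet_mat_def Q)
  show "Binet \<in> carrier_mat (length ts) (length rs)" using inv(2) MR by (simp add: B length_ts)
  have u: "coords z \<in> carrier_vec ?n" by (simp add: length_vs)
  have "transpose_mat Binet *\<^sub>v vec (length ts) (\<lambda>j. grad z (ts ! j)) =
      (transpose_mat (mat_of rs) * transpose_mat Q) *\<^sub>v (transpose_mat (mat_of ts) *\<^sub>v coords z)"
    unfolding transpose_mat_of_mult B using inv(2) MR by (simp add: transpose_mult)
  also have "\<dots> = transpose_mat (mat_of rs) *\<^sub>v
      ((transpose_mat Q * transpose_mat (mat_of ts)) *\<^sub>v coords z)"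
    using inv(2) MR MT u by (simp add: assoc_mult_mat_vec[of _ _ ?n _ ?n])
  also have "transpose_mat Q * transpose_mat (mat_of ts) = 1\<^sub>m ?n"
    using transpose_mult[OF MT inv(2)] inv(1) by simp
  also have "1\<^sub>m ?n *\<^sub>v coords z = coords z" using u by simp
  finally show "transpose_mat Binet *\<^sub>v vec (length ts) (\<lambda>j. grad z (ts ! j)) =
      vec (length rs) (\<lambda>i. grad z (rs ! i))"
    unfolding transpose_mat_of_mult .
qed

text \<open>
  The \<open>i\<close>-th coordinate of \<open>B\<^sup>T y\<^sub>T\<close>.
\<close>

definition fundamental :: "('e \<Rightarrow> real) \<Rightarrow> nat \<Rightarrow> real" where
  "fundamental y i = (transpose_mat Binet *\<^sub>v vec (length ts) (\<lambda>j. y (ts ! j))) $ i"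

lemma fundamental_grad:
  assumes "\<And>e. e \<in> T \<Longrightarrow> y e = grad z e" and "i < length rs"
  shows "fundamental y i = grad z (rs ! i)"
proof -
  have "vec (length ts) (\<lambda>j. y (ts ! j)) = vec (length ts) (\<lambda>j. grad z (ts ! j))"
    using assms(1) ts(2) by (intro eq_vecI) auto
  then show ?thesis using assms(2) by (simp add: fundamental_def binet_transpose(2))
qed

text \<open>
  The scaled parameters \<open>t * x\<close> of a point of the zonotope are regrouped as an edge vector \<open>y\<close>.
\<close>

lemma dilated_lattice_points_iff:
  assumes t: "t > 0"
  shows "w \<in> dilated_lattice_points (length rs) (tocyclotope A vs rs ts) t \<longleftrightarrow>
    w \<in> carrier_vec (length rs) \<and> (\<forall>i<length rs. w $ i \<in> \<int>) \<and>
    (\<exists>y. (\<forall>e\<in>E. 0 \<le> y e \<and> y e \<le> real t) \<and>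
      (\<forall>i<length rs. w $ i = y (rs ! i) - fundamental y i))"
    (is "_ \<longleftrightarrow> _ \<and> _ \<and> ?Y")
proof -
  let ?k = "length rs" and ?n = "length ts"
  let ?M = "append_cols (1\<^sub>m ?k) (- transpose_mat Binet)"
  have BT: "transpose_mat Binet \<in> carrier_mat ?k ?n" using binet_transpose(1) by simp
  have dim: "dim_col ?M = ?k + ?n" using BT by (simp add: append_cols_def)
  have mult: "?M *\<^sub>v (x @\<^sub>v y) = x - transpose_mat Binet *\<^sub>v y"
    if "x \<in> carrier_vec ?k" "y \<in> carrier_vec ?n" for x y
    using that BT by (subst append_cols_mult_vec[of _ ?k ?k _ ?n]) auto
  have point: "(real t \<cdot>\<^sub>v (x - transpose_mat Binet *\<^sub>v y)) $ i =
      real t * x $ i - (transpose_mat Binet *\<^sub>v (real t \<cdot>\<^sub>v y)) $ i"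
    if "x \<in> carrier_vec ?k" "y \<in> carrier_vec ?n" "i < ?k" for x y i
    using that BT by (simp add: right_diff_distrib mult_mat_vec[of _ ?k ?n])
  have "?Y \<longleftrightarrow> (\<exists>p \<in> zonotope ?M. w = real t \<cdot>\<^sub>v p)" if w: "w \<in> carrier_vec ?k"
  proof
    assume ?Y
    then obtain y where y: "\<And>e. e \<in> E \<Longrightarrow> 0 \<le> y e \<and> y e \<le> real t"
      "\<And>i. i < ?k \<Longrightarrow> w $ i = y (rs ! i) - fundamental y i" by blast
    define x1 where "x1 = vec ?k (\<lambda>i. y (rs ! i) / t)"
    define x2 where "x2 = vec ?n (\<lambda>j. y (ts ! j) / t)"
    have xc: "x1 \<in> carrier_vec ?k" "x2 \<in> carrier_vec ?n" by (simp_all add: x1_def x2_def)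
    have "0 \<le> (x1 @\<^sub>v x2) $ i \<and> (x1 @\<^sub>v x2) $ i \<le> 1" if i: "i < ?k + ?n" for i
    proof (cases "i < ?k")
      case True
      then have "rs ! i \<in> E" using rs(2) nth_mem by blast
      then show ?thesis using True y(1) t by (simp add: x1_def x2_def)
    next
      case False
      then have "ts ! (i - ?k) \<in> E" using ts(2) i T_subset nth_mem[of "i - ?k" ts] by auto
      then show ?thesis using False i y(1) t by (simp add: x1_def x2_def)
    qed
    then have "?M *\<^sub>v (x1 @\<^sub>v x2) \<in> zonotope ?M"
      unfolding zonotope_def dim using xc by auto
    moreover have "w = real t \<cdot>\<^sub>v (?M *\<^sub>v (x1 @\<^sub>v x2))"
    proof (rule eq_vecI)
      have tx2: "real t \<cdot>\<^sub>v x2 = vec ?n (\<lambda>j. y (ts ! j))" using t by (auto simp: x2_def)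
      fix i assume "i < dim_vec (real t \<cdot>\<^sub>v (?M *\<^sub>v (x1 @\<^sub>v x2)))"
      then have i: "i < ?k" using BT by (simp add: mult[OF xc])
      have "(real t \<cdot>\<^sub>v (?M *\<^sub>v (x1 @\<^sub>v x2))) $ i = real t * x1 $ i - fundamental y i"
        unfolding mult[OF xc] point[OF xc i] tx2 fundamental_def ..
      then show "w $ i = (real t \<cdot>\<^sub>v (?M *\<^sub>v (x1 @\<^sub>v x2))) $ i" using y(2)[OF i] i t by (simp add: x1_def)
    qed (use w BT in \<open>simp add: mult[OF xc]\<close>)
    ultimately show "\<exists>p \<in> zonotope ?M. w = real t \<cdot>\<^sub>v p" by blast
  next
    assume "\<exists>p \<in> zonotope ?M. w = real t \<cdot>\<^sub>v p"
    then obtain x where x: "x \<in> carrier_vec (?k + ?n)" "\<And>i. i < ?k + ?n \<Longrightarrow> 0 \<le> x $ i \<and> x $ i \<le> 1"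
      and wx: "w = real t \<cdot>\<^sub>v (?M *\<^sub>v x)" unfolding zonotope_def dim by blast
    define x1 where "x1 = vec_first x ?k"
    define x2 where "x2 = vec_last x ?n"
    have xc: "x1 \<in> carrier_vec ?k" "x2 \<in> carrier_vec ?n" and x12: "x1 @\<^sub>v x2 = x"
      using x(1) by (simp_all add: x1_def x2_def)
    have x1: "0 \<le> x1 $ i \<and> x1 $ i \<le> 1" if "i < ?k" for i
      using x(2)[of i] that x12[symmetric] xc by simp
    have x2: "0 \<le> x2 $ j \<and> x2 $ j \<le> 1" if "j < ?n" for j
      using x(2)[of "?k + j"] that x12[symmetric] xc by simp
    define y where "y e = (if e \<in> T then real t * x2 $ (THE j. j < ?n \<and> ts ! j = e)
      else real t * x1 $ (THE i. i < ?k \<and> rs ! i = e))" for e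
    have yts: "y (ts ! j) = real t * x2 $ j" if "j < ?n" for j
    proof -
      have "(THE j'. j' < ?n \<and> ts ! j' = ts ! j) = j"
        using that ts(1) by (intro the_equality) (auto simp: nth_eq_iff_index_eq)
      then show ?thesis using that ts(2) nth_mem[OF that] by (simp add: y_def)
    qed
    have yrs: "y (rs ! i) = real t * x1 $ i" if "i < ?k" for i
    proof -
      have "(THE i'. i' < ?k \<and> rs ! i' = rs ! i) = i"
        using that rs(1) by (intro the_equality) (auto simp: nth_eq_iff_index_eq)
      moreover have "rs ! i \<notin> T" using rs(2) nth_mem[OF that] by auto
      ultimately show ?thesis by (simp add: y_def)
    qed
    have "0 \<le> y e \<and> y e \<le> real t" if e: "e \<in> E" for e
    proof (cases "e \<in> T")
      case True
      then obtain j where "j < ?n" "e = ts ! j" using ts(2) by (metis in_set_conv_nth)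
      then show ?thesis using x2[of j] yts[of j] by (simp add: mult_left_le)
    next
      case False
      then obtain i where "i < ?k" "e = rs ! i" using rs(2) e by (metis DiffI in_set_conv_nth)
      then show ?thesis using x1[of i] yrs[of i] by (simp add: mult_left_le)
    qed
    moreover have "w $ i = y (rs ! i) - fundamental y i" if i: "i < ?k" for i
    proof -
      have "real t \<cdot>\<^sub>v x2 = vec ?n (\<lambda>j. y (ts ! j))"
        using xc(2) by (intro eq_vecI) (auto simp: yts)
      then show ?thesis
        unfolding wx x12[symmetric] mult[OF xc] point[OF xc i] fundamental_def by (simp add: yrs[OF i])
    qed
    ultimately show ?Y by blast
  qed
  then show ?thesis
    unfolding dilated_lattice_points_def tocyclotope_def by auto
qed

lemma unbalanced_T: "unbalanced T" and unbalanced_E: "unbalanced E"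
  using basis_separating[OF basis separating_E] separating_E
    separating_iff_unbalanced[OF T_subset] separating_iff_unbalanced[of E] by auto

lemma comps_E: "comps E = {V}"
  by (rule comps_connected) (use connected in \<open>simp_all add: sg_restrict_def\<close>)

lemma V_nonempty: "V \<noteq> {}"
  using connected by (simp add: sg_connected_def)

text \<open>
  This is the integrality of the binet matrix: if \<open>grad z\<close> is integral on the basis, it is integral on all edges.
  It rests on the choice of a connected basis that contains a halfedge if there is one.
\<close>

lemma potentials_T: "potentials T = potentials E"
proof -
  have half: "T \<inter> sg_halfedges G = {} \<longleftrightarrow> E \<inter> sg_halfedges G = {}"
    using half_T T_subset by (auto simp: sg_halfedges_def)
  have "p \<in> potentials T \<longleftrightarrow> p \<in> potentials E" for p
    unfolding potentials_connected_iff[OF subset_refl unbalanced_E comps_E]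
      potentials_connected_iff[OF T_subset unbalanced_T comps_connected[OF T_subset connected_T]]
      half ..
  then show ?thesis by blast
qed

text \<open>
  Since the kernel of \<open>[I | -B\<^sup>T]\<close> consists of the vectors \<open>grad z\<close>, a lattice point \<open>w\<close> corresponds to the
  class of the edge vector that is \<open>w\<close> outside the basis and zero on it. Every class contains exactly
  one integer vector that vanishes on the basis.
\<close>

lemma bij_betw_lattice_points_classes:
  assumes t: "t > 0"
  shows "bij_betw (\<lambda>w. lat.lattice_rel E ``
      {\<lambda>e. if e \<in> T then 0 else \<lfloor>w $ (THE i. i < length rs \<and> rs ! i = e)\<rfloor>})
    (dilated_lattice_points (length rs) (tocyclotope A vs rs ts) t)
    (lat.reach E (\<lambda>_. t) // lat.lattice_rel E)"
proof -
  let ?D = "dilated_lattice_points (length rs) (tocyclotope A vs rs ts) t"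
  let ?R = "lat.lattice_rel E"
  define pt where "pt w e = (if e \<in> T then 0 else \<lfloor>w $ (THE i. i < length rs \<and> rs ! i = e)\<rfloor>)"
    for w :: "real vec" and e
  have sepT: "separating V a T" by (rule basis_separating[OF basis separating_E])
  have idx: "(THE i'. i' < length rs \<and> rs ! i' = rs ! i) = i" if "i < length rs" for i
    using that rs(1) by (intro the_equality) (auto simp: nth_eq_iff_index_eq)
  have notT: "rs ! i \<notin> T" "rs ! i \<in> E" if "i < length rs" for i
    using rs(2) nth_mem[OF that] by auto
  have ptT: "pt w e = 0" if "e \<in> T" for w e using that by (simp add: pt_def)
  have ptR: "real_of_int (pt w (rs ! i)) = w $ i" if "i < length rs" "w $ i \<in> \<int>" for w i
    using that notT[OF that(1)] by (auto simp: pt_def idx)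
  have edge: "e \<in> T \<or> (\<exists>i<length rs. e = rs ! i)" if "e \<in> E" for e
    using that rs(2) by (metis DiffI in_set_conv_nth)
  have D: "w \<in> carrier_vec (length rs)" "\<And>i. i < length rs \<Longrightarrow> w $ i \<in> \<int>" if "w \<in> ?D" for w
    using that unfolding dilated_lattice_points_iff[OF t] by auto
  have inj: "inj_on (\<lambda>w. ?R `` {pt w}) ?D"
  proof (rule inj_onI)
    fix w w' assume w: "w \<in> ?D" and w': "w' \<in> ?D" and eq: "?R `` {pt w} = ?R `` {pt w'}"
    have "(pt w, pt w') \<in> ?R" using eq_equiv_class[OF eq lat.equiv_lattice_rel] by simp
    then obtain p where p: "\<And>e. e \<in> E \<Longrightarrow> real_of_int (pt w e) - real_of_int (pt w' e) = grad p e"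
      by (auto simp: lat.lattice_rel_def)
    have "grad p e = 0" if "e \<in> T" for e using p[of e] that T_subset by (auto simp: ptT)
    then have "\<forall>v\<in>V. p v = 0" using sepT by (simp add: separating_def)
    then have "grad p e = 0" for e by (simp add: pairing_def)
    then have "w $ i = w' $ i" if "i < length rs" for i
      using p[OF notT(2)[OF that]] ptR[OF that D(2)[OF w that]] ptR[OF that D(2)[OF w' that]] by simp
    then show "w = w'" using D(1)[OF w] D(1)[OF w'] by (intro eq_vecI) auto
  qed
  have "(\<lambda>w. ?R `` {pt w}) ` ?D = lat.reach E (\<lambda>_. t) // ?R"
  proof (intro equalityI subsetI)
    fix c assume "c \<in> (\<lambda>w. ?R `` {pt w}) ` ?D"
    then obtain w where w: "w \<in> ?D" "c = ?R `` {pt w}" by blast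
    obtain y where y: "\<And>e. e \<in> E \<Longrightarrow> 0 \<le> y e \<and> y e \<le> real t"
      "\<And>i. i < length rs \<Longrightarrow> w $ i = y (rs ! i) - fundamental y i"
      using w(1) unfolding dilated_lattice_points_iff[OF t] by blast
    obtain z where z: "\<And>e. e \<in> T \<Longrightarrow> grad z e = y e"
      using basis_potential_exists[OF basis separating_E, of y] by blast
    have neg: "grad (\<lambda>v. 0 - z v) e = - grad z e" for e by (simp only: pairing_diff) simp
    have "real_of_int (pt w e) - grad (\<lambda>v. 0 - z v) e = y e" if e: "e \<in> E" for e
    proof (cases "e \<in> T")
      case True
      then show ?thesis by (simp only: neg ptT z of_int_0 diff_minus_eq_add add_0)
    next
      case False
      then obtain i where i: "i < length rs" "e = rs ! i" using edge[OF e] by blast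
      have "fundamental y i = grad z e" using fundamental_grad[of y z i] z i by simp
      then show ?thesis using y(2)[OF i(1)] ptR[OF i(1) D(2)[OF w(1) i(1)]] unfolding neg i(2) by simp
    qed
    then have "pt w \<in> lat.reach E (\<lambda>_. t)"
      unfolding lat.reach_def using y(1) by (intro CollectI exI[of _ "\<lambda>v. 0 - z v"]) simp
    then show "c \<in> lat.reach E (\<lambda>_. t) // ?R" unfolding w(2) by (rule quotientI)
  next
    fix c assume "c \<in> lat.reach E (\<lambda>_. t) // ?R"
    then obtain x where x: "x \<in> lat.reach E (\<lambda>_. t)" "c = ?R `` {x}" by (auto elim: quotientE)
    \<comment> \<open>Normalise \<open>x\<close> to vanish on \<open>T\<close>; the correction \<open>grad p\<close> is integral by \<open>potentials_T\<close>.\<close>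
    obtain p where p: "\<And>e. e \<in> T \<Longrightarrow> grad p e = real_of_int (x e)"
      using basis_potential_exists[OF basis separating_E, of "\<lambda>e. real_of_int (x e)"] by blast
    have "p \<in> potentials T" using p by (simp add: potentials_def)
    then have pE: "p \<in> potentials E" by (simp add: potentials_T)
    then have pint: "grad p e \<in> \<int>" if "e \<in> E" for e using that by (simp add: potentials_def)
    obtain z where z: "\<And>e. e \<in> E \<Longrightarrow> 0 \<le> real_of_int (x e) - grad z e \<and> real_of_int (x e) - grad z e \<le> real t"
      using x(1) by (auto simp: lat.reach_def)
    define w where "w = vec (length rs) (\<lambda>i. real_of_int (x (rs ! i)) - grad p (rs ! i))"
    have wint: "w $ i \<in> \<int>" if "i < length rs" for i
      using pint[OF notT(2)[OF that]] that by (simp add: w_def)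
    define y where "y e = real_of_int (x e) - grad z e" for e
    have "fundamental y i = grad (\<lambda>v. p v - z v) (rs ! i)" if "i < length rs" for i
      using that by (intro fundamental_grad) (simp_all add: y_def pairing_diff p)
    then have "w $ i = y (rs ! i) - fundamental y i" if "i < length rs" for i
      using that by (simp add: w_def y_def pairing_diff)
    then have wD: "w \<in> ?D"
      unfolding dilated_lattice_points_iff[OF t] using wint z
      by (intro conjI exI[of _ y]) (auto simp: w_def y_def)
    have "real_of_int (x e) - real_of_int (pt w e) = grad p e" if e: "e \<in> E" for e
    proof (cases "e \<in> T")
      case True
      then show ?thesis by (simp add: ptT p)
    next
      case False
      then obtain i where i: "i < length rs" "e = rs ! i" using edge[OF e] by blast
      then show ?thesis using ptR[OF i(1) wint[OF i(1)]] by (simp add: w_def)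
    qed
    then have "(x, pt w) \<in> ?R" using pE unfolding lat.lattice_rel_def by blast
    then have "c = ?R `` {pt w}" using equiv_class_eq[OF lat.equiv_lattice_rel] x(2) by simp
    then show "c \<in> (\<lambda>w. ?R `` {pt w}) ` ?D" using wD by blast
  qed
  with inj show ?thesis unfolding bij_betw_def pt_def by blast
qed

definition coefficient :: "'e set \<Rightarrow> real" where
  "coefficient S = (if sg_halfedges G \<noteq> {} then 2 ^ mplc G S else 2 powi (int (mplc G S) - 1))"

lemma count_lattice_points:
  assumes t: "t > 0"
  shows "finite (dilated_lattice_points (length rs) (tocyclotope A vs rs ts) t)"
    and "real (card (dilated_lattice_points (length rs) (tocyclotope A vs rs ts) t)) =
      (\<Sum>S | S \<subseteq> E \<and> (\<exists>F. sgm_basis G A F \<and> F \<subseteq> S). coefficient S * real t ^ (card E - card S))"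
proof -
  let ?D = "dilated_lattice_points (length rs) (tocyclotope A vs rs ts) t"
  let ?SS = "{S. S \<subseteq> E \<and> (\<exists>F. sgm_basis G A F \<and> F \<subseteq> S)}"
  let ?U = "{U. U \<subseteq> E \<and> separating V a (E - U)}"
  have fin0: "finite (lat.reach S (\<lambda>_. 0) // lat.lattice_rel S)"
    if "S \<subseteq> E" "separating V a S" for S
    using count_zero_eq_mplc(1)[OF comps_E that(1) _ V_nonempty] that separating_iff_unbalanced by blast
  have reach: "lat.reach E (\<lambda>f. if f \<in> E then t else 0) = lat.reach E (\<lambda>_. t)"
    by (rule lat.reach_cong) simp
  note main = lat.count_eq_sum_separating[OF fin0 subset_refl separating_E subset_refl, of "\<lambda>_. t",
      unfolded lat.count_def reach]
  have bij: "bij_betw ((-) E) ?SS ?U"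
  proof (rule bij_betw_byWitness[where f' = "(-) E"])
    show "(-) E ` ?SS \<subseteq> ?U"
    proof
      fix U assume "U \<in> (-) E ` ?SS"
      then obtain S F where S: "U = E - S" "S \<subseteq> E" "sgm_basis G A F" "F \<subseteq> S" by blast
      then have "E - U = S" by blast
      then show "U \<in> ?U" using S separating_mono[OF basis_separating[OF S(3) separating_E] S(4)] by auto
    qed
    show "(-) E ` ?U \<subseteq> ?SS"
      using separating_contains_basis by (fastforce elim!: separating_contains_basis[rotated])
  qed auto
  have coeff: "real (lat.count S (\<lambda>_. 0)) = coefficient S" if S: "S \<in> ?SS" for S
  proof -
    obtain F where F: "sgm_basis G A F" "F \<subseteq> S" using S by blast
    have "unbalanced S"
      using separating_mono[OF basis_separating[OF F(1) separating_E] F(2)] S separating_iff_unbalanced by blast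
    then show ?thesis
      using count_zero_eq_mplc(2,3)[OF comps_E _ _ V_nonempty, of S] S by (simp add: coefficient_def)
  qed
  note D = bij_betw_lattice_points_classes[OF t]
  show "finite ?D" using main bij_betw_finite[OF D] by simp
  have "real (card ?D) = real (\<Sum>U\<in>?U. (\<Prod>f\<in>U. t) * lat.count (E - U) (\<lambda>_. 0))"
    using main bij_betw_same_card[OF D] by (simp add: lat.count_def)
  also have "(\<Sum>U\<in>?U. (\<Prod>f\<in>U. t) * lat.count (E - U) (\<lambda>_. 0)) =
      (\<Sum>S\<in>?SS. (\<Prod>f\<in>E - S. t) * lat.count (E - (E - S)) (\<lambda>_. 0))"
    by (rule sum.reindex_bij_betw[OF bij, symmetric])
  also have "real \<dots> = (\<Sum>S\<in>?SS. coefficient S * real t ^ (card E - card S))"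
    unfolding of_nat_sum
  proof (rule sum.cong[OF refl])
    fix S assume S: "S \<in> ?SS"
    then have "E - (E - S) = S" "card (E - S) = card E - card S"
      using finite_E by (auto intro: card_Diff_subset finite_subset)
    then show "real ((\<Prod>f\<in>E - S. t) * lat.count (E - (E - S)) (\<lambda>_. 0)) =
        coefficient S * real t ^ (card E - card S)"
      using coeff[OF S] by simp
  qed
  finally show "real (card ?D) = (\<Sum>S\<in>?SS. coefficient S * real t ^ (card E - card S))" .
qed

end

theorem theorem6p3:
  fixes G :: "('v, 'e) signed_graph"
    and A :: "'v \<Rightarrow> 'e \<Rightarrow> int"
    and T :: "'e set"
    and vs :: "'v list" and rs ts :: "'e list"
    and n m :: nat
  assumes "is_signed_graph G" and "sg_connected G"
    and "n = card (sg_nodes G)" and "m = card (sg_edges G)"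
    and "is_incidence G A"
    and "distinct vs" and "set vs = sg_nodes G"
    and "distinct rs" and "set rs = sg_edges G - T"
    and "distinct ts" and "set ts = T"
    and "vec_space.rank n (map_mat real_of_int (incidence_mat A vs (rs @ ts))) = n"
    and "sgm_basis G A T" and "sg_connected (sg_restrict G T)"
    and "sg_halfedges G \<noteq> {} \<Longrightarrow> T \<inter> sg_halfedges G \<noteq> {}"
  shows "is_ehrhart_polynomial (m - n) (tocyclotope A vs rs ts)
    (if sg_halfedges G \<noteq> {}
     then \<Sum>S | S \<subseteq> sg_edges G \<and> (\<exists>F. sgm_basis G A F \<and> F \<subseteq> S).
            monom (2 ^ mplc G S) (m - card S)
     else \<Sum>S | S \<subseteq> sg_edges G \<and> (\<exists>F. sgm_basis G A F \<and> F \<subseteq> S).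
            monom (2 powi (int (mplc G S) - 1)) (m - card S))"
    (is "is_ehrhart_polynomial _ _ ?p")
proof -
  interpret binet G A T vs rs ts
    using assms by unfold_locales auto
  have "length rs = card (E - T)" using assms(8,9) distinct_card by metis
  also have "\<dots> = m - n"
    using T_subset card_T finite_E assms(3,4) by (simp add: card_Diff_subset finite_subset)
  finally have k: "length rs = m - n" .
  have "?p = (\<Sum>S | S \<subseteq> E \<and> (\<exists>F. sgm_basis G A F \<and> F \<subseteq> S). monom (coefficient S) (m - card S))"
    by (simp add: coefficient_def)
  then have "poly ?p (real t) = (\<Sum>S | S \<subseteq> E \<and> (\<exists>F. sgm_basis G A F \<and> F \<subseteq> S).
      coefficient S * real t ^ (card E - card S))" for t
    by (simp add: poly_sum poly_monom assms(4))
  then show ?thesis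
    using count_lattice_points unfolding is_ehrhart_polynomial_def k[symmetric] by simp
qed

end
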